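(* Let $k$ be an algebraically closed field of characteristic $0$ and let $H$ be a biconnected finite dimensional Frobenius weak Hopf algebra over $k$ such that $S^2|_{H_{\min}}=\mathrm{id}$. If $\mathrm{Tr}(S^2)\neq0$ (the trace of $S^2:H\to H$), then $H$ and $H^*$ are semisimple.
   Context: A weak Hopf algebra over a field $k$ is a $k$-vector space $H$ with an associative unital algebra structure $(m,1)$, a coassociative counital coalgebra structure $(\Delta,\epsilon)$ (Sweedler notation $\Delta(h)=h_{(1)}\otimes h_{(2)}$) and a linear map $S:H\to H$ (antipode) such that for all $f,g,h\in H$: $\Delta(hg)=\Delta(h)\Delta(g)$; $(\Delta\otimes\mathrm{id})\Delta(1)=(\Delta(1)\otimes1)(1\otimes\Delta(1))=(1\otimes\Delta(1))(\Delta(1)\otimes1)$; $\epsilon(fgh)=\epsilon(fg_{(1)})\epsilon(g_{(2)}h)=\epsilon(fg_{(2)})\epsilon(g_{(1)}h)$; $m(\mathrm{id}\otimes S)\Delta(h)=(\epsilon\otimes\mathrm{id})(\Delta(1)(h\otimes1))$; $m(S\otimes\mathrm{id})\Delta(h)=(\mathrm{id}\otimes\epsilon)((1\otimes h)\Delta(1))$; $S(h)=S(h_{(1)})h_{(2)}S(h_{(3)})$. ($\Delta(1)\neq1\otimes1$ in general.) Bases: $H_t=\varepsilon_t(H)$, $H_s=\varepsilon_s(H)$, where $\varepsilon_t(h)=\epsilon(1_{(1)}h)1_{(2)}$, $\varepsilon_s(h)=1_{(1)}\epsilon(h1_{(2)})$; they are commuting separable subalgebras, and $H_{\min}=H_tH_s$.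 $Z(H)$ is the center of $H$. If $\dim_kH<\infty$, $H^*$ is a weak Hopf algebra via $\langle\phi\psi,h\rangle=\langle\phi\otimes\psi,\Delta(h)\rangle$, $\langle\Delta(\phi),h\otimes g\rangle=\langle\phi,hg\rangle$, $\langle S(\phi),h\rangle=\langle\phi,S(h)\rangle$, with unit $\epsilon$ and counit $\phi\mapsto\langle\phi,1\rangle$; its bases are denoted $H_t^*$, $H_s^*$. $H$ is connected if $H_s\cap Z(H)=k1$ (equivalently $H_s^*\cap H_t^*=k\epsilon$), and biconnected if both $H$ and $H^*$ are connected. $H$ is called Frobenius if it is a Frobenius algebra; semisimple means semisimple as an algebra. *)

theory Defs
  imports
    "HOL-Computational_Algebra.Polynomial"
    "HOL-Library.Function_Algebras"
begin

text \<open>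
  The base field is a type \<open>'k::field\<close>. A vector space is a subspace \<open>elems V\<close> of an
  ambient vector space, the latter being a type with scalar multiplication \<open>scl V\<close>
  in the sense of the library locale \<open>vector_space\<close>. Working with subspaces rather than
  whole types makes tensor products, iterated tensor products and duals objects of the
  same kind. Linearity is only ever required on \<open>elems V\<close>.
\<close>

record ('k, 'v) vspace =
  elems :: "'v set"
  scl :: "'k \<Rightarrow> 'v \<Rightarrow> 'v"

locale vspace =
  fixes V :: "('k::field, 'v::ab_group_add, 'x) vspace_scheme"
  assumes ambient: "vector_space (scl V)"
    and subspace_elems: "module.subspace (scl V) (elems V)"

definition ground :: "('k::field, 'k) vspace" where
  "ground = \<lparr>elems = UNIV, scl = (*)\<rparr>"

definition linear_map ::
  "('k::field, 'v::ab_group_add, 'x) vspace_scheme \<Rightarrow>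
   ('k, 'w::ab_group_add, 'y) vspace_scheme \<Rightarrow> ('v \<Rightarrow> 'w) \<Rightarrow> bool" where
  "linear_map V W f \<longleftrightarrow>
     (\<forall>x\<in>elems V. f x \<in> elems W) \<and>
     (\<forall>x\<in>elems V. \<forall>y\<in>elems V. f (x + y) = f x + f y) \<and>
     (\<forall>c. \<forall>x\<in>elems V. f (scl V c x) = scl W c (f x))"

definition bilinear_map ::
  "('k::field, 'v::ab_group_add, 'x) vspace_scheme \<Rightarrow>
   ('k, 'w::ab_group_add, 'y) vspace_scheme \<Rightarrow>
   ('k, 'u::ab_group_add, 'z) vspace_scheme \<Rightarrow> ('v \<Rightarrow> 'w \<Rightarrow> 'u) \<Rightarrow> bool" where
  "bilinear_map V W U f \<longleftrightarrow>
     (\<forall>x\<in>elems V. linear_map W U (f x)) \<and>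
     (\<forall>y\<in>elems W. linear_map V U (\<lambda>x. f x y))"

definition finite_dim :: "('k::field, 'v::ab_group_add, 'x) vspace_scheme \<Rightarrow> bool" where
  "finite_dim V \<longleftrightarrow> (\<exists>B. finite B \<and> module.span (scl V) B = elems V)"

text \<open>The trace of an endomorphism of \<open>elems V\<close> (finite-dimensional); the value does not
  depend on the basis chosen.\<close>

definition trace_on :: "('k::field, 'v::ab_group_add, 'x) vspace_scheme \<Rightarrow> ('v \<Rightarrow> 'v) \<Rightarrow> 'k" where
  "trace_on V f =
     (let B = (SOME B. \<not> module.dependent (scl V) B \<and> module.span (scl V) B = elems V)
      in \<Sum>b\<in>B. module.representation (scl V) B (f b) b)"


section \<open>Tensor products\<close>

text \<open>
  Over a field, the canonical map from \<open>V \<otimes> W\<close> to the dual of the space of bilinear forms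
  on \<open>V \<times> W\<close> is injective. We take its image as the tensor product: the simple tensor
  \<open>v \<otimes> w\<close> is evaluation of bilinear forms at \<open>(v, w)\<close>.
\<close>

type_synonym ('k, 'v, 'w) tens = "('v \<Rightarrow> 'w \<Rightarrow> 'k) \<Rightarrow> 'k"

definition simple_tensor ::
  "('k::field, 'v::ab_group_add, 'x) vspace_scheme \<Rightarrow>
   ('k, 'w::ab_group_add, 'y) vspace_scheme \<Rightarrow> 'v \<Rightarrow> 'w \<Rightarrow> ('k, 'v, 'w) tens" where
  "simple_tensor V W v w = (\<lambda>\<beta>. if bilinear_map V W ground \<beta> then \<beta> v w else 0)"

definition tensor ::
  "('k::field, 'v::ab_group_add, 'x) vspace_scheme \<Rightarrow>
   ('k, 'w::ab_group_add, 'y) vspace_scheme \<Rightarrow> ('k, ('k, 'v, 'w) tens) vspace" where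
  "tensor V W =
     \<lparr>elems = module.span (\<lambda>c t \<beta>. c * t \<beta>) {simple_tensor V W v w |v w. v \<in> elems V \<and> w \<in> elems W},
      scl = (\<lambda>c t \<beta>. c * t \<beta>)\<rparr>"

text \<open>
  A representation of a tensor as a finite sum of simple tensors. It is only used to form
  sums \<open>\<Sum>(v, w)\<leftarrow>sweedler V W t. f v w\<close> with \<open>f\<close> bilinear, i.e. to apply to \<open>t\<close> the linear
  map induced by \<open>f\<close>; by \<open>sweedler_sum_well_defined\<close> below the choice is then immaterial.
\<close>

definition sweedler ::
  "('k::field, 'v::ab_group_add, 'x) vspace_scheme \<Rightarrow>
   ('k, 'w::ab_group_add, 'y) vspace_scheme \<Rightarrow> ('k, 'v, 'w) tens \<Rightarrow> ('v \<times> 'w) list" where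
  "sweedler V W t =
     (SOME ps. set ps \<subseteq> elems V \<times> elems W \<and> (\<Sum>(v, w)\<leftarrow>ps. simple_tensor V W v w) = t)"

lemma tensor_representation:
  fixes V :: "('k::field, 'v::ab_group_add, 'x) vspace_scheme"
    and W :: "('k, 'w::ab_group_add, 'y) vspace_scheme"
  assumes "t \<in> elems (tensor V W)" and "vspace V"
  shows "\<exists>ps. set ps \<subseteq> elems V \<times> elems W \<and> (\<Sum>(v, w)\<leftarrow>ps. simple_tensor V W v w) = t"
proof -
  let ?s = "\<lambda>c (t :: ('k, 'v, 'w) tens) \<beta>. c * t \<beta>"
  interpret T: module ?s
    by unfold_locales (auto simp: fun_eq_iff algebra_simps)
  interpret V: vector_space "scl V" using assms(2) by (simp add: vspace.ambient)
  have scV: "scl V c v \<in> elems V" if "v \<in> elems V" for c v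
    using V.subspace_scale[OF vspace.subspace_elems[OF assms(2)] that] .
  have "t \<in> T.span {simple_tensor V W v w |v w. v \<in> elems V \<and> w \<in> elems W}"
    using assms(1) by (simp add: tensor_def)
  then show ?thesis
  proof (induction rule: T.span_induct_alt)
    case base
    show ?case by (intro exI[of _ "[]"]) (simp add: zero_fun_def)
  next
    case (step c x y)
    then obtain v w ps where vw: "x = simple_tensor V W v w" "v \<in> elems V" "w \<in> elems W"
      and ps: "set ps \<subseteq> elems V \<times> elems W" "(\<Sum>(v, w)\<leftarrow>ps. simple_tensor V W v w) = y"
      by auto
    have "(\<lambda>\<beta>. c * x \<beta>) = simple_tensor V W (scl V c v) w"
      using vw by (auto simp: fun_eq_iff simple_tensor_def bilinear_map_def linear_map_def ground_def)
    then show ?case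
      using vw ps scV by (intro exI[of _ "(scl V c v, w) # ps"]) auto
  qed
qed

lemma sweedler_sum_well_defined:
  fixes U :: "('k::field, 'u::ab_group_add, 'z) vspace_scheme"
  assumes U: "vspace U" and f: "bilinear_map V W U f"
    and ps: "set ps \<subseteq> elems V \<times> elems W"
    and t: "(\<Sum>(v, w)\<leftarrow>ps. simple_tensor V W v w) = t"
  shows "(\<Sum>(v, w)\<leftarrow>sweedler V W t. f v w) = (\<Sum>(v, w)\<leftarrow>ps. f v w)"
proof (rule ccontr)
  let ?qs = "sweedler V W t"
  have qs: "set ?qs \<subseteq> elems V \<times> elems W" "(\<Sum>(v, w)\<leftarrow>?qs. simple_tensor V W v w) = t"
    using someI[of "\<lambda>ps. set ps \<subseteq> elems V \<times> elems W \<and>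
        (\<Sum>(v, w)\<leftarrow>ps. simple_tensor V W v w) = t" ps] ps t
    unfolding sweedler_def by auto
  interpret U: vector_space "scl U" using U by (simp add: vspace.ambient)
  interpret G: vector_space "(*) :: 'k \<Rightarrow> 'k \<Rightarrow> 'k"
    by unfold_locales (auto simp: algebra_simps)
  interpret P: vector_space_pair "scl U" "(*) :: 'k \<Rightarrow> 'k \<Rightarrow> 'k" ..
  define d where "d = (\<Sum>(v, w)\<leftarrow>?qs. f v w) - (\<Sum>(v, w)\<leftarrow>ps. f v w)"
  assume "(\<Sum>(v, w)\<leftarrow>?qs. f v w) \<noteq> (\<Sum>(v, w)\<leftarrow>ps. f v w)"
  then have "\<not> U.dependent {d}"
    by (simp add: d_def U.dependent_single)
  from P.linear_independent_extend[OF this, of "\<lambda>_. 1"] obtain \<phi>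
    where \<phi>: "Vector_Spaces.linear (scl U) (*) \<phi>" "\<phi> d = 1" by auto
  interpret \<phi>: Vector_Spaces.linear "scl U" "(*)" \<phi> by (fact \<phi>(1))
  define \<beta> where "\<beta> = (\<lambda>v w. \<phi> (f v w))"
  have \<beta>: "bilinear_map V W ground \<beta>"
    using f by (auto simp: bilinear_map_def linear_map_def ground_def \<beta>_def \<phi>.add \<phi>.scale)
  have ev: "(\<Sum>(v, w)\<leftarrow>rs. simple_tensor V W v w) \<beta> = \<phi> (\<Sum>(v, w)\<leftarrow>rs. f v w)" for rs
  proof (induction rs)
    case (Cons r rs)
    obtain v w where "r = (v, w)" by (cases r)
    moreover have "simple_tensor V W v w \<beta> = \<phi> (f v w)"
      using \<beta> by (simp add: simple_tensor_def) (simp add: \<beta>_def)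
    ultimately show ?case using Cons by (simp add: \<phi>.add)
  qed (simp add: \<phi>.zero)
  have "\<phi> d = 0"
    using ev[of ?qs] ev[of ps] qs(2) t by (simp add: d_def \<phi>.diff)
  with \<phi>(2) show False by simp
qed


section \<open>Weak Hopf algebras\<close>

record ('k, 'v) alg = "('k, 'v) vspace" +
  mul :: "'v \<Rightarrow> 'v \<Rightarrow> 'v" (infixl "\<cdot>\<index>" 70)
  unit_elt :: "'v"

record ('k, 'v) weak_hopf = "('k, 'v) alg" +
  comul :: "'v \<Rightarrow> ('k, 'v, 'v) tens"
  counit :: "'v \<Rightarrow> 'k"
  antipode :: "'v \<Rightarrow> 'v"

locale k_algebra = vspace H
  for H :: "('k::field, 'v::ab_group_add, 'x) alg_scheme" (structure) +
  assumes mul_bilinear: "bilinear_map H H H (mul H)"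
    and unit_closed: "unit_elt H \<in> elems H"
    and mul_assoc: "\<And>x y z. \<lbrakk>x \<in> elems H; y \<in> elems H; z \<in> elems H\<rbrakk> \<Longrightarrow>
          (x \<cdot> y) \<cdot> z = x \<cdot> (y \<cdot> z)"
    and unit_left: "\<And>x. x \<in> elems H \<Longrightarrow> unit_elt H \<cdot> x = x"
    and unit_right: "\<And>x. x \<in> elems H \<Longrightarrow> x \<cdot> unit_elt H = x"

text \<open>The pairs \<open>(h\<^sub>(\<^sub>1\<^sub>), h\<^sub>(\<^sub>2\<^sub>))\<close> of Sweedler's notation for \<open>\<Delta>(h)\<close>.\<close>

definition legs :: "('k::field, 'v::ab_group_add, 'x) weak_hopf_scheme \<Rightarrow> 'v \<Rightarrow> ('v \<times> 'v) list" where
  "legs H h = sweedler H H (comul H h)"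

text \<open>\<open>a \<otimes> b \<otimes> c\<close> as an element of \<open>H \<otimes> (H \<otimes> H)\<close>.\<close>

definition simple_tensor3 ::
  "('k::field, 'v::ab_group_add, 'x) vspace_scheme \<Rightarrow> 'v \<Rightarrow> 'v \<Rightarrow> 'v \<Rightarrow>
   ('k, 'v, ('k, 'v, 'v) tens) tens" where
  "simple_tensor3 H a b c = simple_tensor H (tensor H H) a (simple_tensor H H b c)"

text \<open>\<open>\<epsilon>\<^sub>t(h) = \<epsilon>(1\<^sub>(\<^sub>1\<^sub>)h)1\<^sub>(\<^sub>2\<^sub>)\<close> and \<open>\<epsilon>\<^sub>s(h) = 1\<^sub>(\<^sub>1\<^sub>)\<epsilon>(h1\<^sub>(\<^sub>2\<^sub>))\<close>\<close>

definition target_map :: "('k::field, 'v::ab_group_add, 'x) weak_hopf_scheme \<Rightarrow> 'v \<Rightarrow> 'v" where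
  "target_map H h =
     (\<Sum>(a, b)\<leftarrow>legs H (unit_elt H). scl H (counit H (a \<cdot>\<^bsub>H\<^esub> h)) b)"

definition source_map :: "('k::field, 'v::ab_group_add, 'x) weak_hopf_scheme \<Rightarrow> 'v \<Rightarrow> 'v" where
  "source_map H h =
     (\<Sum>(a, b)\<leftarrow>legs H (unit_elt H). scl H (counit H (h \<cdot>\<^bsub>H\<^esub> b)) a)"

locale weak_hopf_algebra = k_algebra H
  for H :: "('k::field, 'v::ab_group_add, 'x) weak_hopf_scheme" (structure) +
  assumes comul_linear: "linear_map H (tensor H H) (comul H)"
    and counit_linear: "linear_map H ground (counit H)"
    and coassoc: "\<And>h. h \<in> elems H \<Longrightarrow>
          (\<Sum>(a, b)\<leftarrow>legs H h. \<Sum>(a1, a2)\<leftarrow>legs H a. simple_tensor3 H a1 a2 b) =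
          (\<Sum>(a, b)\<leftarrow>legs H h. \<Sum>(b1, b2)\<leftarrow>legs H b. simple_tensor3 H a b1 b2)"
    and counit_left: "\<And>h. h \<in> elems H \<Longrightarrow> (\<Sum>(a, b)\<leftarrow>legs H h. scl H (counit H a) b) = h"
    and counit_right: "\<And>h. h \<in> elems H \<Longrightarrow> (\<Sum>(a, b)\<leftarrow>legs H h. scl H (counit H b) a) = h"
    and comul_mul: "\<And>h g. \<lbrakk>h \<in> elems H; g \<in> elems H\<rbrakk> \<Longrightarrow>
          comul H (h \<cdot> g) =
          (\<Sum>(a, b)\<leftarrow>legs H h. \<Sum>(c, d)\<leftarrow>legs H g. simple_tensor H H (a \<cdot> c) (b \<cdot> d))"
    and comul_unit1:
          "(\<Sum>(a, b)\<leftarrow>legs H (unit_elt H). \<Sum>(a1, a2)\<leftarrow>legs H a. simple_tensor3 H a1 a2 b) =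
           (\<Sum>(a, b)\<leftarrow>legs H (unit_elt H). \<Sum>(c, d)\<leftarrow>legs H (unit_elt H). simple_tensor3 H a (b \<cdot> c) d)"
    and comul_unit2:
          "(\<Sum>(a, b)\<leftarrow>legs H (unit_elt H). \<Sum>(a1, a2)\<leftarrow>legs H a. simple_tensor3 H a1 a2 b) =
           (\<Sum>(a, b)\<leftarrow>legs H (unit_elt H). \<Sum>(c, d)\<leftarrow>legs H (unit_elt H). simple_tensor3 H a (c \<cdot> b) d)"
    and counit_mul1: "\<And>f g h. \<lbrakk>f \<in> elems H; g \<in> elems H; h \<in> elems H\<rbrakk> \<Longrightarrow>
          counit H (f \<cdot> g \<cdot> h) = (\<Sum>(a, b)\<leftarrow>legs H g. counit H (f \<cdot> a) * counit H (b \<cdot> h))"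
    and counit_mul2: "\<And>f g h. \<lbrakk>f \<in> elems H; g \<in> elems H; h \<in> elems H\<rbrakk> \<Longrightarrow>
          counit H (f \<cdot> g \<cdot> h) = (\<Sum>(a, b)\<leftarrow>legs H g. counit H (f \<cdot> b) * counit H (a \<cdot> h))"
    and antipode_linear: "linear_map H H (antipode H)"
    and antipode_target: "\<And>h. h \<in> elems H \<Longrightarrow>
          (\<Sum>(a, b)\<leftarrow>legs H h. a \<cdot> antipode H b) = target_map H h"
    and antipode_source: "\<And>h. h \<in> elems H \<Longrightarrow>
          (\<Sum>(a, b)\<leftarrow>legs H h. antipode H a \<cdot> b) = source_map H h"
    and antipode_conv: "\<And>h. h \<in> elems H \<Longrightarrow>
          antipode H h =
          (\<Sum>(a, b)\<leftarrow>legs H h. \<Sum>(b1, b2)\<leftarrow>legs H b. antipode H a \<cdot> b1 \<cdot> antipode H b2)"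

definition target_base :: "('k::field, 'v::ab_group_add, 'x) weak_hopf_scheme \<Rightarrow> 'v set" where
  "target_base H = target_map H ` elems H"

definition source_base :: "('k::field, 'v::ab_group_add, 'x) weak_hopf_scheme \<Rightarrow> 'v set" where
  "source_base H = source_map H ` elems H"

definition minimal_part :: "('k::field, 'v::ab_group_add, 'x) weak_hopf_scheme \<Rightarrow> 'v set" where
  "minimal_part H =
     module.span (scl H) {a \<cdot>\<^bsub>H\<^esub> b |a b. a \<in> target_base H \<and> b \<in> source_base H}"


section \<open>The dual\<close>

text \<open>Functionals are normalised to vanish outside \<open>elems V\<close>, so that equality of
  functionals is equality on \<open>elems V\<close>.\<close>

definition dual_space ::
  "('k::field, 'v::ab_group_add, 'x) vspace_scheme \<Rightarrow> ('k, 'v \<Rightarrow> 'k) vspace" where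
  "dual_space V =
     \<lparr>elems = {\<phi>. linear_map V ground \<phi> \<and> (\<forall>x. x \<notin> elems V \<longrightarrow> \<phi> x = 0)},
      scl = (\<lambda>c \<phi> x. c * \<phi> x)\<rparr>"

definition dual ::
  "('k::field, 'v::ab_group_add, 'x) weak_hopf_scheme \<Rightarrow> ('k, 'v \<Rightarrow> 'k) weak_hopf" where
  "dual H =
     \<lparr>elems = elems (dual_space H),
      scl = scl (dual_space H),
      mul = (\<lambda>\<phi> \<psi> h. if h \<in> elems H then \<Sum>(a, b)\<leftarrow>legs H h. \<phi> a * \<psi> b else 0),
      unit_elt = (\<lambda>h. if h \<in> elems H then counit H h else 0),
      comul = (\<lambda>\<phi>. THE t. t \<in> elems (tensor (dual_space H) (dual_space H)) \<and>
        (\<forall>h\<in>elems H. \<forall>g\<in>elems H.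
           (\<Sum>(\<alpha>, \<beta>)\<leftarrow>sweedler (dual_space H) (dual_space H) t. \<alpha> h * \<beta> g) = \<phi> (h \<cdot>\<^bsub>H\<^esub> g))),
      counit = (\<lambda>\<phi>. \<phi> (unit_elt H)),
      antipode = (\<lambda>\<phi> h. if h \<in> elems H then \<phi> (antipode H h) else 0)\<rparr>"


section \<open>Connectedness, Frobenius and semisimple algebras\<close>

definition center :: "('k::field, 'v::ab_group_add, 'x) alg_scheme \<Rightarrow> 'v set" where
  "center A = {z \<in> elems A. \<forall>x\<in>elems A. z \<cdot>\<^bsub>A\<^esub> x = x \<cdot>\<^bsub>A\<^esub> z}"

definition connected_wha :: "('k::field, 'v::ab_group_add, 'x) weak_hopf_scheme \<Rightarrow> bool" where
  "connected_wha H \<longleftrightarrow> source_base H \<inter> center H = {scl H c (unit_elt H) |c. True}"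

definition biconnected :: "('k::field, 'v::ab_group_add, 'x) weak_hopf_scheme \<Rightarrow> bool" where
  "biconnected H \<longleftrightarrow> connected_wha H \<and> connected_wha (dual H)"

definition frobenius_algebra :: "('k::field, 'v::ab_group_add, 'x) alg_scheme \<Rightarrow> bool" where
  "frobenius_algebra A \<longleftrightarrow>
     finite_dim A \<and>
     (\<exists>f. linear_map A ground f \<and>
        (\<forall>x\<in>elems A. (\<forall>y\<in>elems A. f (x \<cdot>\<^bsub>A\<^esub> y) = 0) \<longrightarrow> x = 0) \<and>
        (\<forall>y\<in>elems A. (\<forall>x\<in>elems A. f (x \<cdot>\<^bsub>A\<^esub> y) = 0) \<longrightarrow> y = 0))"

definition left_ideal :: "('k::field, 'v::ab_group_add, 'x) alg_scheme \<Rightarrow> 'v set \<Rightarrow> bool" where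
  "left_ideal A I \<longleftrightarrow>
     I \<subseteq> elems A \<and> module.subspace (scl A) I \<and> (\<forall>a\<in>elems A. \<forall>x\<in>I. a \<cdot>\<^bsub>A\<^esub> x \<in> I)"

text \<open>Complete reducibility of the left regular module.\<close>

definition semisimple :: "('k::field, 'v::ab_group_add, 'x) alg_scheme \<Rightarrow> bool" where
  "semisimple A \<longleftrightarrow>
     (\<forall>I. left_ideal A I \<longrightarrow>
        (\<exists>J. left_ideal A J \<and> I \<inter> J = {0} \<and> {x + y |x y. x \<in> I \<and> y \<in> J} = elems A))"

end

theory Submission
  imports Defs
begin

text \<open>
  A trace produces an integral. Write \<open>h\<^sub>1 \<otimes> h\<^sub>2\<close> for \<open>\<Delta>(h)\<close>, \<open>u \<otimes> v\<close> for \<open>\<Delta>(1)\<close>, and \<open>\<tau>\<close>, \<open>\<sigma>\<close>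
  for the counital maps \<open>\<epsilon>\<^sub>t\<close>, \<open>\<epsilon>\<^sub>s\<close>. Consider

    \<open>l \<in> H\<close>, \<open>\<phi>(l) = Tr(y \<mapsto> \<phi>(y\<^sub>1) S\<^sup>2(y\<^sub>2))\<close>,   and   \<open>\<chi> \<in> H\<^sup>*\<close>, \<open>\<chi>(x) = Tr(y \<mapsto> x S\<^sup>2(y))\<close>.

  The square of the antipode plays the role of the isomorphism of a module (or comodule) with
  its double dual, which is what makes a trace invariant: expanding \<open>h y\<^sub>1 \<otimes> S\<^sup>2(y\<^sub>2)\<close> by the
  antipode axioms and moving one factor around the trace turns \<open>h\<close> into \<open>\<tau>(h)\<close>, so \<open>l\<close> is a left
  integral of \<open>H\<close> (\<open>trace_integral_left\<close>). In the same way \<open>\<chi>\<close> is a left integral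
  of \<open>H\<^sup>*\<close> (\<open>trace_functional_left\<close>). Both are tied to the hypothesis on the trace, because
  \<open>\<epsilon>(l) = \<chi>(1) = Tr(S\<^sup>2)\<close>.

  A left integral gives a Casimir element, \<open>l\<^sub>1 \<otimes> S(l\<^sub>2)\<close> in \<open>H \<otimes> H\<close>, respectively the
  bilinear form \<open>\<chi>(x S(y))\<close> seen as an element of \<open>H\<^sup>* \<otimes> H\<^sup>*\<close>. If multiplying its legs yields
  a nonzero multiple of the unit, averaging a linear projection over it makes the projection
  a module map, and every left ideal has a complement (\<open>semisimple_if_separable\<close>).

  In a Hopf algebra the product of the legs is automatically a scalar. Here it is only
  an element of a base, and connectedness makes it a scalar: for \<open>H\<close> the product is \<open>\<tau>(l)\<close>,
  which is central (\<open>target_integral_central\<close>), and its image under the antipode is a central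
  element of the source base; for \<open>H\<^sup>*\<close> it is the functional \<open>\<epsilon>(w _)\<close> with \<open>w = u \<chi>(v)\<close>, and
  \<open>w\<close> lies in both bases of \<open>H\<close>, so that \<open>\<epsilon>(_ w)\<close> is central in \<open>H\<^sup>*\<close> and belongs to its
  source base (\<open>connected_dual_trivial\<close>). Applying the counit identifies
  the scalar, up to the factor \<open>\<epsilon>(1)\<close>, with \<open>Tr(S\<^sup>2)\<close>, which is not zero.
  That \<open>S\<^sup>2\<close> is the identity on the bases is used to pass from the target
  base to the source base and to move elements of the bases past the antipode.

  All identities between tensors are stated by applying multilinear forms to them. This
  replaces equations in iterated tensor products by equations between sums in the field.
\<close>

section \<open>Semisimplicity from a separability element\<close>

context k_algebra
begin

lemma mul_add_left: "x \<in> elems H \<Longrightarrow> y \<in> elems H \<Longrightarrow> z \<in> elems H \<Longrightarrow> (x + y) \<cdot> z = x \<cdot> z + y \<cdot> z"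
  and mul_add_right: "x \<in> elems H \<Longrightarrow> y \<in> elems H \<Longrightarrow> z \<in> elems H \<Longrightarrow> z \<cdot> (x + y) = z \<cdot> x + z \<cdot> y"
  and mul_scale_left: "x \<in> elems H \<Longrightarrow> z \<in> elems H \<Longrightarrow> scl H c x \<cdot> z = scl H c (x \<cdot> z)"
  and mul_scale_right: "x \<in> elems H \<Longrightarrow> z \<in> elems H \<Longrightarrow> z \<cdot> scl H c x = scl H c (z \<cdot> x)"
  and mul_in: "x \<in> elems H \<Longrightarrow> z \<in> elems H \<Longrightarrow> x \<cdot> z \<in> elems H"
  using mul_bilinear by (auto simp: bilinear_map_def linear_map_def)

text \<open>
  The element \<open>\<Sum> x\<^sub>i \<otimes> y\<^sub>i\<close> is a separability idempotent: the matrix \<open>\<alpha>\<close> expresses that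
  \<open>\<Sum> a x\<^sub>i \<otimes> y\<^sub>i = \<Sum> x\<^sub>i \<otimes> y\<^sub>i a\<close> without mentioning tensors. Averaging a linear projection
  \<open>g\<close> onto a left ideal to \<open>m \<mapsto> \<Sum> x\<^sub>i g(y\<^sub>i m)\<close> keeps it a projection and makes it a module
  map; its kernel is the complement (Maschke's argument).
\<close>

lemma semisimple_if_separable:
  fixes x y :: "'i \<Rightarrow> 'v"
  assumes I: "finite I" and xy: "\<And>i. i \<in> I \<Longrightarrow> x i \<in> elems H" "\<And>i. i \<in> I \<Longrightarrow> y i \<in> elems H"
    and unit: "(\<Sum>i\<in>I. x i \<cdot> y i) = unit_elt H"
    and casimir: "\<And>a. a \<in> elems H \<Longrightarrow> \<exists>\<alpha>.
        (\<forall>j\<in>I. a \<cdot> x j = (\<Sum>i\<in>I. scl H (\<alpha> i j) (x i))) \<and>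
        (\<forall>i\<in>I. y i \<cdot> a = (\<Sum>j\<in>I. scl H (\<alpha> i j) (y j)))"
  shows "semisimple H"
  unfolding semisimple_def
proof (intro allI impI)
  interpret V: vector_space "scl H" by (rule ambient)
  interpret P: vector_space_pair "scl H" "scl H" ..
  let ?E = "elems H"
  have E: "V.subspace ?E" by (rule subspace_elems)
  note [simp] = V.subspace_add[OF E] V.subspace_scale[OF E] V.subspace_0[OF E] mul_in xy
  have [simp]: "sum g J \<in> ?E" if "\<And>i. i \<in> J \<Longrightarrow> g i \<in> ?E" for g and J :: "'i set"
    using that by (rule V.subspace_sum[OF E])
  have sum_left: "sum g J \<cdot> z = (\<Sum>i\<in>J. g i \<cdot> z)"
    if "\<And>i. i \<in> J \<Longrightarrow> g i \<in> ?E" "z \<in> ?E" for g z and J :: "'i set"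
    using that mul_scale_left[of 0 z 0]
    by (induction J rule: infinite_finite_induct) (auto simp: mul_add_left)
  have sum_right: "z \<cdot> sum g J = (\<Sum>i\<in>J. z \<cdot> g i)"
    if "\<And>i. i \<in> J \<Longrightarrow> g i \<in> ?E" "z \<in> ?E" for g z and J :: "'i set"
    using that mul_scale_right[of 0 z 0]
    by (induction J rule: infinite_finite_induct) (auto simp: mul_add_right)
  fix M assume M: "left_ideal H M"
  then have M_sub: "V.subspace M" and ME: "M \<subseteq> ?E"
    and ideal: "\<And>a m. a \<in> ?E \<Longrightarrow> m \<in> M \<Longrightarrow> a \<cdot> m \<in> M"
    by (auto simp: left_ideal_def)
  obtain g where g: "range g \<subseteq> M" "Vector_Spaces.linear (scl H) (scl H) g" "\<And>v. v \<in> M \<Longrightarrow> g v = v"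
    using P.linear_exists_left_inverse_on[OF V.linear_id M_sub] by auto
  interpret g: Vector_Spaces.linear "scl H" "scl H" g by (rule g(2))
  have gM: "g v \<in> M" and [simp]: "g v \<in> ?E" for v using g(1) ME by auto
  define Q where "Q m = (\<Sum>i\<in>I. x i \<cdot> g (y i \<cdot> m))" for m
  have QM: "Q m \<in> M" for m
    unfolding Q_def using xy by (intro V.subspace_sum[OF M_sub] ideal gM) auto
  have Q_id: "Q m = m" if m: "m \<in> M" for m
  proof -
    have [simp]: "m \<in> ?E" using m ME by auto
    have "Q m = (\<Sum>i\<in>I. x i \<cdot> y i \<cdot> m)"
      unfolding Q_def by (intro sum.cong refl) (simp add: g(3) ideal m mul_assoc)
    also have "\<dots> = (\<Sum>i\<in>I. x i \<cdot> y i) \<cdot> m"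
      by (rule sum_left[symmetric]) auto
    finally show ?thesis by (simp add: unit unit_left)
  qed
  have Q_mul: "Q (a \<cdot> m) = a \<cdot> Q m" if [simp]: "a \<in> ?E" "m \<in> ?E" for a m
  proof -
    obtain \<alpha> where \<alpha>: "\<And>j. j \<in> I \<Longrightarrow> a \<cdot> x j = (\<Sum>i\<in>I. scl H (\<alpha> i j) (x i))"
      "\<And>i. i \<in> I \<Longrightarrow> y i \<cdot> a = (\<Sum>j\<in>I. scl H (\<alpha> i j) (y j))"
      using casimir[of a] by auto
    have "a \<cdot> Q m = (\<Sum>j\<in>I. a \<cdot> x j \<cdot> g (y j \<cdot> m))"
      unfolding Q_def by (subst sum_right) (auto simp: mul_assoc)
    also have "\<dots> = (\<Sum>j\<in>I. \<Sum>i\<in>I. scl H (\<alpha> i j) (x i \<cdot> g (y j \<cdot> m)))"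
      by (intro sum.cong refl) (simp add: \<alpha>(1) sum_left mul_scale_left)
    also have "\<dots> = (\<Sum>i\<in>I. \<Sum>j\<in>I. scl H (\<alpha> i j) (x i \<cdot> g (y j \<cdot> m)))"
      by (rule sum.swap)
    also have "\<dots> = Q (a \<cdot> m)"
      unfolding Q_def
    proof (intro sum.cong refl)
      fix i assume i: "i \<in> I"
      have "y i \<cdot> (a \<cdot> m) = (\<Sum>j\<in>I. scl H (\<alpha> i j) (y j \<cdot> m))"
        using i by (subst mul_assoc[symmetric]) (auto simp: \<alpha>(2) sum_left mul_scale_left)
      then show "(\<Sum>j\<in>I. scl H (\<alpha> i j) (x i \<cdot> g (y j \<cdot> m))) = x i \<cdot> g (y i \<cdot> (a \<cdot> m))"
        using i by (simp add: g.sum g.scale sum_right mul_scale_right)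
    qed
    finally show ?thesis ..
  qed
  have Q_add: "Q (m + n) = Q m + Q n" if "m \<in> ?E" "n \<in> ?E" for m n
    using that unfolding Q_def by (simp add: mul_add_right g.add sum.distrib)
  have Q_scale: "Q (scl H c m) = scl H c (Q m)" if "m \<in> ?E" for c m
    using that unfolding Q_def by (simp add: mul_scale_right g.scale V.scale_sum_right)
  let ?K = "{m \<in> ?E. Q m = 0}"
  have "V.subspace ?K"
    using Q_scale[of 0 0] by (auto intro!: V.subspaceI simp: Q_add Q_scale)
  moreover have "a \<cdot> (0::'v) = 0" if "a \<in> ?E" for a
    using mul_scale_right[of 0 a 0] that by simp
  ultimately have K: "left_ideal H ?K"
    by (auto simp: left_ideal_def Q_mul)
  have "M \<inter> ?K = {0}"
    using Q_id V.subspace_0[OF M_sub] ME by fastforce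
  moreover have "{u + v |u v. u \<in> M \<and> v \<in> ?K} = ?E"
  proof (intro equalityI subsetI)
    fix m assume m: "m \<in> ?E"
    have "Q m \<in> ?E" using QM ME by auto
    then have n: "m - Q m \<in> ?E" using m by (intro V.subspace_diff[OF E])
    have "Q m = Q (Q m + (m - Q m))" by simp
    also have "\<dots> = Q m + Q (m - Q m)"
      using Q_add[OF \<open>Q m \<in> ?E\<close> n] Q_id[OF QM] by simp
    finally have "m - Q m \<in> ?K" using n by simp
    moreover have "m = Q m + (m - Q m)" by simp
    ultimately show "m \<in> {u + v |u v. u \<in> M \<and> v \<in> ?K}" using QM by blast
  next
    fix m assume "m \<in> {u + v |u v. u \<in> M \<and> v \<in> ?K}"
    then show "m \<in> ?E" using ME by auto
  qed
  ultimately show "\<exists>J. left_ideal H J \<and> M \<inter> J = {0} \<and> {u + v |u v. u \<in> M \<and> v \<in> J} = ?E"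
    using K by blast
qed

end

section \<open>Sweedler calculus in coordinates\<close>

text \<open>
  Rules deciding linearity in one variable of an expression built from the operations of the
  weak Hopf algebra; used as introduction rules, they discharge the multilinearity conditions
  on test forms. A proof about a fixed form adds the rules for that form.
\<close>

named_theorems lins

locale based_weak_hopf_algebra = weak_hopf_algebra H
  for H :: "('k::field, 'v::ab_group_add, 'x) weak_hopf_scheme" (structure) +
  fixes B :: "'v set"
  assumes finite_B: "finite B"
    and independent_B: "\<not> module.dependent (scl H) B"
    and span_B: "module.span (scl H) B = elems H"
begin

sublocale amb: vector_space "scl H" by (rule ambient)

abbreviation E where "E \<equiv> elems H"
abbreviation S where "S \<equiv> antipode H"
abbreviation counit' ("\<epsilon>") where "\<epsilon> \<equiv> counit H"
abbreviation one' ("\<one>") where "\<one> \<equiv> unit_elt H"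
abbreviation target' ("\<tau>") where "\<tau> \<equiv> target_map H"
abbreviation source' ("\<sigma>") where "\<sigma> \<equiv> source_map H"
abbreviation lin where "lin \<equiv> linear_map H ground"
abbreviation linH where "linH \<equiv> linear_map H H"
abbreviation bil where "bil \<equiv> bilinear_map H H ground"

definition coord :: "'v \<Rightarrow> 'v \<Rightarrow> 'k" where
  "coord b x = amb.representation B x b"

lemma lin_add: "lin f \<Longrightarrow> x \<in> E \<Longrightarrow> y \<in> E \<Longrightarrow> f (x + y) = f x + f y"
  and lin_scale: "lin f \<Longrightarrow> x \<in> E \<Longrightarrow> f (scl H c x) = c * f x"
  by (auto simp: linear_map_def ground_def)

lemma linI: "(\<And>x y. x \<in> E \<Longrightarrow> y \<in> E \<Longrightarrow> f (x + y) = f x + f y) \<Longrightarrow>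
   (\<And>c x. x \<in> E \<Longrightarrow> f (scl H c x) = c * f x) \<Longrightarrow> lin f"
  by (auto simp: linear_map_def ground_def)

lemma linH_closed: "linH g \<Longrightarrow> x \<in> E \<Longrightarrow> g x \<in> E"
  and linH_add: "linH g \<Longrightarrow> x \<in> E \<Longrightarrow> y \<in> E \<Longrightarrow> g (x + y) = g x + g y"
  and linH_scale: "linH g \<Longrightarrow> x \<in> E \<Longrightarrow> g (scl H c x) = scl H c (g x)"
  by (auto simp: linear_map_def)

lemma add_closed [simp]: "x \<in> E \<Longrightarrow> y \<in> E \<Longrightarrow> x + y \<in> E"
  and scale_closed [simp]: "x \<in> E \<Longrightarrow> scl H c x \<in> E"
  and zero_closed [simp]: "0 \<in> E"
  and sum_closed [simp]: "(\<And>i. i \<in> J \<Longrightarrow> g i \<in> E) \<Longrightarrow> sum g J \<in> E"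
  using subspace_elems amb.subspace_add amb.subspace_scale amb.subspace_0 amb.subspace_sum by blast+

lemma B_in_E [simp]: "b \<in> B \<Longrightarrow> b \<in> E"
  using span_B amb.span_base by blast

lemma mul_closed [simp]: "x \<in> E \<Longrightarrow> y \<in> E \<Longrightarrow> x \<cdot> y \<in> E"
  using mul_bilinear by (auto simp: bilinear_map_def linear_map_def)

lemma S_closed [simp]: "x \<in> E \<Longrightarrow> S x \<in> E"
  using antipode_linear by (simp add: linH_closed)

declare unit_closed [simp]

lemma lin_zero: "lin f \<Longrightarrow> f 0 = 0"
  using lin_scale[of f 0 0] by simp

lemma lin_sum: "lin f \<Longrightarrow> (\<And>i. i \<in> J \<Longrightarrow> g i \<in> E) \<Longrightarrow> f (sum g J) = (\<Sum>i\<in>J. f (g i))"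
  by (induction J rule: infinite_finite_induct) (auto simp: lin_zero lin_add)

lemma lin_sum_list:
  "lin f \<Longrightarrow> (\<And>i. i \<in> set xs \<Longrightarrow> g i \<in> E) \<Longrightarrow> f (\<Sum>i\<leftarrow>xs. g i) = (\<Sum>i\<leftarrow>xs. f (g i)) \<and> (\<Sum>i\<leftarrow>xs. g i) \<in> E"
  by (induction xs) (auto simp: lin_zero lin_add)

lemma lin_co [lins]: "lin (coord b)"
  unfolding coord_def using span_B independent_B
  by (auto intro!: linI simp: amb.representation_add amb.representation_scale)

lemma expand_vector: "x \<in> E \<Longrightarrow> (\<Sum>b\<in>B. scl H (coord b x) b) = x"
  unfolding coord_def
  using amb.sum_representation_eq[OF independent_B, of x B] finite_B span_B by simp

lemma expand: "lin f \<Longrightarrow> x \<in> E \<Longrightarrow> f x = (\<Sum>b\<in>B. coord b x * f b)"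
  using lin_sum[of f B "\<lambda>b. scl H (coord b x) b"] by (simp add: expand_vector lin_scale)

lemma lin_ext: "x \<in> E \<Longrightarrow> y \<in> E \<Longrightarrow> (\<And>f. lin f \<Longrightarrow> f x = f y) \<Longrightarrow> x = y"
  by (metis (no_types, lifting) expand_vector lin_co sum.cong)

lemma lin_comp: "lin f \<Longrightarrow> linH g \<Longrightarrow> lin (\<lambda>x. f (g x))"
  by (auto intro!: linI simp: lin_add lin_scale linH_add linH_scale linH_closed)

lemma bil_left: "bil f \<Longrightarrow> linH g \<Longrightarrow> c \<in> E \<Longrightarrow> lin (\<lambda>x. f (g x) c)"
  and bil_right: "bil f \<Longrightarrow> linH g \<Longrightarrow> c \<in> E \<Longrightarrow> lin (\<lambda>x. f c (g x))"
  unfolding bilinear_map_def using lin_comp[of "\<lambda>x. f x c" g] lin_comp[of "f c" g] by auto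

lemma bilI: "(\<And>b. b \<in> E \<Longrightarrow> lin (\<lambda>a. f a b)) \<Longrightarrow> (\<And>a. a \<in> E \<Longrightarrow> lin (\<lambda>b. f a b)) \<Longrightarrow> bil f"
  by (auto simp: bilinear_map_def)

lemma linH_id [lins]: "linH (\<lambda>x. x)"
  by (simp add: linear_map_def)

lemma linH_compose: "linH f \<Longrightarrow> linH g \<Longrightarrow> linH (\<lambda>x. f (g x))"
  by (auto simp: linear_map_def)

lemma linH_mul_left [lins]: "linH g \<Longrightarrow> c \<in> E \<Longrightarrow> linH (\<lambda>x. g x \<cdot> c)"
  using mul_bilinear linH_compose[of "\<lambda>x. x \<cdot> c" g] by (auto simp: bilinear_map_def)

lemma linH_mul_right [lins]: "linH g \<Longrightarrow> c \<in> E \<Longrightarrow> linH (\<lambda>x. c \<cdot> g x)"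
  using mul_bilinear linH_compose[of "\<lambda>x. c \<cdot> x" g] by (auto simp: bilinear_map_def)

lemmas linH_S [lins] = linH_compose[OF antipode_linear]
lemmas lin_counit [lins] = lin_comp[OF counit_linear]
lemmas lin_co' [lins] = lin_comp[OF lin_co]

lemma lin_times_left [lins]: "lin g \<Longrightarrow> lin (\<lambda>x. c * g x)"
  and lin_times_right [lins]: "lin g \<Longrightarrow> lin (\<lambda>x. g x * c)"
  by (auto intro!: linI simp: lin_add lin_scale algebra_simps)

lemma lin_plus: "lin f \<Longrightarrow> lin g \<Longrightarrow> lin (\<lambda>x. f x + g x)"
  by (rule linI) (simp_all add: lin_add[of f] lin_add[of g] lin_scale[of f] lin_scale[of g] algebra_simps)

lemma lin_divide [lins]: "lin g \<Longrightarrow> lin (\<lambda>x. g x / c)"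
  using lin_times_right[of g "1 / c"] by simp

lemma lin_sum_fun [lins]: "(\<And>i. i \<in> J \<Longrightarrow> lin (\<lambda>x. g x i)) \<Longrightarrow> lin (\<lambda>x. \<Sum>i\<in>J. g x i)"
proof (induction J rule: infinite_finite_induct)
  case (insert j J)
  then show ?case by (simp add: lin_plus)
qed (auto intro: linI)

definition comul_coeff :: "'v \<Rightarrow> 'v \<Rightarrow> 'v \<Rightarrow> 'k" where
  "comul_coeff h i j = comul H h (\<lambda>a b. coord i a * coord j b)"

text \<open>
  \<open>D f h\<close> is \<open>f(h\<^sub>1, h\<^sub>2)\<close> for bilinear \<open>f\<close> (see \<open>legs_D\<close>). Summing over a basis instead of
  over the list of legs makes the expression linear in \<open>h\<close> and coassociative for
  arbitrary \<open>f\<close>, which spares most multilinearity conditions.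
\<close>

definition D :: "('v \<Rightarrow> 'v \<Rightarrow> 'k) \<Rightarrow> 'v \<Rightarrow> 'k" where
  "D f h = (\<Sum>i\<in>B. \<Sum>j\<in>B. comul_coeff h i j * f i j)"

lemma sum_list_apply2: "(\<Sum>(a,b)\<leftarrow>xs. F a b) \<beta> = (\<Sum>(a,b)\<leftarrow>xs. F a b \<beta>)" for F :: "'c \<Rightarrow> 'e \<Rightarrow> 'd \<Rightarrow> 'k"
  by (induction xs) auto

lemma comul_in: "h \<in> E \<Longrightarrow> comul H h \<in> elems (tensor H H)"
  using comul_linear by (auto simp: linear_map_def)

lemma legs: assumes "h \<in> E"
  shows legs_subset: "set (legs H h) \<subseteq> E \<times> E"
    and legs_sum: "(\<Sum>(a, b)\<leftarrow>legs H h. simple_tensor H H a b) = comul H h"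
  using someI_ex[OF tensor_representation[OF comul_in[OF assms] vspace_axioms]]
  unfolding legs_def sweedler_def by auto

lemma bil_co: "bil (\<lambda>a b. coord i a * coord j b)"
  by (auto intro!: bilI lins)

lemma comul_apply: "h \<in> E \<Longrightarrow> bil f \<Longrightarrow> comul H h f = (\<Sum>(a, b)\<leftarrow>legs H h. f a b)"
  by (subst legs_sum[symmetric]) (auto simp: sum_list_apply2 simple_tensor_def)

lemma bil_expand: "bil f \<Longrightarrow> a \<in> E \<Longrightarrow> b \<in> E \<Longrightarrow> f a b = (\<Sum>i\<in>B. \<Sum>j\<in>B. coord i a * coord j b * f i j)"
proof -
  assume f: "bil f" and ab: "a \<in> E" "b \<in> E"
  have "f a b = (\<Sum>i\<in>B. coord i a * f i b)"
    using f ab by (intro expand[of "\<lambda>a. f a b"]) (auto simp: bilinear_map_def)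
  also have "\<dots> = (\<Sum>i\<in>B. coord i a * (\<Sum>j\<in>B. coord j b * f i j))"
    using f ab by (intro sum.cong refl arg_cong2[where f="(*)"] expand) (auto simp: bilinear_map_def)
  finally show ?thesis by (simp add: sum_distrib_left mult.assoc)
qed

lemma sum_list_sum: "(\<Sum>(a,b)\<leftarrow>xs. \<Sum>i\<in>J. F a b i) = (\<Sum>i\<in>J. \<Sum>(a,b)\<leftarrow>xs. F a b i)" for F :: "'c \<Rightarrow> 'd \<Rightarrow> 'e \<Rightarrow> 'k"
  by (induction xs) (auto simp: sum.distrib)

lemma sum_list_mult: "(\<Sum>(a,b)\<leftarrow>xs. F a b * c) = (\<Sum>(a,b)\<leftarrow>xs. F a b) * c" for c :: 'k
  by (induction xs) (auto simp: algebra_simps)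

lemma legs_cong: "h \<in> E \<Longrightarrow> (\<And>a b. a \<in> E \<Longrightarrow> b \<in> E \<Longrightarrow> F a b = G a b) \<Longrightarrow>
   (\<Sum>(a, b)\<leftarrow>legs H h. F a b) = (\<Sum>(a, b)\<leftarrow>legs H h. G a b)"
  using legs_subset[of h] by (intro arg_cong[where f=sum_list] map_cong) auto

lemma legs_D: "h \<in> E \<Longrightarrow> bil f \<Longrightarrow> (\<Sum>(a, b)\<leftarrow>legs H h. f a b) = D f h"
proof -
  assume h: "h \<in> E" and f: "bil f"
  have "(\<Sum>(a, b)\<leftarrow>legs H h. f a b) = (\<Sum>(a, b)\<leftarrow>legs H h. \<Sum>i\<in>B. \<Sum>j\<in>B. coord i a * coord j b * f i j)"
    by (rule legs_cong[OF h]) (rule bil_expand[OF f])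
  also have "\<dots> = (\<Sum>i\<in>B. \<Sum>j\<in>B. (\<Sum>(a, b)\<leftarrow>legs H h. coord i a * coord j b) * f i j)"
    by (simp add: sum_list_sum sum_list_mult)
  finally show ?thesis
    by (simp add: D_def comul_coeff_def comul_apply[OF h bil_co])
qed

lemma D_cong: "h = h' \<Longrightarrow> (\<And>a b. a \<in> E \<Longrightarrow> b \<in> E \<Longrightarrow> f a b = g a b) \<Longrightarrow> D f h = D g h'"
  by (simp add: D_def)

lemma lin_comul_coeff: "lin (\<lambda>h. comul_coeff h i j)"
proof (rule linI)
  show "comul_coeff (x + y) i j = comul_coeff x i j + comul_coeff y i j" if "x \<in> E" "y \<in> E" for x y
    using comul_linear that by (simp add: comul_coeff_def linear_map_def)
  show "comul_coeff (scl H c x) i j = c * comul_coeff x i j" if "x \<in> E" for c x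
    using comul_linear that by (simp add: comul_coeff_def linear_map_def tensor_def)
qed

lemma lin_D [lins]: "linH g \<Longrightarrow> lin (\<lambda>x. D f (g x))"
  unfolding D_def using lin_comp[OF lin_comul_coeff] by (auto intro!: lins)

lemma lin_D_fun [lins]: "(\<And>a b. a \<in> E \<Longrightarrow> b \<in> E \<Longrightarrow> lin (\<lambda>x. f x a b)) \<Longrightarrow> lin (\<lambda>x. D (f x) h)"
  unfolding D_def by (auto intro!: lins)

lemma D_sum: "D (\<lambda>a b. \<Sum>i\<in>J. f a b i) h = (\<Sum>i\<in>J. D (\<lambda>a b. f a b i) h)"
proof -
  have "D (\<lambda>a b. \<Sum>i\<in>J. f a b i) h = (\<Sum>a\<in>B. \<Sum>i\<in>J. \<Sum>b\<in>B. comul_coeff h a b * f a b i)"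
    unfolding D_def sum_distrib_left by (intro sum.cong refl sum.swap)
  also have "\<dots> = (\<Sum>i\<in>J. D (\<lambda>a b. f a b i) h)"
    unfolding D_def by (rule sum.swap)
  finally show ?thesis .
qed

lemma D_plus: "D (\<lambda>a b. f a b + g a b) h = D f h + D g h"
  unfolding D_def by (simp add: sum.distrib algebra_simps)

lemma D_times: "D (\<lambda>a b. c * f a b) h = c * D f h"
  and D_times_right: "D (\<lambda>a b. f a b * c) h = D f h * c"
  unfolding D_def by (simp_all add: sum_distrib_left sum_distrib_right mult_ac)

lemma D_swap: "D (\<lambda>a b. D (\<lambda>c d. f a b c d) h) g = D (\<lambda>c d. D (\<lambda>a b. f a b c d) g) h"
proof -
  have "D (\<lambda>a b. D (\<lambda>c d. f a b c d) h) g
     = (\<Sum>c\<in>B. \<Sum>d\<in>B. D (\<lambda>a b. comul_coeff h c d * f a b c d) g)"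
    unfolding D_def[of _ h] by (simp add: D_sum)
  then show ?thesis
    by (simp add: D_times D_def[of _ h])
qed


section \<open>The axioms evaluated at multilinear forms\<close>

lemma legs2_D:
  assumes "h \<in> E" "\<And>a b. a \<in> E \<Longrightarrow> b \<in> E \<Longrightarrow> g a b \<in> E"
    and "\<And>a b. a \<in> E \<Longrightarrow> b \<in> E \<Longrightarrow> bil (f a b)" "bil (\<lambda>a b. D (f a b) (g a b))"
  shows "(\<Sum>(a, b)\<leftarrow>legs H h. \<Sum>(c, d)\<leftarrow>legs H (g a b). f a b c d) = D (\<lambda>a b. D (f a b) (g a b)) h"
  using assms by (subst legs_D[symmetric]) (auto intro!: legs_cong legs_D)

text \<open>
  Threefold tensors live in \<open>H \<otimes> (H \<otimes> H)\<close>. As the elements of \<open>H \<otimes> H\<close> are themselves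
  functionals on forms, a trilinear form \<open>f\<close> acts on them by this bilinear form, which makes
  it possible to evaluate the axioms for threefold tensors at \<open>f\<close>.
\<close>

lemma trilinear_form:
  assumes f: "\<And>b c. b \<in> E \<Longrightarrow> c \<in> E \<Longrightarrow> lin (\<lambda>a. f a b c)" "\<And>a. a \<in> E \<Longrightarrow> bil (f a)"
  shows "bilinear_map H (tensor H H) ground (\<lambda>x t. t (f x))"
proof -
  have rep: "\<exists>ps. set ps \<subseteq> E \<times> E \<and> (\<forall>a\<in>E. t (f a) = (\<Sum>(b, c)\<leftarrow>ps. f a b c))"
    if t: "t \<in> elems (tensor H H)" for t
  proof -
    obtain ps where "set ps \<subseteq> E \<times> E" "t = (\<Sum>(v, w)\<leftarrow>ps. simple_tensor H H v w)"
      using tensor_representation[OF t vspace_axioms] by auto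
    then show ?thesis using f(2)
      by (intro exI[of _ ps]) (auto simp: sum_list_apply2 simple_tensor_def)
  qed
  have "lin (\<lambda>x. t (f x))" if t: "t \<in> elems (tensor H H)" for t
  proof -
    obtain ps where ps: "set ps \<subseteq> E \<times> E" "\<And>a. a \<in> E \<Longrightarrow> t (f a) = (\<Sum>(b, c)\<leftarrow>ps. f a b c)"
      using rep[OF t] by auto
    have "lin (\<lambda>a. \<Sum>(b, c)\<leftarrow>ps. f a b c)"
      using ps(1) by (induction ps) (auto intro!: lin_plus f(1) intro: linI)
    then show ?thesis using ps(2) by (auto simp: linear_map_def ground_def)
  qed
  moreover have "linear_map (tensor H H) ground (\<lambda>t. t (f x))" for x
    by (simp add: linear_map_def ground_def tensor_def)
  ultimately show ?thesis
    by (simp add: bilinear_map_def)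
qed

lemma legs2_apply:
  assumes "\<And>b c. b \<in> E \<Longrightarrow> c \<in> E \<Longrightarrow> lin (\<lambda>a. f a b c)" "\<And>a. a \<in> E \<Longrightarrow> bil (f a)"
    and "h \<in> E" "\<And>a b. a \<in> E \<Longrightarrow> b \<in> E \<Longrightarrow> g a b \<in> E"
    and m: "\<And>a b c d. a \<in> E \<Longrightarrow> b \<in> E \<Longrightarrow> c \<in> E \<Longrightarrow> d \<in> E \<Longrightarrow> m1 a b c d \<in> E"
    and "\<And>a b. a \<in> E \<Longrightarrow> b \<in> E \<Longrightarrow> bil (\<lambda>c d. f (m1 a b c d) (m2 a b c d) (m3 a b c d))"
    and "bil (\<lambda>a b. D (\<lambda>c d. f (m1 a b c d) (m2 a b c d) (m3 a b c d)) (g a b))"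
  shows "(\<Sum>(a, b)\<leftarrow>legs H h. \<Sum>(c, d)\<leftarrow>legs H (g a b).
       simple_tensor3 H (m1 a b c d) (m2 a b c d) (m3 a b c d)) (\<lambda>x t. t (f x))
   = D (\<lambda>a b. D (\<lambda>c d. f (m1 a b c d) (m2 a b c d) (m3 a b c d)) (g a b)) h"
proof -
  have "simple_tensor3 H a b c (\<lambda>x t. t (f x)) = f a b c" if "a \<in> E" for a b c
    using trilinear_form[OF assms(1,2)] assms(2) that
    by (simp add: simple_tensor3_def simple_tensor_def)
  then have "(\<Sum>(a, b)\<leftarrow>legs H h. \<Sum>(c, d)\<leftarrow>legs H (g a b).
       simple_tensor3 H (m1 a b c d) (m2 a b c d) (m3 a b c d)) (\<lambda>x t. t (f x))
     = (\<Sum>(a, b)\<leftarrow>legs H h. \<Sum>(c, d)\<leftarrow>legs H (g a b). f (m1 a b c d) (m2 a b c d) (m3 a b c d))"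
    using assms(3-) by (simp add: sum_list_apply2) (auto intro!: legs_cong)
  then show ?thesis
    using assms(3-) by (simp add: legs2_D)
qed

lemma co_basis: "b \<in> B \<Longrightarrow> coord i b = (if b = i then 1 else 0)"
  unfolding coord_def using amb.representation_basis[OF independent_B] by simp

lemma sum_co_basis: "b \<in> B \<Longrightarrow> (\<Sum>i\<in>B. coord i b * f i) = f b"
proof -
  assume b: "b \<in> B"
  have "(\<Sum>i\<in>B. coord i b * f i) = (\<Sum>i\<in>B. if i = b then f i else 0)"
    using b by (intro sum.cong) (auto simp: co_basis)
  then show ?thesis using b finite_B by simp
qed

text \<open>
  Both sides depend only on the values of \<open>f\<close> on basis elements, so \<open>f\<close> can be replaced by
  the trilinear form \<open>f'\<close> with the same values, to which the axiom applies.
\<close>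

lemma D_coassoc:
  assumes h: "h \<in> E"
  shows "D (\<lambda>a b. D (\<lambda>c d. f c d b) a) h = D (\<lambda>a b. D (\<lambda>c d. f a c d) b) h"
proof -
  define f' where "f' a b c = (\<Sum>i\<in>B. coord i a * (\<Sum>j\<in>B. coord j b * (\<Sum>k\<in>B. coord k c * f i j k)))" for a b c
  have f': "f' a b c = f a b c" if "a \<in> B" "b \<in> B" "c \<in> B" for a b c
    using that by (simp add: f'_def sum_co_basis)
  have [lins]: "lin (\<lambda>a. f' (g a) b c)" "lin (\<lambda>a. f' b (g a) c)" "lin (\<lambda>a. f' b c (g a))"
    if "linH g" for b c g
    using that unfolding f'_def by (auto intro!: lins)
  have "D (\<lambda>a b. D (\<lambda>c d. f' c d b) a) h = D (\<lambda>a b. D (\<lambda>c d. f' a c d) b) h"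
    using arg_cong[OF coassoc[OF h], of "\<lambda>t. t (\<lambda>x t. t (f' x))"] h
    by (subst (asm) (1 2) legs2_apply) (auto intro!: lins bilI)
  then show ?thesis by (simp add: D_def f')
qed

text \<open>
  The two expressions \<open>u \<otimes> v u' \<otimes> v'\<close> and \<open>u \<otimes> u' v \<otimes> v'\<close> for \<open>\<Delta>\<^sup>2(1)\<close>; the form is
  extended from the basis in the outer variables only, since the middle leg is a product.
\<close>

lemma D_unit:
  assumes f: "\<And>a c. a \<in> E \<Longrightarrow> c \<in> E \<Longrightarrow> lin (\<lambda>x. f a x c)"
  shows D_unit1: "D (\<lambda>a b. D (\<lambda>c d. f a (b \<cdot> c) d) \<one>) \<one> = D (\<lambda>a b. D (\<lambda>c d. f a c d) b) \<one>" (is ?A)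
    and D_unit2: "D (\<lambda>a b. D (\<lambda>c d. f a (c \<cdot> b) d) \<one>) \<one> = D (\<lambda>a b. D (\<lambda>c d. f a c d) b) \<one>" (is ?B)
proof -
  define f' where "f' a b c = (\<Sum>i\<in>B. coord i a * (\<Sum>k\<in>B. coord k c * f i b k))" for a b c
  have f': "f' a b c = f a b c" if "a \<in> B" "c \<in> B" for a b c
    using that by (simp add: f'_def sum_co_basis)
  have "lin (\<lambda>a. f i (g a) k)" if "i \<in> B" "k \<in> B" "linH g" for i k g
    using that by (intro lin_comp[OF f]) auto
  then have [lins]: "lin (\<lambda>a. f' (g a) b c)" "lin (\<lambda>a. f' b (g a) c)" "lin (\<lambda>a. f' b c (g a))"
    if "linH g" for b c g
    using that unfolding f'_def by (auto intro!: lins)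
  have "D (\<lambda>a b. D (\<lambda>c d. f' c d b) a) \<one> = D (\<lambda>a b. D (\<lambda>c d. f' a (b \<cdot> c) d) \<one>) \<one>"
    using arg_cong[OF comul_unit1, of "\<lambda>t. t (\<lambda>x t. t (f' x))"]
    by (subst (asm) (1 2) legs2_apply) (auto intro!: lins bilI)
  then show ?A by (simp add: D_coassoc) (simp add: D_def f')
  have "D (\<lambda>a b. D (\<lambda>c d. f' c d b) a) \<one> = D (\<lambda>a b. D (\<lambda>c d. f' a (c \<cdot> b) d) \<one>) \<one>"
    using arg_cong[OF comul_unit2, of "\<lambda>t. t (\<lambda>x t. t (f' x))"]
    by (subst (asm) (1 2) legs2_apply) (auto intro!: lins bilI)
  then show ?B by (simp add: D_coassoc) (simp add: D_def f')
qed

lemma D_counit_left: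
  assumes "lin f" "h \<in> E"
  shows "D (\<lambda>a b. \<epsilon> a * f b) h = f h"
proof -
  have "bil (\<lambda>a b. \<epsilon> a * f b)"
    using lin_comp[OF assms(1)] by (auto intro!: bilI lins)
  then have "D (\<lambda>a b. \<epsilon> a * f b) h = (\<Sum>(a, b)\<leftarrow>legs H h. f (scl H (\<epsilon> a) b))"
    using assms by (subst legs_D[symmetric]) (auto intro!: legs_cong simp: lin_scale)
  also have "\<dots> = f (\<Sum>(a, b)\<leftarrow>legs H h. scl H (\<epsilon> a) b)"
    using legs_subset[OF assms(2)] by (subst lin_sum_list[OF assms(1), THEN conjunct1]) (auto simp: case_prod_unfold)
  finally show ?thesis using counit_left assms by simp
qed

lemma D_counit_right:
  assumes "lin f" "h \<in> E"
  shows "D (\<lambda>a b. f a * \<epsilon> b) h = f h"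
proof -
  have "bil (\<lambda>a b. f a * \<epsilon> b)"
    using lin_comp[OF assms(1)] by (auto intro!: bilI lins)
  then have "D (\<lambda>a b. f a * \<epsilon> b) h = (\<Sum>(a, b)\<leftarrow>legs H h. f (scl H (\<epsilon> b) a))"
    using assms by (subst legs_D[symmetric]) (auto intro!: legs_cong simp: lin_scale)
  also have "\<dots> = f (\<Sum>(a, b)\<leftarrow>legs H h. scl H (\<epsilon> b) a)"
    using legs_subset[OF assms(2)] by (subst lin_sum_list[OF assms(1), THEN conjunct1]) (auto simp: case_prod_unfold)
  finally show ?thesis using counit_right assms by simp
qed

lemma D_mul:
  assumes f: "bil f" and "g \<in> E" "h \<in> E"
  shows "D f (g \<cdot> h) = D (\<lambda>a b. D (\<lambda>c d. f (a \<cdot> c) (b \<cdot> d)) h) g"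
proof -
  note [lins] = bil_left[OF f] bil_right[OF f]
  have "D f (g \<cdot> h) = comul H (g \<cdot> h) f"
    using assms by (simp add: comul_apply legs_D)
  also have "\<dots> = (\<Sum>(a, b)\<leftarrow>legs H g. \<Sum>(c, d)\<leftarrow>legs H h. f (a \<cdot> c) (b \<cdot> d))"
    using f by (simp add: comul_mul assms sum_list_apply2 simple_tensor_def)
  also have "\<dots> = D (\<lambda>a b. D (\<lambda>c d. f (a \<cdot> c) (b \<cdot> d)) h) g"
    using assms by (intro legs2_D) (auto intro!: bilI lins)
  finally show ?thesis .
qed


lemma D_one_left:
  assumes "bil f" "h \<in> E"
  shows "D f h = D (\<lambda>p q. D (\<lambda>a b. f (p \<cdot> a) (q \<cdot> b)) h) \<one>"
  using D_mul[OF assms(1) unit_closed assms(2)] assms by (simp add: unit_left)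

lemma D_one_right:
  assumes "bil f" "h \<in> E"
  shows "D f h = D (\<lambda>a b. D (\<lambda>p q. f (a \<cdot> p) (b \<cdot> q)) \<one>) h"
  using D_mul[OF assms(1) assms(2) unit_closed] assms by (simp add: unit_right)

lemma counit_split1:
  "f \<in> E \<Longrightarrow> g \<in> E \<Longrightarrow> h \<in> E \<Longrightarrow> D (\<lambda>a b. \<epsilon> (f \<cdot> a) * \<epsilon> (b \<cdot> h)) g = \<epsilon> (f \<cdot> g \<cdot> h)"
  by (subst legs_D[symmetric]) (auto intro!: lins bilI simp: counit_mul1)

lemma counit_split2:
  "f \<in> E \<Longrightarrow> g \<in> E \<Longrightarrow> h \<in> E \<Longrightarrow> D (\<lambda>a b. \<epsilon> (f \<cdot> b) * \<epsilon> (a \<cdot> h)) g = \<epsilon> (f \<cdot> g \<cdot> h)"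
  by (subst legs_D[symmetric]) (auto intro!: lins bilI simp: counit_mul2)

lemma counit_unit1: "f \<in> E \<Longrightarrow> h \<in> E \<Longrightarrow> D (\<lambda>a b. \<epsilon> (f \<cdot> a) * \<epsilon> (b \<cdot> h)) \<one> = \<epsilon> (f \<cdot> h)"
  and counit_unit2: "f \<in> E \<Longrightarrow> h \<in> E \<Longrightarrow> D (\<lambda>a b. \<epsilon> (f \<cdot> b) * \<epsilon> (a \<cdot> h)) \<one> = \<epsilon> (f \<cdot> h)"
  by (simp_all add: counit_split1 counit_split2 unit_right)

lemma lin_legs:
  assumes f: "lin f" and h: "h \<in> E"
    and g: "\<And>a b. a \<in> E \<Longrightarrow> b \<in> E \<Longrightarrow> g a b \<in> E" and b: "bil (\<lambda>a b. f (g a b))"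
  shows "f (\<Sum>(a, b)\<leftarrow>legs H h. g a b) = D (\<lambda>a b. f (g a b)) h" "(\<Sum>(a, b)\<leftarrow>legs H h. g a b) \<in> E"
proof -
  have "f (\<Sum>(a, b)\<leftarrow>legs H h. g a b) = (\<Sum>(a, b)\<leftarrow>legs H h. f (g a b)) \<and> (\<Sum>(a, b)\<leftarrow>legs H h. g a b) \<in> E"
    unfolding case_prod_unfold using legs_subset[OF h]
    by (intro lin_sum_list[OF f] g) auto
  then show "f (\<Sum>(a, b)\<leftarrow>legs H h. g a b) = D (\<lambda>a b. f (g a b)) h" "(\<Sum>(a, b)\<leftarrow>legs H h. g a b) \<in> E"
    using legs_D[OF h b] by auto
qed

lemma lin_zero_fun: "lin (\<lambda>x. 0)"
  by (rule linI) auto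

lemma target_apply:
  assumes "lin f" "h \<in> E" shows "f (\<tau> h) = D (\<lambda>u v. \<epsilon> (u \<cdot> h) * f v) \<one>"
proof -
  note [lins] = lin_comp[OF assms(1)]
  have 1: "bil (\<lambda>u v. \<epsilon> (u \<cdot> h) * f v)" using assms by (auto intro!: bilI lins)
  then have "bil (\<lambda>u v. f (scl H (\<epsilon> (u \<cdot> h)) v))"
    using assms by (auto simp: bilinear_map_def linear_map_def ground_def lin_scale)
  from lin_legs(1)[OF assms(1) unit_closed _ this] assms show ?thesis
    unfolding target_map_def by (auto intro!: D_cong simp: lin_scale)
qed

lemma source_apply:
  assumes "lin f" "h \<in> E" shows "f (\<sigma> h) = D (\<lambda>u v. \<epsilon> (h \<cdot> v) * f u) \<one>"
proof -
  note [lins] = lin_comp[OF assms(1)]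
  have 1: "bil (\<lambda>u v. \<epsilon> (h \<cdot> v) * f u)" using assms by (auto intro!: bilI lins)
  then have "bil (\<lambda>u v. f (scl H (\<epsilon> (h \<cdot> v)) u))"
    using assms by (auto simp: bilinear_map_def linear_map_def ground_def lin_scale)
  from lin_legs(1)[OF assms(1) unit_closed _ this] assms show ?thesis
    unfolding source_map_def by (auto intro!: D_cong simp: lin_scale)
qed

lemma target_antipode:
  assumes "lin f" "h \<in> E" shows "f (\<tau> h) = D (\<lambda>a b. f (a \<cdot> S b)) h"
  using assms
  by (subst antipode_target[symmetric], simp)
    (rule lin_legs, auto intro!: bilI lins lin_comp[OF assms(1)])

lemma source_antipode:
  assumes "lin f" "h \<in> E" shows "f (\<sigma> h) = D (\<lambda>a b. f (S a \<cdot> b)) h"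
  using assms
  by (subst antipode_source[symmetric], simp)
    (rule lin_legs, auto intro!: bilI lins lin_comp[OF assms(1)])

lemma target_closed [simp]: "h \<in> E \<Longrightarrow> \<tau> h \<in> E"
  using lin_legs(2)[OF lin_zero_fun, of h "\<lambda>a b. a \<cdot> S b"] antipode_target[of h]
  by (simp add: bilI lin_zero_fun)

lemma source_closed [simp]: "h \<in> E \<Longrightarrow> \<sigma> h \<in> E"
  using lin_legs(2)[OF lin_zero_fun, of h "\<lambda>a b. S a \<cdot> b"] antipode_source[of h]
  by (simp add: bilI lin_zero_fun)

text \<open>
  Maps like the counital maps are known only through the functionals of their values.
\<close>

lemma linH_I:
  assumes "\<And>x. x \<in> E \<Longrightarrow> g x \<in> E" "\<And>f. lin f \<Longrightarrow> lin (\<lambda>x. f (g x))"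
  shows "linH g"
  unfolding linear_map_def
proof (intro conjI allI ballI)
  fix x y c assume xy: "x \<in> E" "y \<in> E"
  show "g x \<in> E" by (rule assms) fact
  show "g (x + y) = g x + g y"
  proof (rule lin_ext)
    fix f assume f: "lin f"
    show "f (g (x + y)) = f (g x + g y)"
      using lin_add[OF assms(2)[OF f]] lin_add[OF f] assms(1) xy by simp
  qed (use xy assms in auto)
next
  fix x c assume x: "x \<in> E"
  show "g (scl H c x) = scl H c (g x)"
  proof (rule lin_ext)
    fix f assume f: "lin f"
    show "f (g (scl H c x)) = f (scl H c (g x))"
      using lin_scale[OF assms(2)[OF f]] lin_scale[OF f] assms(1) x by simp
  qed (use x assms in auto)
qed

lemma linH_target: "linH \<tau>"
proof (rule linH_I)
  fix f assume f: "lin f"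
  note [lins] = lin_comp[OF f]
  have "lin (\<lambda>h. D (\<lambda>a b. f (a \<cdot> S b)) h)" by (auto intro!: lins)
  then show "lin (\<lambda>x. f (\<tau> x))" by (simp add: target_antipode[OF f] linear_map_def ground_def)
qed simp

lemma linH_source: "linH \<sigma>"
proof (rule linH_I)
  fix f assume f: "lin f"
  note [lins] = lin_comp[OF f]
  have "lin (\<lambda>h. D (\<lambda>a b. f (S a \<cdot> b)) h)" by (auto intro!: lins)
  then show "lin (\<lambda>x. f (\<sigma> x))" by (simp add: source_antipode[OF f] linear_map_def ground_def)
qed simp

lemmas [lins] = linH_compose[OF linH_target] linH_compose[OF linH_source]

text \<open>
  The axiom \<open>S(h) = S(h\<^sub>1) h\<^sub>2 S(h\<^sub>3)\<close>, contracted on the left or on the right.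
\<close>

lemma antipode_expand:
  assumes f: "lin f" and "h \<in> E"
  shows antipode_source_left: "f (S h) = D (\<lambda>a b. f (\<sigma> a \<cdot> S b)) h"
    and antipode_target_right: "f (S h) = D (\<lambda>a b. f (S a \<cdot> \<tau> b)) h"
proof -
  note [lins] = lin_comp[OF f]
  have 1: "f (S h) = D (\<lambda>a b. D (\<lambda>c d. f (S a \<cdot> c \<cdot> S d)) b) h"
  proof -
    have *: "(\<Sum>(b1, b2)\<leftarrow>legs H b. S a \<cdot> b1 \<cdot> S b2) \<in> E"
       "f (\<Sum>(b1, b2)\<leftarrow>legs H b. S a \<cdot> b1 \<cdot> S b2) = D (\<lambda>c d. f (S a \<cdot> c \<cdot> S d)) b"
      if "a \<in> E" "b \<in> E" for a b
      using that by (intro lin_legs[OF f]; auto intro!: lins bilI)+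
    have "bil (\<lambda>a b. D (\<lambda>c d. f (S a \<cdot> c \<cdot> S d)) b)" by (auto intro!: lins bilI)
    then have "bil (\<lambda>a b. f (\<Sum>(b1, b2)\<leftarrow>legs H b. S a \<cdot> b1 \<cdot> S b2))"
      by (simp add: bilinear_map_def linear_map_def ground_def *)
    from lin_legs(1)[OF f \<open>h \<in> E\<close> _ this] * \<open>h \<in> E\<close> show ?thesis
      by (subst antipode_conv) (auto intro!: D_cong)
  qed
  also have "\<dots> = D (\<lambda>a b. D (\<lambda>c d. f (S a \<cdot> (c \<cdot> S d))) b) h"
    by (intro D_cong refl) (simp add: mul_assoc)
  also have "\<dots> = D (\<lambda>a b. f (S a \<cdot> \<tau> b)) h"
    by (intro D_cong refl target_antipode[symmetric]) (auto intro!: lins)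
  finally show "f (S h) = D (\<lambda>a b. f (S a \<cdot> \<tau> b)) h" .
  have "D (\<lambda>a b. D (\<lambda>c d. f (S a \<cdot> c \<cdot> S d)) b) h = D (\<lambda>a b. D (\<lambda>c d. f (S c \<cdot> d \<cdot> S b)) a) h"
    by (rule D_coassoc[symmetric]) fact
  also have "\<dots> = D (\<lambda>a b. f (\<sigma> a \<cdot> S b)) h"
    by (intro D_cong refl source_antipode[symmetric, where f="\<lambda>x. f (x \<cdot> S _)"]) (auto intro!: lins)
  finally show "f (S h) = D (\<lambda>a b. f (\<sigma> a \<cdot> S b)) h" unfolding 1 .
qed

section \<open>The counital maps\<close>

text \<open>
  This and its variants \<open>source_left_leg\<close>, \<open>target_left_leg\<close>, \<open>source_right_leg\<close> reduce the
  counital map of one leg of \<open>\<Delta>(h)\<close> to \<open>\<Delta>(1)\<close>. Here \<open>h\<^sub>1 \<otimes> \<tau>(h\<^sub>2) = u' h\<^sub>1 \<otimes> \<epsilon>(u v' h\<^sub>2) v\<close>, where \<open>\<Delta>(h)\<close> was multiplied by another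
  copy \<open>u' \<otimes> v'\<close> of \<open>\<Delta>(1)\<close>; now \<open>u' \<otimes> u v' \<otimes> v = \<Delta>\<^sup>2(1)\<close>, and the first two factors
  combine to a coproduct \<open>\<Delta>(u h)\<close> whose second leg is removed by the counit.
\<close>

lemma target_right_leg:
  assumes f: "bil f" and h [simp]: "h \<in> E"
  shows "D (\<lambda>a b. f a (\<tau> b)) h = D (\<lambda>u v. f (u \<cdot> h) v) \<one>"
proof -
  note [lins] = bil_left[OF f] bil_right[OF f]
  have "D (\<lambda>a b. f a (\<tau> b)) h = D (\<lambda>a b. D (\<lambda>u v. \<epsilon> (u \<cdot> b) * f a v) \<one>) h"
    by (intro D_cong refl target_apply) (auto intro!: lins)
  also have "\<dots> = D (\<lambda>p q. D (\<lambda>a b. D (\<lambda>u v. \<epsilon> (u \<cdot> (q \<cdot> b)) * f (p \<cdot> a) v) \<one>) h) \<one>"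
    by (rule D_one_left) (auto intro!: lins bilI)
  also have "\<dots> = D (\<lambda>a b. D (\<lambda>p q. D (\<lambda>u v. \<epsilon> (u \<cdot> q \<cdot> b) * f (p \<cdot> a) v) \<one>) \<one>) h"
    by (subst D_swap) (intro D_cong refl, simp add: mul_assoc)
  also have "\<dots> = D (\<lambda>a b. D (\<lambda>p q. D (\<lambda>u v. \<epsilon> (u \<cdot> b) * f (p \<cdot> a) v) q) \<one>) h"
    by (intro D_cong refl D_unit2[where f="\<lambda>p x v. \<epsilon> (x \<cdot> _) * f (p \<cdot> _) v"]) (auto intro!: lins)
  also have "\<dots> = D (\<lambda>a b. D (\<lambda>p q. D (\<lambda>u v. \<epsilon> (v \<cdot> b) * f (u \<cdot> a) q) p) \<one>) h"
    by (intro D_cong refl D_coassoc[symmetric]) simp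
  also have "\<dots> = D (\<lambda>p q. D (\<lambda>u v. D (\<lambda>a b. \<epsilon> (v \<cdot> b) * f (u \<cdot> a) q) h) p) \<one>"
    by (subst D_swap) (intro D_cong refl D_swap)
  also have "\<dots> = D (\<lambda>p q. D (\<lambda>x y. f x q * \<epsilon> y) (p \<cdot> h)) \<one>"
    by (rule D_cong[OF refl], subst D_mul) (auto intro!: lins bilI simp: mult.commute)
  also have "\<dots> = D (\<lambda>p q. f (p \<cdot> h) q) \<one>"
    by (intro D_cong refl D_counit_right) (auto intro!: lins)
  finally show ?thesis .
qed

lemma source_left_leg:
  assumes f: "bil f" and h [simp]: "h \<in> E"
  shows "D (\<lambda>a b. f (\<sigma> a) b) h = D (\<lambda>u v. f u (h \<cdot> v)) \<one>"
proof -
  note [lins] = bil_left[OF f] bil_right[OF f]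
  have "D (\<lambda>a b. f (\<sigma> a) b) h = D (\<lambda>a b. D (\<lambda>u v. \<epsilon> (a \<cdot> v) * f u b) \<one>) h"
    by (intro D_cong refl source_apply[where f="\<lambda>x. f x _"]) (auto intro!: lins)
  also have "\<dots> = D (\<lambda>a b. D (\<lambda>p q. D (\<lambda>u v. \<epsilon> (a \<cdot> p \<cdot> v) * f u (b \<cdot> q)) \<one>) \<one>) h"
    by (rule D_one_right) (auto intro!: lins bilI)
  also have "\<dots> = D (\<lambda>a b. D (\<lambda>u v. D (\<lambda>p q. \<epsilon> (a \<cdot> (p \<cdot> v)) * f u (b \<cdot> q)) \<one>) \<one>) h"
    by (rule D_cong[OF refl], subst D_swap) (intro D_cong refl, simp add: mul_assoc)
  also have "\<dots> = D (\<lambda>a b. D (\<lambda>u v. D (\<lambda>p q. \<epsilon> (a \<cdot> p) * f u (b \<cdot> q)) v) \<one>) h"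
    by (intro D_cong refl D_unit2[where f="\<lambda>u x q. \<epsilon> (_ \<cdot> x) * f u (_ \<cdot> q)"]) (auto intro!: lins)
  also have "\<dots> = D (\<lambda>u v. D (\<lambda>a b. D (\<lambda>p q. \<epsilon> (a \<cdot> p) * f u (b \<cdot> q)) v) h) \<one>"
    by (rule D_swap)
  also have "\<dots> = D (\<lambda>u v. D (\<lambda>x y. \<epsilon> x * f u y) (h \<cdot> v)) \<one>"
    by (rule D_cong[OF refl], subst D_mul) (auto intro!: lins bilI)
  also have "\<dots> = D (\<lambda>u v. f u (h \<cdot> v)) \<one>"
    by (intro D_cong refl D_counit_left) (auto intro!: lins)
  finally show ?thesis .
qed

lemma antipode_unit:
  assumes f: "lin f" and "h \<in> E"
  shows antipode_unit_left: "f (S h) = D (\<lambda>u v. f (u \<cdot> S (h \<cdot> v))) \<one>"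
    and antipode_unit_right: "f (S h) = D (\<lambda>u v. f (S (u \<cdot> h) \<cdot> v)) \<one>"
proof -
  note [lins] = lin_comp[OF f]
  have "D (\<lambda>a b. f (\<sigma> a \<cdot> S b)) h = D (\<lambda>u v. f (u \<cdot> S (h \<cdot> v))) \<one>"
    using assms by (intro source_left_leg[where f="\<lambda>a b. f (a \<cdot> S b)"]) (auto intro!: lins bilI)
  then show "f (S h) = D (\<lambda>u v. f (u \<cdot> S (h \<cdot> v))) \<one>"
    using antipode_source_left[OF assms] by simp
  have "D (\<lambda>a b. f (S a \<cdot> \<tau> b)) h = D (\<lambda>u v. f (S (u \<cdot> h) \<cdot> v)) \<one>"
    using assms by (intro target_right_leg[where f="\<lambda>a b. f (S a \<cdot> b)"]) (auto intro!: lins bilI)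
  then show "f (S h) = D (\<lambda>u v. f (S (u \<cdot> h) \<cdot> v)) \<one>"
    using antipode_target_right[OF assms] by simp
qed

text \<open>
  Here \<open>\<tau>(u) \<otimes> v = u\<^sub>1 S(u\<^sub>2) \<otimes> v = u' S(u v') \<otimes> v\<close> by the second expression for \<open>\<Delta>\<^sup>2(1)\<close>,
  and \<open>u' S(x v') = S(x)\<close> is \<open>antipode_unit_left\<close>. As the first leg of \<open>\<Delta>(1)\<close> ranges over the
  source base, this says that the antipode agrees with \<open>\<tau>\<close> on that base.
\<close>

lemma target_eq_antipode_unit:
  assumes f: "bil f"
  shows "D (\<lambda>u v. f (\<tau> u) v) \<one> = D (\<lambda>u v. f (S u) v) \<one>"
proof -
  note [lins] = bil_left[OF f] bil_right[OF f]
  have "D (\<lambda>u v. f (\<tau> u) v) \<one> = D (\<lambda>u v. D (\<lambda>a b. f (a \<cdot> S b) v) u) \<one>"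
    by (intro D_cong refl target_antipode[where f="\<lambda>x. f x _"]) (auto intro!: lins)
  also have "\<dots> = D (\<lambda>a b. D (\<lambda>c d. f (a \<cdot> S c) d) b) \<one>"
    by (rule D_coassoc) simp
  also have "\<dots> = D (\<lambda>a b. D (\<lambda>c d. f (a \<cdot> S (c \<cdot> b)) d) \<one>) \<one>"
    by (rule D_unit2[where f="\<lambda>a c d. f (a \<cdot> S c) d", symmetric]) (auto intro!: lins)
  also have "\<dots> = D (\<lambda>c d. D (\<lambda>a b. f (a \<cdot> S (c \<cdot> b)) d) \<one>) \<one>"
    by (rule D_swap)
  also have "\<dots> = D (\<lambda>u v. f (S u) v) \<one>"
    by (intro D_cong refl antipode_unit_left[where f="\<lambda>x. f x _", symmetric]) (auto intro!: lins)
  finally show ?thesis .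
qed

lemma source_eq_antipode_unit:
  assumes f: "bil f"
  shows "D (\<lambda>u v. f u (\<sigma> v)) \<one> = D (\<lambda>u v. f u (S v)) \<one>"
proof -
  note [lins] = bil_left[OF f] bil_right[OF f]
  have "D (\<lambda>u v. f u (\<sigma> v)) \<one> = D (\<lambda>u v. D (\<lambda>a b. f u (S a \<cdot> b)) v) \<one>"
    by (intro D_cong refl source_antipode[where f="f _"]) (auto intro!: lins)
  also have "\<dots> = D (\<lambda>a b. D (\<lambda>c d. f a (S (c \<cdot> b) \<cdot> d)) \<one>) \<one>"
    by (rule D_unit2[where f="\<lambda>a c d. f a (S c \<cdot> d)", symmetric]) (auto intro!: lins)
  also have "\<dots> = D (\<lambda>u v. f u (S v)) \<one>"
    by (intro D_cong refl antipode_unit_right[where f="f _", symmetric]) (auto intro!: lins)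
  finally show ?thesis .
qed

text \<open>
  In \<open>\<epsilon>(u u' h\<^sub>1) v \<otimes> v' h\<^sub>2\<close> the counit is split along \<open>\<Delta>(u')\<close>; by coassociativity one factor
  becomes \<open>\<tau>(u')\<close> and the other removes a leg of \<open>\<Delta>(v' h)\<close>.
\<close>

lemma target_left_leg:
  assumes f: "bil f" and h [simp]: "h \<in> E"
  shows "D (\<lambda>a b. f (\<tau> a) b) h = D (\<lambda>u v. f (S u) (v \<cdot> h)) \<one>"
proof -
  note [lins] = bil_left[OF f] bil_right[OF f]
  have "D (\<lambda>a b. f (\<tau> a) b) h = D (\<lambda>a b. D (\<lambda>u v. \<epsilon> (u \<cdot> a) * f v b) \<one>) h"
    by (intro D_cong refl target_apply[where f="\<lambda>x. f x _"]) (auto intro!: lins)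
  also have "\<dots> = D (\<lambda>p q. D (\<lambda>a b. D (\<lambda>u v. \<epsilon> (u \<cdot> (p \<cdot> a)) * f v (q \<cdot> b)) \<one>) h) \<one>"
    by (rule D_one_left) (auto intro!: lins bilI)
  also have "\<dots> = D (\<lambda>p q. D (\<lambda>a b. D (\<lambda>u v. D (\<lambda>m n. \<epsilon> (u \<cdot> m) * \<epsilon> (n \<cdot> a)) p * f v (q \<cdot> b)) \<one>) h) \<one>"
    by (intro D_cong refl arg_cong2[where f="(*)"]) (simp add: counit_split1 mul_assoc)
  also have "\<dots> = D (\<lambda>p q. D (\<lambda>m n. D (\<lambda>a b. D (\<lambda>u v. \<epsilon> (u \<cdot> m) * \<epsilon> (n \<cdot> a) * f v (q \<cdot> b)) \<one>) h) p) \<one>"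
    by (rule D_cong[OF refl], subst D_swap, rule D_cong[OF refl])
      (simp add: D_times_right[symmetric] D_swap[of _ \<one>])
  also have "\<dots> = D (\<lambda>p q. D (\<lambda>m n. D (\<lambda>a b. \<epsilon> (n \<cdot> a) * f (\<tau> m) (q \<cdot> b)) h) p) \<one>"
    by (intro D_cong refl, subst target_apply[where f="\<lambda>x. f x _"]) 
      (auto intro!: lins D_cong simp: D_times[symmetric] mult_ac)
  also have "\<dots> = D (\<lambda>p q. D (\<lambda>m n. D (\<lambda>a b. \<epsilon> (m \<cdot> a) * f (\<tau> p) (n \<cdot> b)) h) q) \<one>"
    by (rule D_coassoc) simp
  also have "\<dots> = D (\<lambda>p q. D (\<lambda>x y. \<epsilon> x * f (\<tau> p) y) (q \<cdot> h)) \<one>"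
    by (rule D_cong[OF refl], subst D_mul) (auto intro!: lins bilI)
  also have "\<dots> = D (\<lambda>p q. f (\<tau> p) (q \<cdot> h)) \<one>"
    by (intro D_cong refl D_counit_left) (auto intro!: lins)
  also have "\<dots> = D (\<lambda>p q. f (S p) (q \<cdot> h)) \<one>"
    using h by (intro target_eq_antipode_unit[where f="\<lambda>a b. f a (b \<cdot> h)"]) (auto intro!: lins bilI)
  finally show ?thesis .
qed

lemma source_right_leg:
  assumes f: "bil f" and h [simp]: "h \<in> E"
  shows "D (\<lambda>a b. f a (\<sigma> b)) h = D (\<lambda>u v. f (h \<cdot> u) (S v)) \<one>"
proof -
  note [lins] = bil_left[OF f] bil_right[OF f]
  have "D (\<lambda>a b. f a (\<sigma> b)) h = D (\<lambda>a b. D (\<lambda>u v. \<epsilon> (b \<cdot> v) * f a u) \<one>) h"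
    by (intro D_cong refl source_apply) (auto intro!: lins)
  also have "\<dots> = D (\<lambda>a b. D (\<lambda>p q. D (\<lambda>u v. \<epsilon> (b \<cdot> q \<cdot> v) * f (a \<cdot> p) u) \<one>) \<one>) h"
    by (rule D_one_right) (auto intro!: lins bilI)
  also have "\<dots> = D (\<lambda>a b. D (\<lambda>p q. D (\<lambda>m n. D (\<lambda>u v. \<epsilon> (b \<cdot> m) * \<epsilon> (n \<cdot> v) * f (a \<cdot> p) u) \<one>) q) \<one>) h"
    by (rule D_cong[OF refl], rule D_cong[OF refl], subst D_swap) 
      (intro D_cong refl, simp add: D_times_right counit_split1)
  also have "\<dots> = D (\<lambda>a b. D (\<lambda>p q. D (\<lambda>m n. \<epsilon> (b \<cdot> m) * f (a \<cdot> p) (\<sigma> n)) q) \<one>) h"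
    by (intro D_cong refl, subst source_apply)
      (auto intro!: lins D_cong simp: D_times[symmetric] mult_ac)
  also have "\<dots> = D (\<lambda>a b. D (\<lambda>p q. D (\<lambda>m n. \<epsilon> (b \<cdot> n) * f (a \<cdot> m) (\<sigma> q)) p) \<one>) h"
    by (intro D_cong refl D_coassoc[symmetric]) simp
  also have "\<dots> = D (\<lambda>p q. D (\<lambda>a b. D (\<lambda>m n. \<epsilon> (b \<cdot> n) * f (a \<cdot> m) (\<sigma> q)) p) h) \<one>"
    by (rule D_swap)
  also have "\<dots> = D (\<lambda>p q. D (\<lambda>x y. f x (\<sigma> q) * \<epsilon> y) (h \<cdot> p)) \<one>"
    by (rule D_cong[OF refl], subst D_mul) (auto intro!: lins bilI simp: mult.commute)
  also have "\<dots> = D (\<lambda>p q. f (h \<cdot> p) (\<sigma> q)) \<one>"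
    by (intro D_cong refl D_counit_right) (auto intro!: lins)
  also have "\<dots> = D (\<lambda>p q. f (h \<cdot> p) (S q)) \<one>"
    using h by (intro source_eq_antipode_unit[where f="\<lambda>a b. f (h \<cdot> a) b"]) (auto intro!: lins bilI)
  finally show ?thesis .
qed

lemma target_mul_target:
  assumes [simp]: "g \<in> E" "h \<in> E" shows "\<tau> (g \<cdot> \<tau> h) = \<tau> (g \<cdot> h)"
proof (rule lin_ext)
  fix f assume f: "lin f"
  note [lins] = lin_comp[OF f]
  have "f (\<tau> (g \<cdot> \<tau> h)) = D (\<lambda>u v. \<epsilon> (u \<cdot> g \<cdot> \<tau> h) * f v) \<one>"
    by (subst target_apply[OF f]) (auto simp: mul_assoc intro!: D_cong)
  also have "\<dots> = D (\<lambda>u v. D (\<lambda>p q. \<epsilon> (u \<cdot> g \<cdot> q) * \<epsilon> (p \<cdot> h)) \<one> * f v) \<one>"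
    by (intro D_cong refl arg_cong2[where f="(*)"], subst target_apply)
      (auto intro!: lins D_cong simp: mult.commute)
  also have "\<dots> = D (\<lambda>u v. \<epsilon> (u \<cdot> (g \<cdot> h)) * f v) \<one>"
    by (intro D_cong refl) (simp add: counit_unit2 mul_assoc)
  also have "\<dots> = f (\<tau> (g \<cdot> h))"
    by (subst target_apply[OF f]) auto
  finally show "f (\<tau> (g \<cdot> \<tau> h)) = f (\<tau> (g \<cdot> h))" .
qed auto

lemma source_mul_source:
  assumes [simp]: "g \<in> E" "h \<in> E" shows "\<sigma> (\<sigma> g \<cdot> h) = \<sigma> (g \<cdot> h)"
proof (rule lin_ext)
  fix f assume f: "lin f"
  note [lins] = lin_comp[OF f]
  have "f (\<sigma> (\<sigma> g \<cdot> h)) = D (\<lambda>u v. \<epsilon> (\<sigma> g \<cdot> (h \<cdot> v)) * f u) \<one>"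
    by (subst source_apply[OF f]) (auto simp: mul_assoc intro!: D_cong)
  also have "\<dots> = D (\<lambda>u v. D (\<lambda>p q. \<epsilon> (g \<cdot> q) * \<epsilon> (p \<cdot> (h \<cdot> v))) \<one> * f u) \<one>"
    by (intro D_cong refl arg_cong2[where f="(*)"], subst source_apply[where f="\<lambda>x. \<epsilon> (x \<cdot> _)"])
      (auto intro!: lins D_cong simp: mult.commute)
  also have "\<dots> = D (\<lambda>u v. \<epsilon> (g \<cdot> h \<cdot> v) * f u) \<one>"
    by (intro D_cong refl) (simp add: counit_unit2 mul_assoc)
  also have "\<dots> = f (\<sigma> (g \<cdot> h))"
    by (subst source_apply[OF f]) auto
  finally show "f (\<sigma> (\<sigma> g \<cdot> h)) = f (\<sigma> (g \<cdot> h))" .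
qed auto

text \<open>
  The coproduct of an element \<open>z\<close> of the target base is \<open>u z \<otimes> v = z u \<otimes> v\<close>: compare
  \<open>u \<otimes> \<Delta>(v)\<close> with the two expressions for \<open>\<Delta>\<^sup>2(1)\<close>. So multiplication by \<open>z\<close> acts on the first
  leg only, and elements of the source base act on the second leg only.
\<close>

lemma comul_target_mul:
  assumes f: "bil f" and [simp]: "g \<in> E" "x \<in> E"
  shows comul_mul_target: "D f (g \<cdot> \<tau> x) = D (\<lambda>a b. f (a \<cdot> \<tau> x) b) g"
    and comul_target_mul': "D f (\<tau> x \<cdot> g) = D (\<lambda>a b. f (\<tau> x \<cdot> a) b) g"
proof -
  note [lins] = bil_left[OF f] bil_right[OF f]
  have "D f (g \<cdot> \<tau> x) = D (\<lambda>u v. \<epsilon> (u \<cdot> x) * D f (g \<cdot> v)) \<one>"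
    by (rule target_apply) (auto intro!: lins)
  also have "\<dots> = D (\<lambda>u v. \<epsilon> (u \<cdot> x) * D (\<lambda>a b. D (\<lambda>c d. f (a \<cdot> c) (b \<cdot> d)) v) g) \<one>"
    by (intro D_cong refl arg_cong2[where f="(*)"] D_mul f) auto
  also have "\<dots> = D (\<lambda>a b. D (\<lambda>u v. D (\<lambda>c d. \<epsilon> (u \<cdot> x) * f (a \<cdot> c) (b \<cdot> d)) v) \<one>) g"
    by (subst D_swap[symmetric]) (simp add: D_times)
  also have "\<dots> = D (\<lambda>a b. D (\<lambda>u v. D (\<lambda>c d. \<epsilon> (u \<cdot> x) * f (a \<cdot> (c \<cdot> v)) (b \<cdot> d)) \<one>) \<one>) g"
    by (intro D_cong refl D_unit2[where f="\<lambda>u c d. \<epsilon> (u \<cdot> x) * f (_ \<cdot> c) (_ \<cdot> d)", symmetric]) (auto intro!: lins)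
  also have "\<dots> = D (\<lambda>a b. D (\<lambda>c d. D (\<lambda>u v. \<epsilon> (u \<cdot> x) * f (a \<cdot> (c \<cdot> v)) (b \<cdot> d)) \<one>) \<one>) g"
    by (rule D_cong[OF refl], rule D_swap)
  also have "\<dots> = D (\<lambda>a b. D (\<lambda>c d. f (a \<cdot> c \<cdot> \<tau> x) (b \<cdot> d)) \<one>) g"
    by (intro D_cong refl, subst target_apply[where f="\<lambda>y. f (_ \<cdot> _ \<cdot> y) _"]) 
      (auto intro!: lins D_cong simp: mul_assoc)
  also have "\<dots> = D (\<lambda>a b. f (a \<cdot> \<tau> x) b) g"
    by (subst (3) D_one_right) (auto intro!: lins bilI)
  finally show "D f (g \<cdot> \<tau> x) = D (\<lambda>a b. f (a \<cdot> \<tau> x) b) g" .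
  have "D f (\<tau> x \<cdot> g) = D (\<lambda>u v. \<epsilon> (u \<cdot> x) * D f (v \<cdot> g)) \<one>"
    by (rule target_apply[where f="\<lambda>y. D f (y \<cdot> g)"]) (auto intro!: lins)
  also have "\<dots> = D (\<lambda>u v. D (\<lambda>c d. D (\<lambda>a b. \<epsilon> (u \<cdot> x) * f (c \<cdot> a) (d \<cdot> b)) g) v) \<one>"
    by (rule D_cong[OF refl]) (simp add: D_times[symmetric] D_mul f)
  also have "\<dots> = D (\<lambda>u v. D (\<lambda>c d. D (\<lambda>a b. \<epsilon> (u \<cdot> x) * f (v \<cdot> c \<cdot> a) (d \<cdot> b)) g) \<one>) \<one>"
    by (rule D_unit1[where f="\<lambda>u c d. D (\<lambda>a b. \<epsilon> (u \<cdot> x) * f (c \<cdot> a) (d \<cdot> b)) g", symmetric]) (auto intro!: lins)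
  also have "\<dots> = D (\<lambda>c d. D (\<lambda>a b. D (\<lambda>u v. \<epsilon> (u \<cdot> x) * f (v \<cdot> c \<cdot> a) (d \<cdot> b)) \<one>) g) \<one>"
    by (subst D_swap, rule D_cong[OF refl], rule D_swap)
  also have "\<dots> = D (\<lambda>c d. D (\<lambda>a b. f (\<tau> x \<cdot> (c \<cdot> a)) (d \<cdot> b)) g) \<one>"
    by (intro D_cong refl, subst target_apply[where f="\<lambda>y. f (y \<cdot> (_ \<cdot> _)) _"]) 
      (auto intro!: lins D_cong simp: mul_assoc)
  also have "\<dots> = D (\<lambda>a b. f (\<tau> x \<cdot> a) b) g"
    by (subst (3) D_one_left) (auto intro!: lins bilI)
  finally show "D f (\<tau> x \<cdot> g) = D (\<lambda>a b. f (\<tau> x \<cdot> a) b) g" .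
qed

lemma comul_source_mul:
  assumes f: "bil f" and [simp]: "g \<in> E" "x \<in> E"
  shows comul_mul_source: "D f (g \<cdot> \<sigma> x) = D (\<lambda>a b. f a (b \<cdot> \<sigma> x)) g"
    and comul_source_mul': "D f (\<sigma> x \<cdot> g) = D (\<lambda>a b. f a (\<sigma> x \<cdot> b)) g"
proof -
  note [lins] = bil_left[OF f] bil_right[OF f]
  have "D f (g \<cdot> \<sigma> x) = D (\<lambda>u v. \<epsilon> (x \<cdot> v) * D f (g \<cdot> u)) \<one>"
    by (rule source_apply) (auto intro!: lins)
  also have "\<dots> = D (\<lambda>u v. \<epsilon> (x \<cdot> v) * D (\<lambda>a b. D (\<lambda>c d. f (a \<cdot> c) (b \<cdot> d)) u) g) \<one>"
    by (intro D_cong refl arg_cong2[where f="(*)"] D_mul f) auto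
  also have "\<dots> = D (\<lambda>a b. D (\<lambda>u v. D (\<lambda>c d. \<epsilon> (x \<cdot> v) * f (a \<cdot> c) (b \<cdot> d)) u) \<one>) g"
    by (subst D_swap[symmetric]) (simp add: D_times)
  also have "\<dots> = D (\<lambda>a b. D (\<lambda>c m. D (\<lambda>d v. \<epsilon> (x \<cdot> v) * f (a \<cdot> c) (b \<cdot> d)) m) \<one>) g"
    by (rule D_cong[OF refl], rule D_coassoc) simp
  also have "\<dots> = D (\<lambda>a b. D (\<lambda>c m. D (\<lambda>d v. \<epsilon> (x \<cdot> v) * f (a \<cdot> c) (b \<cdot> (m \<cdot> d))) \<one>) \<one>) g"
    by (intro D_cong refl D_unit1[where f="\<lambda>c d v. \<epsilon> (x \<cdot> v) * f (_ \<cdot> c) (_ \<cdot> d)", symmetric]) (auto intro!: lins)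
  also have "\<dots> = D (\<lambda>a b. D (\<lambda>c d. f (a \<cdot> c) (b \<cdot> d \<cdot> \<sigma> x)) \<one>) g"
    by (intro D_cong refl, subst source_apply[where f="\<lambda>y. f _ (_ \<cdot> _ \<cdot> y)"]) 
      (auto intro!: lins D_cong simp: mul_assoc)
  also have "\<dots> = D (\<lambda>a b. f a (b \<cdot> \<sigma> x)) g"
    by (subst (3) D_one_right) (auto intro!: lins bilI)
  finally show "D f (g \<cdot> \<sigma> x) = D (\<lambda>a b. f a (b \<cdot> \<sigma> x)) g" .
  have "D f (\<sigma> x \<cdot> g) = D (\<lambda>u v. \<epsilon> (x \<cdot> v) * D f (u \<cdot> g)) \<one>"
    by (rule source_apply[where f="\<lambda>y. D f (y \<cdot> g)"]) (auto intro!: lins)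
  also have "\<dots> = D (\<lambda>u v. D (\<lambda>c d. D (\<lambda>a b. \<epsilon> (x \<cdot> v) * f (c \<cdot> a) (d \<cdot> b)) g) u) \<one>"
    by (rule D_cong[OF refl]) (simp add: D_times[symmetric] D_mul f)
  also have "\<dots> = D (\<lambda>c m. D (\<lambda>d v. D (\<lambda>a b. \<epsilon> (x \<cdot> v) * f (c \<cdot> a) (d \<cdot> b)) g) m) \<one>"
    by (rule D_coassoc) simp
  also have "\<dots> = D (\<lambda>c m. D (\<lambda>d v. D (\<lambda>a b. \<epsilon> (x \<cdot> v) * f (c \<cdot> a) (d \<cdot> m \<cdot> b)) g) \<one>) \<one>"
    by (rule D_unit2[where f="\<lambda>c d v. D (\<lambda>a b. \<epsilon> (x \<cdot> v) * f (c \<cdot> a) (d \<cdot> b)) g", symmetric]) (auto intro!: lins)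
  also have "\<dots> = D (\<lambda>c m. D (\<lambda>a b. D (\<lambda>d v. \<epsilon> (x \<cdot> v) * f (c \<cdot> a) (d \<cdot> m \<cdot> b)) \<one>) g) \<one>"
    by (rule D_cong[OF refl], rule D_swap)
  also have "\<dots> = D (\<lambda>c m. D (\<lambda>a b. f (c \<cdot> a) (\<sigma> x \<cdot> (m \<cdot> b))) g) \<one>"
    by (intro D_cong refl, subst source_apply[where f="\<lambda>y. f _ (y \<cdot> (_ \<cdot> _))"]) 
      (auto intro!: lins D_cong simp: mul_assoc)
  also have "\<dots> = D (\<lambda>a b. f a (\<sigma> x \<cdot> b)) g"
    by (subst (3) D_one_left) (auto intro!: lins bilI)
  finally show "D f (\<sigma> x \<cdot> g) = D (\<lambda>a b. f a (\<sigma> x \<cdot> b)) g" .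
qed

text \<open>
  The outer legs of \<open>u \<otimes> v u' \<otimes> v' = u \<otimes> u' v \<otimes> v'\<close> are paired with \<open>y\<close> and \<open>x\<close>; the middle
  leg becomes the product of the two base elements in either order.
\<close>

lemma source_target_commute:
  assumes [simp]: "x \<in> E" "y \<in> E"
  shows "\<sigma> x \<cdot> \<tau> y = \<tau> y \<cdot> \<sigma> x"
proof (rule lin_ext)
  fix f assume f: "lin f"
  note [lins] = lin_comp[OF f]
  let ?F = "\<lambda>u m v. \<epsilon> (u \<cdot> y) * (\<epsilon> (x \<cdot> v) * f m)"
  have "f (\<sigma> x \<cdot> \<tau> y) = D (\<lambda>u v. \<epsilon> (u \<cdot> y) * D (\<lambda>p q. \<epsilon> (x \<cdot> q) * f (p \<cdot> v)) \<one>) \<one>"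
    by (subst target_apply[where f="\<lambda>z. f (_ \<cdot> z)"]; (auto intro!: lins)?)
      (intro D_cong refl arg_cong2[where f="(*)"] source_apply[where f="\<lambda>z. f (z \<cdot> _)"]; auto intro!: lins)
  also have "\<dots> = D (\<lambda>u v. D (\<lambda>p q. ?F u (p \<cdot> v) q) \<one>) \<one>"
    by (simp add: D_times)
  also have "\<dots> = D (\<lambda>u v. D (\<lambda>p q. ?F u (v \<cdot> p) q) \<one>) \<one>"
    by (subst (1) D_unit2[where f="?F"], (auto intro!: lins)[1],
        rule D_unit1[where f="?F", symmetric], auto intro!: lins)
  also have "\<dots> = D (\<lambda>u v. \<epsilon> (u \<cdot> y) * D (\<lambda>p q. \<epsilon> (x \<cdot> q) * f (v \<cdot> p)) \<one>) \<one>"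
    by (simp add: D_times)
  also have "\<dots> = f (\<tau> y \<cdot> \<sigma> x)"
    by (subst target_apply[where f="\<lambda>z. f (z \<cdot> \<sigma> x)" and h=y]; (auto intro!: lins)?)
      (intro D_cong refl arg_cong2[where f="(*)"] source_apply[where f="\<lambda>z. f (_ \<cdot> z)", symmetric]; auto intro!: lins)
  finally show "f (\<sigma> x \<cdot> \<tau> y) = f (\<tau> y \<cdot> \<sigma> x)" .
qed auto

section \<open>The antipode reverses products and coproducts\<close>

lemma target_mul_expand:
  assumes f: "lin f" and [simp]: "g \<in> E" "h \<in> E"
  shows "f (\<tau> (g \<cdot> h)) = D (\<lambda>a b. D (\<lambda>c d. f (a \<cdot> (c \<cdot> S d) \<cdot> S b)) h) g"
proof -
  note [lins] = lin_comp[OF f]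
  have "f (\<tau> (g \<cdot> h)) = D (\<lambda>a b. f (a \<cdot> S b)) (g \<cdot> \<tau> h)"
    by (subst target_mul_target[symmetric]) (auto intro: target_antipode[OF f])
  also have "\<dots> = D (\<lambda>a b. f (a \<cdot> \<tau> h \<cdot> S b)) g"
    by (rule comul_mul_target[where f="\<lambda>a b. f (a \<cdot> S b)"]) (auto intro!: lins bilI)
  also have "\<dots> = D (\<lambda>a b. D (\<lambda>c d. f (a \<cdot> (c \<cdot> S d) \<cdot> S b)) h) g"
    by (intro D_cong refl target_antipode[where f="\<lambda>z. f (_ \<cdot> z \<cdot> _)"]) (auto intro!: lins)
  finally show ?thesis .
qed

lemma source_mul_expand:
  assumes f: "lin f" and [simp]: "g \<in> E" "h \<in> E"
  shows "f (\<sigma> (g \<cdot> h)) = D (\<lambda>p q. f (S p \<cdot> (\<sigma> g \<cdot> q))) h"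
proof -
  note [lins] = lin_comp[OF f]
  have "f (\<sigma> (g \<cdot> h)) = D (\<lambda>a b. f (S a \<cdot> b)) (\<sigma> g \<cdot> h)"
    by (subst source_mul_source[symmetric]) (auto intro: source_antipode[OF f])
  also have "\<dots> = D (\<lambda>p q. f (S p \<cdot> (\<sigma> g \<cdot> q))) h"
    by (rule comul_source_mul'[where f="\<lambda>a b. f (S a \<cdot> b)"]) (auto intro!: lins bilI)
  finally show ?thesis .
qed

text \<open>
  Start from \<open>S(gh) = S(g\<^sub>1 h\<^sub>1) \<tau>(g\<^sub>2 h\<^sub>2)\<close> with \<open>\<tau>(gh) = g\<^sub>1 h\<^sub>1 S(h\<^sub>2) S(g\<^sub>2)\<close>. The antipode
  together with the next factors forms \<open>\<sigma>(g\<^sub>1 h\<^sub>1)\<close>, so that \<open>S(gh) = \<sigma>(g\<^sub>1 h\<^sub>1) S(h\<^sub>2) S(g\<^sub>2)\<close>.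
  Expanding \<open>\<sigma>(g h) = S(h\<^sub>1) \<sigma>(g) h\<^sub>2\<close> leaves \<open>S(h\<^sub>1) \<sigma>(g\<^sub>1) \<tau>(h\<^sub>2) S(g\<^sub>2)\<close>, and the two bases
  commute.
\<close>

lemma antipode_mul:
  assumes [simp]: "g \<in> E" "h \<in> E"
  shows "S (g \<cdot> h) = S h \<cdot> S g"
proof (rule lin_ext)
  fix f assume f: "lin f"
  note [lins] = lin_comp[OF f]
  have "f (S (g \<cdot> h)) = D (\<lambda>a b. D (\<lambda>c d. f (S (a \<cdot> c) \<cdot> \<tau> (b \<cdot> d))) h) g"
    by (subst antipode_target_right[OF f], simp, subst D_mul) (auto intro!: lins bilI)
  also have "\<dots> = D (\<lambda>a b. D (\<lambda>c d. D (\<lambda>p q. D (\<lambda>r s. f (S (a \<cdot> c) \<cdot> (p \<cdot> (r \<cdot> S s) \<cdot> S q))) d) b) h) g"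
    by (intro D_cong refl target_mul_expand[where f="\<lambda>z. f (_ \<cdot> z)"]) (auto intro!: lins)
  also have "\<dots> = D (\<lambda>a b. D (\<lambda>p q. D (\<lambda>c d. D (\<lambda>r s. f (S (a \<cdot> c) \<cdot> (p \<cdot> (r \<cdot> S s) \<cdot> S q))) d) h) b) g"
    by (rule D_cong[OF refl], rule D_swap)
  also have "\<dots> = D (\<lambda>a b. D (\<lambda>p q. D (\<lambda>c d. D (\<lambda>r s. f (S (p \<cdot> c) \<cdot> (q \<cdot> (r \<cdot> S s) \<cdot> S b))) d) h) a) g"
    by (rule D_coassoc[symmetric]) simp
  also have "\<dots> = D (\<lambda>a b. D (\<lambda>p q. D (\<lambda>c d. D (\<lambda>r s. f (S (p \<cdot> r) \<cdot> (q \<cdot> (s \<cdot> S d) \<cdot> S b))) c) h) a) g"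
    by (intro D_cong refl D_coassoc[symmetric]) simp
  also have "\<dots> = D (\<lambda>a b. D (\<lambda>c d. D (\<lambda>p q. D (\<lambda>r s. f (S (p \<cdot> r) \<cdot> (q \<cdot> s) \<cdot> (S d \<cdot> S b))) c) a) h) g"
    by (rule D_cong[OF refl], subst D_swap) (intro D_cong refl, simp add: mul_assoc)
  also have "\<dots> = D (\<lambda>a b. D (\<lambda>c d. D (\<lambda>x y. f (S x \<cdot> y \<cdot> (S d \<cdot> S b))) (a \<cdot> c)) h) g"
    by (rule D_cong[OF refl], rule D_cong[OF refl], subst D_mul) (auto intro!: lins bilI)
  also have "\<dots> = D (\<lambda>a b. D (\<lambda>c d. f (\<sigma> (a \<cdot> c) \<cdot> (S d \<cdot> S b))) h) g"
    by (intro D_cong refl source_antipode[where f="\<lambda>z. f (z \<cdot> _)", symmetric]) (auto intro!: lins)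
  also have "\<dots> = D (\<lambda>a b. D (\<lambda>c d. D (\<lambda>p q. f (S p \<cdot> (\<sigma> a \<cdot> q) \<cdot> (S d \<cdot> S b))) c) h) g"
    by (intro D_cong refl source_mul_expand[where f="\<lambda>z. f (z \<cdot> _)"]) (auto intro!: lins)
  also have "\<dots> = D (\<lambda>a b. D (\<lambda>p c. D (\<lambda>q d. f (S p \<cdot> \<sigma> a \<cdot> (q \<cdot> S d) \<cdot> S b)) c) h) g"
    by (rule D_cong[OF refl], subst D_coassoc) (auto intro!: D_cong simp: mul_assoc)
  also have "\<dots> = D (\<lambda>a b. D (\<lambda>p c. f (S p \<cdot> \<sigma> a \<cdot> \<tau> c \<cdot> S b)) h) g"
    by (intro D_cong refl target_antipode[where f="\<lambda>z. f (_ \<cdot> z \<cdot> _)", symmetric]) (auto intro!: lins)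
  also have "\<dots> = D (\<lambda>a b. D (\<lambda>p c. f (S p \<cdot> \<tau> c \<cdot> (\<sigma> a \<cdot> S b))) h) g"
  proof (intro D_cong refl)
    fix a b p c assume [simp]: "a \<in> E" "b \<in> E" "p \<in> E" "c \<in> E"
    show "f (S p \<cdot> \<sigma> a \<cdot> \<tau> c \<cdot> S b) = f (S p \<cdot> \<tau> c \<cdot> (\<sigma> a \<cdot> S b))"
      using source_target_commute[of a c] by (simp add: mul_assoc[symmetric]) (simp add: mul_assoc)
  qed
  also have "\<dots> = D (\<lambda>p c. D (\<lambda>a b. f (S p \<cdot> \<tau> c \<cdot> (\<sigma> a \<cdot> S b))) g) h"
    by (rule D_swap)
  also have "\<dots> = D (\<lambda>p c. f (S p \<cdot> \<tau> c \<cdot> S g)) h"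
    by (intro D_cong refl antipode_source_left[where f="\<lambda>z. f (_ \<cdot> z)", symmetric]) (auto intro!: lins)
  also have "\<dots> = f (S h \<cdot> S g)"
    by (rule antipode_target_right[where f="\<lambda>z. f (z \<cdot> _)", symmetric]) (auto intro!: lins)
  finally show "f (S (g \<cdot> h)) = f (S h \<cdot> S g)" .
qed auto

lemma target_one [simp]: "\<tau> \<one> = \<one>"
  and source_one [simp]: "\<sigma> \<one> = \<one>"
  and antipode_one [simp]: "S \<one> = \<one>"
proof -
  have t: "f (\<tau> \<one>) = f \<one>" if f: "lin f" for f
  proof -
    have "f (\<tau> \<one>) = D (\<lambda>u v. \<epsilon> u * f v) \<one>"
      by (subst target_apply[OF f]) (auto intro!: D_cong simp: unit_right)
    then show ?thesis by (simp add: D_counit_left f)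
  qed
  have s: "f (\<sigma> \<one>) = f \<one>" if f: "lin f" for f
  proof -
    have "f (\<sigma> \<one>) = D (\<lambda>u v. f u * \<epsilon> v) \<one>"
      by (subst source_apply[OF f]) (auto intro!: D_cong simp: unit_left)
    then show ?thesis by (simp add: D_counit_right f)
  qed
  have a: "f (S \<one>) = f \<one>" if f: "lin f" for f
  proof -
    have "f (S \<one>) = D (\<lambda>u v. f (u \<cdot> S v)) \<one>"
      by (subst antipode_unit_left[OF f]) (auto intro!: D_cong simp: unit_left)
    then show ?thesis by (simp add: target_antipode[OF f, symmetric] t f)
  qed
  show "\<tau> \<one> = \<one>" "\<sigma> \<one> = \<one>" "S \<one> = \<one>"
    by (rule lin_ext; simp add: t s a)+
qed

lemma target_target [simp]: "x \<in> E \<Longrightarrow> \<tau> (\<tau> x) = \<tau> x"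
  using target_mul_target[of \<one> x] by (simp add: unit_left)

lemma target_source: assumes [simp]: "x \<in> E" shows "\<tau> (\<sigma> x) = S (\<sigma> x)"
proof (rule lin_ext)
  fix f assume f: "lin f"
  note [lins] = lin_comp[OF f]
  have "f (\<tau> (\<sigma> x)) = D (\<lambda>u v. \<epsilon> (x \<cdot> v) * f (\<tau> u)) \<one>"
    by (rule source_apply) (auto intro!: lins)
  also have "\<dots> = D (\<lambda>u v. \<epsilon> (x \<cdot> v) * f (S u)) \<one>"
    by (rule target_eq_antipode_unit[where f="\<lambda>a b. \<epsilon> (x \<cdot> b) * f a"]) (auto intro!: lins bilI)
  also have "\<dots> = f (S (\<sigma> x))"
    by (rule source_apply[symmetric]) (auto intro!: lins)
  finally show "f (\<tau> (\<sigma> x)) = f (S (\<sigma> x))" .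
qed auto

lemma source_target: assumes [simp]: "x \<in> E" shows "\<sigma> (\<tau> x) = S (\<tau> x)"
proof (rule lin_ext)
  fix f assume f: "lin f"
  note [lins] = lin_comp[OF f]
  have "f (\<sigma> (\<tau> x)) = D (\<lambda>u v. \<epsilon> (u \<cdot> x) * f (\<sigma> v)) \<one>"
    by (rule target_apply) (auto intro!: lins)
  also have "\<dots> = D (\<lambda>u v. \<epsilon> (u \<cdot> x) * f (S v)) \<one>"
    by (rule source_eq_antipode_unit[where f="\<lambda>a b. \<epsilon> (a \<cdot> x) * f b"]) (auto intro!: lins bilI)
  also have "\<dots> = f (S (\<tau> x))"
    by (rule target_apply[symmetric]) (auto intro!: lins)
  finally show "f (\<sigma> (\<tau> x)) = f (S (\<tau> x))" .
qed auto

text \<open>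
  By the agreement with the counital maps, \<open>S(v) \<otimes> S(u) = \<sigma>(v) \<otimes> \<tau>(u)\<close>; the two counits in
  the latter contract along \<open>\<Delta>(1)\<close> to one, which leaves \<open>u \<otimes> \<tau>(v)\<close>.
\<close>

lemma unit_swap:
  assumes f: "bil f"
  shows "D (\<lambda>u v. f (S v) (S u)) \<one> = D f \<one>"
proof -
  note [lins] = bil_left[OF f] bil_right[OF f]
  have "D (\<lambda>u v. f (S v) (S u)) \<one> = D (\<lambda>u v. f (S v) (\<tau> u)) \<one>"
    by (rule target_eq_antipode_unit[where f="\<lambda>a b. f (S b) a", symmetric]) (auto intro!: lins bilI)
  also have "\<dots> = D (\<lambda>u v. f (\<sigma> v) (\<tau> u)) \<one>"
    by (rule source_eq_antipode_unit[where f="\<lambda>a b. f b (\<tau> a)", symmetric]) (auto intro!: lins bilI)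
  also have "\<dots> = D (\<lambda>u v. D (\<lambda>a b. D (\<lambda>p q. \<epsilon> (p \<cdot> u) * \<epsilon> (v \<cdot> b) * f a q) \<one>) \<one>) \<one>"
    by (intro D_cong refl, subst source_apply[where f="\<lambda>z. f z _"]; (auto intro!: lins)?)
      (intro D_cong refl, subst target_apply; auto intro!: lins D_cong simp: D_times[symmetric])
  also have "\<dots> = D (\<lambda>a b. D (\<lambda>p q. D (\<lambda>u v. \<epsilon> (p \<cdot> u) * \<epsilon> (v \<cdot> b) * f a q) \<one>) \<one>) \<one>"
    by (subst D_swap, rule D_cong[OF refl], rule D_swap)
  also have "\<dots> = D (\<lambda>a b. f a (\<tau> b)) \<one>"
    by (intro D_cong refl, subst target_apply) (auto intro!: lins D_cong simp: D_times_right counit_unit1)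
  also have "\<dots> = D f \<one>"
    by (subst target_right_leg[OF f]) (auto intro!: D_cong simp: unit_right)
  finally show ?thesis .
qed

text \<open>
  Dual to the product rule. In \<open>\<Delta>(S(h)) = \<Delta>(S(h\<^sub>1)) (\<tau>(h\<^sub>2) \<otimes> 1)\<close> one inserts
  \<open>u \<tau>(h) \<otimes> v = h\<^sub>1 S(h\<^sub>4) \<otimes> h\<^sub>2 S(h\<^sub>3)\<close>, so that a coproduct \<open>\<Delta>(S(h\<^sub>1) h\<^sub>2) = \<Delta>(\<sigma>(h\<^sub>1))\<close> splits off. It acts
  on the second leg and is absorbed there, leaving \<open>u S(h\<^sub>2) \<otimes> v S(h\<^sub>1)\<close>; finally \<open>u \<otimes> v\<close> is
  \<open>S(v) \<otimes> S(u)\<close>, and \<open>\<Delta>(h) \<Delta>(1) = \<Delta>(h)\<close>.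
\<close>

lemma comul_antipode:
  assumes f: "bil f" and [simp]: "h \<in> E"
  shows "D f (S h) = D (\<lambda>a b. f (S b) (S a)) h"
proof -
  note [lins] = bil_left[OF f] bil_right[OF f]
  have "D f (S h) = D (\<lambda>a b. D f (S a \<cdot> \<tau> b)) h"
    by (rule antipode_target_right) (auto intro!: lins)
  also have "\<dots> = D (\<lambda>a b. D (\<lambda>p q. f (p \<cdot> \<tau> b) q) (S a)) h"
    by (intro D_cong refl comul_mul_target f) auto
  also have "\<dots> = D (\<lambda>a b. D (\<lambda>c d. D (\<lambda>p q. f (p \<cdot> (c \<cdot> S d)) q) (S a)) b) h"
    by (intro D_cong refl target_antipode[where f="\<lambda>z. D (\<lambda>p q. f (p \<cdot> z) q) _"]) (auto intro!: lins)
  also have "\<dots> = D (\<lambda>a b. D (\<lambda>c d. D (\<lambda>p q. D (\<lambda>u v. f (p \<cdot> ((u \<cdot> c) \<cdot> S d)) (q \<cdot> v)) \<one>) (S a)) b) h"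
    by (rule D_cong[OF refl], rule D_cong[OF refl], rule trans[OF D_one_right]) (auto intro!: lins bilI D_cong simp: mul_assoc)
  also have "\<dots> = D (\<lambda>a b. D (\<lambda>c d. D (\<lambda>p q. D (\<lambda>x y. f (p \<cdot> (x \<cdot> S d)) (q \<cdot> \<tau> y)) c) (S a)) b) h"
    by (intro D_cong refl target_right_leg[where f="\<lambda>x y. f (_ \<cdot> (x \<cdot> _)) (_ \<cdot> y)", symmetric]) (auto intro!: lins bilI)
  also have "\<dots> = D (\<lambda>a b. D (\<lambda>c d. D (\<lambda>p q. D (\<lambda>x y. D (\<lambda>m n. f (p \<cdot> (x \<cdot> S d)) (q \<cdot> (m \<cdot> S n))) y) c) (S a)) b) h"
    by (intro D_cong refl target_antipode[where f="\<lambda>y. f (_ \<cdot> (_ \<cdot> _)) (_ \<cdot> y)"]) (auto intro!: lins)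
  also have "\<dots> = D (\<lambda>a b. D (\<lambda>c d. D (\<lambda>y n. D (\<lambda>p q. D (\<lambda>x m. f (p \<cdot> x \<cdot> S d) (q \<cdot> m \<cdot> S n)) y) (S a)) c) b) h"
  proof (rule D_cong[OF refl], rule D_cong[OF refl])
    fix a b c d assume [simp]: "a \<in> E" "b \<in> E" "c \<in> E" "d \<in> E"
    have "D (\<lambda>p q. D (\<lambda>x y. D (\<lambda>m n. f (p \<cdot> (x \<cdot> S d)) (q \<cdot> (m \<cdot> S n))) y) c) (S a)
        = D (\<lambda>p q. D (\<lambda>y n. D (\<lambda>x m. f (p \<cdot> x \<cdot> S d) (q \<cdot> m \<cdot> S n)) y) c) (S a)"
      by (rule D_cong[OF refl], subst D_coassoc) (auto intro!: D_cong simp: mul_assoc)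
    also have "\<dots> = D (\<lambda>y n. D (\<lambda>p q. D (\<lambda>x m. f (p \<cdot> x \<cdot> S d) (q \<cdot> m \<cdot> S n)) y) (S a)) c"
      by (rule D_swap)
    finally show "D (\<lambda>p q. D (\<lambda>x y. D (\<lambda>m n. f (p \<cdot> (x \<cdot> S d)) (q \<cdot> (m \<cdot> S n))) y) c) (S a)
        = D (\<lambda>y n. D (\<lambda>p q. D (\<lambda>x m. f (p \<cdot> x \<cdot> S d) (q \<cdot> m \<cdot> S n)) y) (S a)) c" .
  qed
  also have "\<dots> = D (\<lambda>a b. D (\<lambda>c d. D (\<lambda>y n. D (\<lambda>p q. f (p \<cdot> S d) (q \<cdot> S n)) (S a \<cdot> y)) c) b) h"
    by (intro D_cong refl D_mul[symmetric]) (auto intro!: lins bilI)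
  also have "\<dots> = D (\<lambda>a b. D (\<lambda>y w. D (\<lambda>n d. D (\<lambda>p q. f (p \<cdot> S d) (q \<cdot> S n)) (S a \<cdot> y)) w) b) h"
    by (intro D_cong refl D_coassoc) simp
  also have "\<dots> = D (\<lambda>z w. D (\<lambda>a y. D (\<lambda>n d. D (\<lambda>p q. f (p \<cdot> S d) (q \<cdot> S n)) (S a \<cdot> y)) w) z) h"
    by (rule D_coassoc[symmetric]) simp
  also have "\<dots> = D (\<lambda>z w. D (\<lambda>n d. D (\<lambda>p q. f (p \<cdot> S d) (q \<cdot> S n)) (\<sigma> z)) w) h"
    by (rule D_cong[OF refl], subst D_swap, intro D_cong refl source_antipode[symmetric]) (auto intro!: lins)
  also have "\<dots> = D (\<lambda>z w. D (\<lambda>n d. D (\<lambda>u v. f (u \<cdot> S d) (v \<cdot> (\<sigma> z \<cdot> S n))) \<one>) w) h"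
  proof (rule D_cong[OF refl], rule D_cong[OF refl])
    fix z w n d assume [simp]: "z \<in> E" "w \<in> E" "n \<in> E" "d \<in> E"
    have "D (\<lambda>p q. f (p \<cdot> S d) (q \<cdot> S n)) (\<one> \<cdot> \<sigma> z) = D (\<lambda>p q. f (p \<cdot> S d) (q \<cdot> \<sigma> z \<cdot> S n)) \<one>"
      by (rule comul_mul_source[where f="\<lambda>p q. f (p \<cdot> S d) (q \<cdot> S n)"]) (auto intro!: lins bilI)
    then show "D (\<lambda>p q. f (p \<cdot> S d) (q \<cdot> S n)) (\<sigma> z) = D (\<lambda>u v. f (u \<cdot> S d) (v \<cdot> (\<sigma> z \<cdot> S n))) \<one>"
      by (simp add: unit_left) (auto intro!: D_cong simp: mul_assoc)
  qed
  also have "\<dots> = D (\<lambda>m d. D (\<lambda>z n. D (\<lambda>u v. f (u \<cdot> S d) (v \<cdot> (\<sigma> z \<cdot> S n))) \<one>) m) h"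
    by (rule D_coassoc[symmetric]) simp
  also have "\<dots> = D (\<lambda>m d. D (\<lambda>u v. f (u \<cdot> S d) (v \<cdot> S m)) \<one>) h"
    by (intro D_cong refl antipode_source_left[where f="\<lambda>z. D (\<lambda>u v. f (u \<cdot> _) (v \<cdot> z)) \<one>", symmetric]) (auto intro!: lins)
  also have "\<dots> = D (\<lambda>m d. D (\<lambda>u v. f (S v \<cdot> S d) (S u \<cdot> S m)) \<one>) h"
    by (intro D_cong refl unit_swap[where f="\<lambda>a b. f (a \<cdot> S _) (b \<cdot> S _)", symmetric]) (auto intro!: lins bilI)
  also have "\<dots> = D (\<lambda>a b. f (S b) (S a)) h"
    by (subst (3) D_one_right) (auto intro!: lins bilI D_cong simp: antipode_mul)
  finally show ?thesis .
qed


section \<open>An integral from the trace of the squared antipode\<close>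

text \<open>
  The vector representing \<open>\<phi> \<mapsto> Tr(y \<mapsto> \<phi>(y\<^sub>1) S\<^sup>2(y\<^sub>2))\<close>, written out in the basis.
\<close>

definition trace_integral :: 'v where
  "trace_integral = (\<Sum>j\<in>B. scl H (\<Sum>i\<in>B. D (\<lambda>a b. coord j a * coord i (S (S b))) i) j)"

lemma trace_integral_closed [simp]: "trace_integral \<in> E"
  by (simp add: trace_integral_def)

lemma apply_coordinates:
  assumes "lin \<phi>"
  shows "\<phi> (\<Sum>j\<in>B. scl H (\<Sum>i\<in>J. D (\<lambda>a b. coord j a * K i b) (h i)) j) = (\<Sum>i\<in>J. D (\<lambda>a b. \<phi> a * K i b) (h i))"
proof -
  have "\<phi> (\<Sum>j\<in>B. scl H (\<Sum>i\<in>J. D (\<lambda>a b. coord j a * K i b) (h i)) j)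
      = (\<Sum>j\<in>B. (\<Sum>i\<in>J. D (\<lambda>a b. coord j a * K i b) (h i)) * \<phi> j)"
    using assms by (simp add: lin_sum lin_scale)
  also have "\<dots> = (\<Sum>i\<in>J. D (\<lambda>a b. \<Sum>j\<in>B. coord j a * K i b * \<phi> j) (h i))"
    unfolding sum_distrib_right D_times_right[symmetric] D_sum by (rule sum.swap)
  also have "\<dots> = (\<Sum>i\<in>J. D (\<lambda>a b. \<phi> a * K i b) (h i))"
  proof (intro sum.cong refl D_cong)
    fix i a b assume "a \<in> E"
    then have "\<phi> a = (\<Sum>j\<in>B. coord j a * \<phi> j)" by (rule expand[OF assms])
    then show "(\<Sum>j\<in>B. coord j a * K i b * \<phi> j) = \<phi> a * K i b"
      by (simp add: sum_distrib_right sum_distrib_left mult_ac)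
  qed
  finally show ?thesis .
qed

lemma trace_integral_apply:
  "lin \<phi> \<Longrightarrow> \<phi> trace_integral = (\<Sum>i\<in>B. D (\<lambda>a b. \<phi> a * coord i (S (S b))) i)"
  unfolding trace_integral_def by (rule apply_coordinates)

lemma unit_target: "bil f \<Longrightarrow> D (\<lambda>u v. f u (\<tau> v)) \<one> = D f \<one>"
  by (subst target_right_leg) (auto intro!: D_cong simp: unit_right)

lemma unit_source: "bil f \<Longrightarrow> D (\<lambda>u v. f (\<sigma> u) v) \<one> = D f \<one>"
  by (subst source_left_leg) (auto intro!: D_cong simp: unit_left)

lemma target_target_mul:
  assumes [simp]: "x \<in> E" "g \<in> E" shows "\<tau> (\<tau> x \<cdot> g) = \<tau> x \<cdot> \<tau> g"
proof (rule lin_ext)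
  fix f assume f: "lin f"
  note [lins] = lin_comp[OF f]
  have "f (\<tau> (\<tau> x \<cdot> g)) = D (\<lambda>a b. f (\<tau> x \<cdot> a \<cdot> S b)) g"
    by (subst target_antipode[OF f], simp, rule comul_target_mul'[where f="\<lambda>a b. f (a \<cdot> S b)"]) (auto intro!: lins bilI)
  also have "\<dots> = f (\<tau> x \<cdot> \<tau> g)"
    by (subst target_antipode[where f="\<lambda>z. f (_ \<cdot> z)"]) (auto intro!: lins D_cong simp: mul_assoc)
  finally show "f (\<tau> (\<tau> x \<cdot> g)) = f (\<tau> x \<cdot> \<tau> g)" .
qed auto

lemma source_source_mul:
  assumes [simp]: "x \<in> E" "g \<in> E" shows "\<sigma> (g \<cdot> \<sigma> x) = \<sigma> g \<cdot> \<sigma> x"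
proof (rule lin_ext)
  fix f assume f: "lin f"
  note [lins] = lin_comp[OF f]
  have "f (\<sigma> (g \<cdot> \<sigma> x)) = D (\<lambda>a b. f (S a \<cdot> (b \<cdot> \<sigma> x))) g"
    by (subst source_antipode[OF f], simp, rule comul_mul_source[where f="\<lambda>a b. f (S a \<cdot> b)"]) (auto intro!: lins bilI)
  also have "\<dots> = f (\<sigma> g \<cdot> \<sigma> x)"
    by (subst source_antipode[where f="\<lambda>z. f (z \<cdot> _)"]) (auto intro!: lins D_cong simp: mul_assoc)
  finally show "f (\<sigma> (g \<cdot> \<sigma> x)) = f (\<sigma> g \<cdot> \<sigma> x)" .
qed auto

text \<open>
  An element \<open>y\<close> of the source base moves from one leg of \<open>\<Delta>(1)\<close> to the other:
  \<open>u y \<otimes> v = y\<^sub>1 \<otimes> \<tau>(y\<^sub>2) = u \<otimes> \<tau>(v y)\<close>, and \<open>\<tau>\<close> replaces \<open>y\<close> by \<open>S(y)\<close> and is multiplicative on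
  the target base.
\<close>

lemma unit_source_shift:
  assumes f: "bil f" and [simp]: "y \<in> E"
  shows "D (\<lambda>u v. f (u \<cdot> \<sigma> y) v) \<one> = D (\<lambda>u v. f u (v \<cdot> S (\<sigma> y))) \<one>"
proof -
  note [lins] = bil_left[OF f] bil_right[OF f]
  have "D (\<lambda>u v. f (u \<cdot> \<sigma> y) v) \<one> = D (\<lambda>a b. f a (\<tau> b)) (\<one> \<cdot> \<sigma> y)"
    using f by (simp add: target_right_leg unit_left)
  also have "\<dots> = D (\<lambda>a b. f a (\<tau> (b \<cdot> \<sigma> y))) \<one>"
    by (rule comul_mul_source[where f="\<lambda>a b. f a (\<tau> b)"]) (auto intro!: lins bilI)
  also have "\<dots> = D (\<lambda>a b. f a (\<tau> (\<tau> b \<cdot> \<sigma> y))) \<one>"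
    by (rule unit_target[where f="\<lambda>a b. f a (\<tau> (b \<cdot> \<sigma> y))", symmetric]) (auto intro!: lins bilI)
  also have "\<dots> = D (\<lambda>a b. f a (\<tau> b \<cdot> S (\<sigma> y))) \<one>"
    by (simp add: target_source[symmetric] target_target_mul cong: D_cong)
  also have "\<dots> = D (\<lambda>u v. f u (v \<cdot> S (\<sigma> y))) \<one>"
    by (rule unit_target[where f="\<lambda>a b. f a (b \<cdot> S (\<sigma> y))"]) (auto intro!: lins bilI)
  finally show ?thesis .
qed

lemma unit_target_shift:
  assumes f: "bil f" and [simp]: "x \<in> E"
  shows "D (\<lambda>u v. f u (\<tau> x \<cdot> v)) \<one> = D (\<lambda>u v. f (S (\<tau> x) \<cdot> u) v) \<one>"
proof -
  note [lins] = bil_left[OF f] bil_right[OF f]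
  have "D (\<lambda>u v. f u (\<tau> x \<cdot> v)) \<one> = D (\<lambda>a b. f (\<sigma> a) b) (\<tau> x \<cdot> \<one>)"
    using f by (simp add: source_left_leg unit_right)
  also have "\<dots> = D (\<lambda>a b. f (\<sigma> (\<tau> x \<cdot> a)) b) \<one>"
    by (rule comul_target_mul'[where f="\<lambda>a b. f (\<sigma> a) b"]) (auto intro!: lins bilI)
  also have "\<dots> = D (\<lambda>a b. f (\<sigma> (\<tau> x \<cdot> \<sigma> a)) b) \<one>"
    by (rule unit_source[where f="\<lambda>a b. f (\<sigma> (\<tau> x \<cdot> a)) b", symmetric]) (auto intro!: lins bilI)
  also have "\<dots> = D (\<lambda>a b. f (S (\<tau> x) \<cdot> \<sigma> a) b) \<one>"
    by (simp add: source_target[symmetric] source_source_mul cong: D_cong)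
  also have "\<dots> = D (\<lambda>u v. f (S (\<tau> x) \<cdot> u) v) \<one>"
    by (rule unit_source[where f="\<lambda>a b. f (S (\<tau> x) \<cdot> a) b"]) (auto intro!: lins bilI)
  finally show ?thesis .
qed

text \<open>
  The expansion behind the invariance of the trace: \<open>S(q) S\<^sup>2(n) = S(S(n) q)\<close> contains the
  source map of the second leg of \<open>h\<close>, and \<open>h\<^sub>1 \<otimes> \<sigma>(h\<^sub>2) = h u \<otimes> S(v)\<close> lets it merge with \<open>S\<^sup>2(b)\<close>.
\<close>

lemma trace_integral_insert:
  assumes \<phi>: "lin \<phi>" and \<psi>: "lin \<psi>" and [simp]: "h \<in> E" "y \<in> E"
  shows "D (\<lambda>a b. \<phi> (h \<cdot> a) * \<psi> (S (S b))) y
    = D (\<lambda>p q. D (\<lambda>a b. \<phi> a * \<psi> (S q \<cdot> S (S b))) (p \<cdot> y)) h"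
proof -
  note [lins] = lin_comp[OF \<phi>] lin_comp[OF \<psi>]
  have "D (\<lambda>p q. D (\<lambda>a b. \<phi> a * \<psi> (S q \<cdot> S (S b))) (p \<cdot> y)) h
     = D (\<lambda>p q. D (\<lambda>m n. D (\<lambda>c d. \<phi> (m \<cdot> c) * \<psi> (S (S n \<cdot> q) \<cdot> S (S d))) y) p) h"
    by (rule D_cong[OF refl], subst D_mul) (auto intro!: lins bilI D_cong simp: antipode_mul mul_assoc)
  also have "\<dots> = D (\<lambda>m w. D (\<lambda>n q. D (\<lambda>c d. \<phi> (m \<cdot> c) * \<psi> (S (S n \<cdot> q) \<cdot> S (S d))) y) w) h"
    by (rule D_coassoc) simp
  also have "\<dots> = D (\<lambda>m w. D (\<lambda>c d. \<phi> (m \<cdot> c) * \<psi> (S (\<sigma> w) \<cdot> S (S d))) y) h"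
    by (intro D_cong refl source_antipode[where f="\<lambda>z. D (\<lambda>c d. \<phi> (_ \<cdot> c) * \<psi> (S z \<cdot> S (S d))) y", symmetric]) (auto intro!: lins)
  also have "\<dots> = D (\<lambda>u v. D (\<lambda>c d. \<phi> (h \<cdot> u \<cdot> c) * \<psi> (S (S v) \<cdot> S (S d))) y) \<one>"
    by (rule source_right_leg[where f="\<lambda>u v. D (\<lambda>c d. \<phi> (u \<cdot> c) * \<psi> (S v \<cdot> S (S d))) y"]) (auto intro!: lins bilI)
  also have "\<dots> = D (\<lambda>u v. D (\<lambda>c d. \<phi> (h \<cdot> (u \<cdot> c)) * \<psi> (S (S (v \<cdot> d)))) y) \<one>"
    by (intro D_cong refl) (simp add: antipode_mul mul_assoc)
  also have "\<dots> = D (\<lambda>a b. \<phi> (h \<cdot> a) * \<psi> (S (S b))) y"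
    by (rule D_one_left[where f="\<lambda>a b. \<phi> (h \<cdot> a) * \<psi> (S (S b))", symmetric]) (auto intro!: lins bilI)
  finally show ?thesis ..
qed

text \<open>
  After the expansion, \<open>\<phi>(h l)\<close> is the trace of \<open>y \<mapsto> S(h\<^sub>2) F(h\<^sub>1 y)\<close> with
  \<open>F(y) = \<phi>(y\<^sub>1) S\<^sup>2(y\<^sub>2)\<close>. Moving \<open>S(h\<^sub>2)\<close> to the other end of the composition gives the trace of
  \<open>y \<mapsto> F(h\<^sub>1 S(h\<^sub>2) y) = F(\<tau>(h) y)\<close>, and \<open>\<tau>(h)\<close> acts on the first leg only.
\<close>

lemma trace_integral_left:
  assumes [simp]: "h \<in> E"
  shows "h \<cdot> trace_integral = \<tau> h \<cdot> trace_integral"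
proof (rule lin_ext)
  fix \<phi> assume \<phi>: "lin \<phi>"
  note [lins] = lin_comp[OF \<phi>]
  define G where "G d x = D (\<lambda>a b. \<phi> a * coord d (S (S b))) x" for d x
  have [lins]: "lin (\<lambda>x. G d (g x))" if "linH g" for d g
    using that unfolding G_def by (auto intro!: lins)
  have "\<phi> (h \<cdot> trace_integral) = (\<Sum>i\<in>B. D (\<lambda>a b. \<phi> (h \<cdot> a) * coord i (S (S b))) i)"
    by (rule trace_integral_apply) (auto intro!: lins)
  also have "\<dots> = (\<Sum>i\<in>B. D (\<lambda>p q. D (\<lambda>a b. \<phi> a * coord i (S q \<cdot> S (S b))) (p \<cdot> i)) h)"
    by (intro sum.cong refl trace_integral_insert \<phi> lin_co) auto
  also have "\<dots> = (\<Sum>i\<in>B. D (\<lambda>p q. \<Sum>d\<in>B. coord i (S q \<cdot> d) * G d (p \<cdot> i)) h)"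
  proof (intro sum.cong D_cong refl)
    fix i p q assume [simp]: "i \<in> B" "p \<in> E" "q \<in> E"
    have "coord i (S q \<cdot> w) = (\<Sum>d\<in>B. coord d w * coord i (S q \<cdot> d))" if "w \<in> E" for w
      using that by (intro expand[of "\<lambda>w. coord i (S q \<cdot> w)"]) (auto intro!: lins)
    then have "D (\<lambda>a b. \<phi> a * coord i (S q \<cdot> S (S b))) (p \<cdot> i)
       = D (\<lambda>a b. \<Sum>d\<in>B. coord i (S q \<cdot> d) * (\<phi> a * coord d (S (S b)))) (p \<cdot> i)"
      by (intro D_cong refl) (simp add: sum_distrib_left mult_ac)
    then show "D (\<lambda>a b. \<phi> a * coord i (S q \<cdot> S (S b))) (p \<cdot> i) = (\<Sum>d\<in>B. coord i (S q \<cdot> d) * G d (p \<cdot> i))"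
      by (simp add: D_sum D_times G_def)
  qed
  also have "\<dots> = D (\<lambda>p q. \<Sum>d\<in>B. \<Sum>i\<in>B. coord i (S q \<cdot> d) * G d (p \<cdot> i)) h"
    unfolding D_sum[symmetric] by (intro D_cong refl sum.swap)
  \<comment> \<open>cyclicity of the trace: the sum over \<open>i\<close> is the coordinate expansion of \<open>S q \<cdot> d\<close>\<close>
  also have "\<dots> = D (\<lambda>p q. \<Sum>d\<in>B. G d (p \<cdot> (S q \<cdot> d))) h"
    by (intro D_cong sum.cong refl expand[of "\<lambda>z. G _ (_ \<cdot> z)", symmetric]) (auto intro!: lins)
  also have "\<dots> = (\<Sum>d\<in>B. D (\<lambda>p q. G d (p \<cdot> S q \<cdot> d)) h)"
    unfolding D_sum by (intro sum.cong D_cong refl) (simp add: mul_assoc)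
  also have "\<dots> = (\<Sum>d\<in>B. G d (\<tau> h \<cdot> d))"
    by (intro sum.cong refl target_antipode[where f="\<lambda>z. G _ (z \<cdot> _)", symmetric]) (auto intro!: lins)
  also have "\<dots> = (\<Sum>d\<in>B. D (\<lambda>a b. \<phi> (\<tau> h \<cdot> a) * coord d (S (S b))) d)"
    unfolding G_def
    by (intro sum.cong refl comul_target_mul'[where f="\<lambda>a b. \<phi> a * coord _ (S (S b))"]) (auto intro!: lins bilI)
  also have "\<dots> = \<phi> (\<tau> h \<cdot> trace_integral)"
    by (rule trace_integral_apply[symmetric]) (auto intro!: lins)
  finally show "\<phi> (h \<cdot> trace_integral) = \<phi> (\<tau> h \<cdot> trace_integral)" .
qed auto

lemma target_integral_commute:
  assumes [simp]: "l \<in> E" "y \<in> E" and l: "\<And>h. h \<in> E \<Longrightarrow> h \<cdot> l = \<tau> h \<cdot> l"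
  shows "\<tau> l \<cdot> S (\<sigma> y) = S (\<sigma> y) \<cdot> \<tau> l"
proof (rule lin_ext)
  fix f assume f: "lin f"
  note [lins] = lin_comp[OF f]
  have "f (\<tau> l \<cdot> S (\<sigma> y)) = D (\<lambda>u v. \<epsilon> (u \<cdot> l) * f (v \<cdot> S (\<sigma> y))) \<one>"
    by (rule target_apply) (auto intro!: lins)
  also have "\<dots> = D (\<lambda>u v. \<epsilon> (u \<cdot> \<sigma> y \<cdot> l) * f v) \<one>"
    by (rule unit_source_shift[where f="\<lambda>u v. \<epsilon> (u \<cdot> l) * f v", symmetric]) (auto intro!: lins bilI)
  also have "\<dots> = f (\<tau> (\<sigma> y \<cdot> l))"
    by (subst target_apply[OF f]) (auto intro!: D_cong simp: mul_assoc)
  also have "\<tau> (\<sigma> y \<cdot> l) = S (\<sigma> y) \<cdot> \<tau> l"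
    using l[of "\<sigma> y"] target_target_mul[of "\<sigma> y" l] by (simp add: target_source)
  finally show "f (\<tau> l \<cdot> S (\<sigma> y)) = f (S (\<sigma> y) \<cdot> \<tau> l)" .
qed auto

text \<open>
  Put \<open>z = \<tau>(l)\<close>. The integral property gives \<open>h\<^sub>1 z S(h\<^sub>2) = \<tau>(h l) = \<tau>(h) z\<close>; multiplying by a further leg yields
  \<open>h\<^sub>1 z \<sigma>(h\<^sub>2) = \<tau>(h\<^sub>1) z h\<^sub>2\<close>. The left side is \<open>h u z S(v) = h z\<close>, as \<open>z\<close> commutes with the
  source base. The right side is \<open>S(u) z v h = z h\<close>, as \<open>z\<close> commutes with the image of the source base
  under \<open>S\<close>.
\<close>

lemma target_integral_central:
  assumes [simp]: "l \<in> E" "h \<in> E" and l: "\<And>h. h \<in> E \<Longrightarrow> h \<cdot> l = \<tau> h \<cdot> l"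
  shows "h \<cdot> \<tau> l = \<tau> l \<cdot> h"
proof (rule lin_ext)
  fix f assume f: "lin f"
  note [lins] = lin_comp[OF f]
  have adj: "g (\<tau> p \<cdot> \<tau> l) = D (\<lambda>a b. g (a \<cdot> \<tau> l \<cdot> S b)) p" if g: "lin g" and [simp]: "p \<in> E" for g p
  proof -
    note [lins] = lin_comp[OF g]
    have "g (\<tau> p \<cdot> \<tau> l) = g (\<tau> (p \<cdot> \<tau> l))"
      using l[of p] target_target_mul[of p l] target_mul_target[of p l] by simp
    also have "\<dots> = D (\<lambda>a b. g (a \<cdot> \<tau> l \<cdot> S b)) p"
      by (subst target_antipode[OF g], simp, rule comul_mul_target[where f="\<lambda>a b. g (a \<cdot> S b)"]) (auto intro!: lins bilI)
    finally show ?thesis .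
  qed
  have "f (h \<cdot> \<tau> l) = D (\<lambda>u v. f (h \<cdot> \<tau> l \<cdot> (u \<cdot> S v))) \<one>"
    by (subst target_antipode[where f="\<lambda>z. f (h \<cdot> \<tau> l \<cdot> z)", symmetric]) (auto intro!: lins simp: unit_right)
  also have "\<dots> = D (\<lambda>u v. f (h \<cdot> \<tau> l \<cdot> (\<sigma> u \<cdot> S v))) \<one>"
    by (rule unit_source[where f="\<lambda>u v. f (h \<cdot> \<tau> l \<cdot> (u \<cdot> S v))", symmetric]) (auto intro!: lins bilI)
  also have "\<dots> = D (\<lambda>u v. f (h \<cdot> \<sigma> u \<cdot> \<tau> l \<cdot> S v)) \<one>"
  proof (intro D_cong refl)
    fix u v assume [simp]: "u \<in> E" "v \<in> E"
    show "f (h \<cdot> \<tau> l \<cdot> (\<sigma> u \<cdot> S v)) = f (h \<cdot> \<sigma> u \<cdot> \<tau> l \<cdot> S v)"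
      using source_target_commute[of u l] by (simp add: mul_assoc[symmetric]) (simp add: mul_assoc)
  qed
  also have "\<dots> = D (\<lambda>u v. f (h \<cdot> u \<cdot> \<tau> l \<cdot> S v)) \<one>"
    by (rule unit_source[where f="\<lambda>u v. f (h \<cdot> u \<cdot> \<tau> l \<cdot> S v)"]) (auto intro!: lins bilI)
  also have "\<dots> = D (\<lambda>a q. f (a \<cdot> \<tau> l \<cdot> \<sigma> q)) h"
    by (rule source_right_leg[where f="\<lambda>a q. f (a \<cdot> \<tau> l \<cdot> q)", symmetric]) (auto intro!: lins bilI)
  also have "\<dots> = D (\<lambda>a q. D (\<lambda>b c. f (a \<cdot> \<tau> l \<cdot> (S b \<cdot> c))) q) h"
    by (intro D_cong refl source_antipode[where f="\<lambda>z. f (_ \<cdot> z)"]) (auto intro!: lins)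
  also have "\<dots> = D (\<lambda>p c. D (\<lambda>a b. f (a \<cdot> \<tau> l \<cdot> (S b \<cdot> c))) p) h"
    by (rule D_coassoc[symmetric]) simp
  also have "\<dots> = D (\<lambda>p c. f (\<tau> p \<cdot> \<tau> l \<cdot> c)) h"
    by (rule D_cong[OF refl], subst adj[where g="\<lambda>z. f (z \<cdot> _)"]) (auto intro!: lins D_cong simp: mul_assoc)
  also have "\<dots> = D (\<lambda>u v. f (S u \<cdot> \<tau> l \<cdot> (v \<cdot> h))) \<one>"
    by (rule target_left_leg[where f="\<lambda>a b. f (a \<cdot> \<tau> l \<cdot> b)"]) (auto intro!: lins bilI)
  also have "\<dots> = D (\<lambda>u v. f (S (\<sigma> u) \<cdot> \<tau> l \<cdot> (v \<cdot> h))) \<one>"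
    by (rule unit_source[where f="\<lambda>u v. f (S u \<cdot> \<tau> l \<cdot> (v \<cdot> h))", symmetric]) (auto intro!: lins bilI)
  also have "\<dots> = D (\<lambda>u v. f (\<tau> l \<cdot> (S (\<sigma> u) \<cdot> v) \<cdot> h)) \<one>"
    using target_integral_commute[OF _ _ l] by (intro D_cong refl) (simp add: mul_assoc[symmetric])
  also have "\<dots> = D (\<lambda>u v. f (\<tau> l \<cdot> (S u \<cdot> v) \<cdot> h)) \<one>"
    by (rule unit_source[where f="\<lambda>u v. f (\<tau> l \<cdot> (S u \<cdot> v) \<cdot> h)"]) (auto intro!: lins bilI)
  also have "\<dots> = f (\<tau> l \<cdot> h)"
    by (subst source_antipode[where f="\<lambda>z. f (\<tau> l \<cdot> z \<cdot> h)", symmetric]) (auto intro!: lins simp: unit_right)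
  finally show "f (h \<cdot> \<tau> l) = f (\<tau> l \<cdot> h)" .
qed auto

text \<open>
  A central \<open>z\<close> in the target base acts on the second leg of \<open>\<Delta>(h)\<close> equally from both sides.
  It is moved to the first leg through \<open>u \<otimes> z v = S(z) u \<otimes> v\<close> and, because
  \<open>S\<^sup>2(z) = z\<close>, through \<open>u \<otimes> v z = u S(z) \<otimes> v\<close>.
\<close>

lemma antipode_central:
  assumes [simp]: "x \<in> E" "h \<in> E" and c: "\<And>h. h \<in> E \<Longrightarrow> h \<cdot> \<tau> x = \<tau> x \<cdot> h"
    and S2: "S (S (\<tau> x)) = \<tau> x"
  shows "h \<cdot> S (\<tau> x) = S (\<tau> x) \<cdot> h"
proof (rule lin_ext)
  fix f assume f: "lin f"
  note [lins] = lin_comp[OF f]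
  have "f (h \<cdot> S (\<tau> x)) = D (\<lambda>a b. f (a \<cdot> S (\<tau> x)) * \<epsilon> b) h"
    by (rule D_counit_right[symmetric]) (auto intro!: lins)
  also have "\<dots> = D (\<lambda>a b. D (\<lambda>u v. f (a \<cdot> (u \<cdot> \<sigma> (\<tau> x))) * \<epsilon> (b \<cdot> v)) \<one>) h"
    by (subst D_one_right) (auto intro!: lins bilI D_cong simp: mul_assoc source_target)
  also have "\<dots> = D (\<lambda>a b. D (\<lambda>u v. f (a \<cdot> u) * \<epsilon> (b \<cdot> (v \<cdot> S (\<sigma> (\<tau> x))))) \<one>) h"
    by (intro D_cong refl unit_source_shift[where f="\<lambda>u v. f (_ \<cdot> u) * \<epsilon> (_ \<cdot> v)"]) (auto intro!: lins bilI)
  also have "\<dots> = D (\<lambda>a b. f a * \<epsilon> (b \<cdot> \<tau> x)) h"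
    by (subst (3) D_one_right) (auto intro!: lins bilI D_cong simp: mul_assoc source_target S2)
  also have "\<dots> = D (\<lambda>a b. f a * \<epsilon> (\<tau> x \<cdot> b)) h"
    by (intro D_cong refl) (simp add: c)
  also have "\<dots> = D (\<lambda>a b. D (\<lambda>u v. f (u \<cdot> a) * \<epsilon> (\<tau> x \<cdot> v \<cdot> b)) \<one>) h"
    by (subst D_one_left, auto intro!: lins bilI)[1] (subst D_swap, auto intro!: D_cong simp: mul_assoc)
  also have "\<dots> = D (\<lambda>a b. D (\<lambda>u v. f (S (\<tau> x) \<cdot> u \<cdot> a) * \<epsilon> (v \<cdot> b)) \<one>) h"
    by (intro D_cong refl unit_target_shift[where f="\<lambda>u v. f (u \<cdot> _) * \<epsilon> (v \<cdot> _)"]) (auto intro!: lins bilI)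
  also have "\<dots> = D (\<lambda>a b. f (S (\<tau> x) \<cdot> a) * \<epsilon> b) h"
    by (subst (3) D_one_left, (auto intro!: lins bilI)[2]) (subst D_swap, auto intro!: D_cong simp: mul_assoc)
  also have "\<dots> = f (S (\<tau> x) \<cdot> h)"
    by (rule D_counit_right) (auto intro!: lins)
  finally show "f (h \<cdot> S (\<tau> x)) = f (S (\<tau> x) \<cdot> h)" .
qed auto

text \<open>
  Both sides are values of \<open>h\<^sub>1 l\<^sub>1 \<otimes> S(h\<^sub>2 l\<^sub>2) h\<^sub>3\<close>. Contracting \<open>S(h\<^sub>2) h\<^sub>3\<close> gives the left side;
  using \<open>h\<^sub>1 l = \<tau>(h\<^sub>1) l\<close> instead gives the right side.
\<close>

lemma integral_casimir:
  assumes f: "bil f" and [simp]: "l \<in> E" "h \<in> E" and l: "\<And>h. h \<in> E \<Longrightarrow> h \<cdot> l = \<tau> h \<cdot> l"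
  shows "D (\<lambda>a b. f (h \<cdot> a) (S b)) l = D (\<lambda>a b. f a (S b \<cdot> h)) l"
proof -
  note [lins] = bil_left[OF f] bil_right[OF f]
  have "D (\<lambda>a b. f (h \<cdot> a) (S b)) l = D (\<lambda>u v. D (\<lambda>a b. f (h \<cdot> (u \<cdot> a)) (S (v \<cdot> b))) l) \<one>"
    by (rule D_one_left) (auto intro!: lins bilI)
  also have "\<dots> = D (\<lambda>u v. D (\<lambda>a b. f (h \<cdot> u \<cdot> a) (S b \<cdot> S v)) l) \<one>"
    by (intro D_cong refl) (simp add: mul_assoc antipode_mul)
  also have "\<dots> = D (\<lambda>m w. D (\<lambda>a b. f (m \<cdot> a) (S b \<cdot> \<sigma> w)) l) h"
    by (rule source_right_leg[where f="\<lambda>u v. D (\<lambda>a b. f (u \<cdot> a) (S b \<cdot> v)) l", symmetric]) (auto intro!: lins bilI)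
  also have "\<dots> = D (\<lambda>m w. D (\<lambda>n q. D (\<lambda>a b. f (m \<cdot> a) (S b \<cdot> (S n \<cdot> q))) l) w) h"
    by (intro D_cong refl source_antipode[where f="\<lambda>z. D (\<lambda>a b. f (_ \<cdot> a) (S b \<cdot> z)) l"]) (auto intro!: lins)
  also have "\<dots> = D (\<lambda>p q. D (\<lambda>m n. D (\<lambda>a b. f (m \<cdot> a) (S b \<cdot> (S n \<cdot> q))) l) p) h"
    by (rule D_coassoc[symmetric]) simp
  also have "\<dots> = D (\<lambda>p q. D (\<lambda>a b. f a (S b \<cdot> q)) (\<tau> p \<cdot> l)) h"
    by (rule D_cong[OF refl], subst l[symmetric], simp, subst D_mul) (auto intro!: lins bilI D_cong simp: mul_assoc antipode_mul)
  also have "\<dots> = D (\<lambda>p q. D (\<lambda>a b. f (\<tau> p \<cdot> a) (S b \<cdot> q)) l) h"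
    by (intro D_cong refl comul_target_mul'[where f="\<lambda>a b. f a (S b \<cdot> _)"]) (auto intro!: lins bilI)
  also have "\<dots> = D (\<lambda>u v. D (\<lambda>a b. f (S u \<cdot> a) (S b \<cdot> (v \<cdot> h))) l) \<one>"
    by (rule target_left_leg[where f="\<lambda>p q. D (\<lambda>a b. f (p \<cdot> a) (S b \<cdot> q)) l"]) (auto intro!: lins bilI)
  also have "\<dots> = D (\<lambda>u v. D (\<lambda>a b. f (S (\<sigma> u) \<cdot> a) (S b \<cdot> (v \<cdot> h))) l) \<one>"
    by (rule unit_source[where f="\<lambda>u v. D (\<lambda>a b. f (S u \<cdot> a) (S b \<cdot> (v \<cdot> h))) l", symmetric]) (auto intro!: lins bilI)
  also have "\<dots> = D (\<lambda>u v. D (\<lambda>a b. f a (S (\<sigma> u \<cdot> b) \<cdot> (v \<cdot> h))) l) \<one>"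
  proof (rule D_cong[OF refl])
    fix u v assume [simp]: "u \<in> E" "v \<in> E"
    have b: "bil (\<lambda>a b. f a (S b \<cdot> (v \<cdot> h)))" by (auto intro!: lins bilI)
    show "D (\<lambda>a b. f (S (\<sigma> u) \<cdot> a) (S b \<cdot> (v \<cdot> h))) l = D (\<lambda>a b. f a (S (\<sigma> u \<cdot> b) \<cdot> (v \<cdot> h))) l"
      using comul_target_mul'[OF b, of l "\<sigma> u"] comul_source_mul'[OF b, of l u] l[of "\<sigma> u"]
      by (simp add: target_source)
  qed
  also have "\<dots> = D (\<lambda>u v. D (\<lambda>a b. f a (S (u \<cdot> b) \<cdot> (v \<cdot> h))) l) \<one>"
    by (rule unit_source[where f="\<lambda>u v. D (\<lambda>a b. f a (S (u \<cdot> b) \<cdot> (v \<cdot> h))) l"]) (auto intro!: lins bilI)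
  also have "\<dots> = D (\<lambda>u v. D (\<lambda>a b. f a (S b \<cdot> (S u \<cdot> v) \<cdot> h)) l) \<one>"
    by (intro D_cong refl) (simp add: mul_assoc antipode_mul)
  also have "\<dots> = D (\<lambda>a b. f a (S b \<cdot> h)) l"
    by (subst source_antipode[where f="\<lambda>z. D (\<lambda>a b. f a (S b \<cdot> z \<cdot> h)) l", symmetric]) (auto intro!: lins simp: unit_right cong: D_cong)
  finally show ?thesis .
qed

section \<open>Semisimplicity of the algebra\<close>

text \<open>
  The Casimir element \<open>l\<^sub>1 \<otimes> S(l\<^sub>2)\<close>, divided by \<open>c\<close>, is written as \<open>\<Sum> x\<^sub>b \<otimes> b\<close> over the basis; the
  product of its legs is \<open>\<tau>(l) / c\<close>.
\<close>

lemma semisimple_if_integral: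
  assumes [simp]: "l \<in> E" and l: "\<And>h. h \<in> E \<Longrightarrow> h \<cdot> l = \<tau> h \<cdot> l"
    and c: "\<tau> l = scl H c \<one>" "c \<noteq> 0"
  shows "semisimple H"
proof -
  define x where "x b = (\<Sum>j\<in>B. scl H (\<Sum>i\<in>{l}. D (\<lambda>p q. coord j p * (coord b (S q) / c)) i) j)" for b
  have x [simp]: "x b \<in> E" for b by (simp add: x_def)
  have x_apply: "f (x b) = D (\<lambda>p q. f p * (coord b (S q) / c)) l" if "lin f" for f b
    unfolding x_def by (subst apply_coordinates[OF that]) simp
  have expand_antipode: "(\<Sum>b\<in>B. D (\<lambda>p q. f p b * (coord b (S q) / c)) l) = D (\<lambda>p q. f p (S q)) l / c"
    if "bil f" for f
  proof -
    note [lins] = bil_right[OF that]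
    have "D (\<lambda>p q. f p (S q)) l = D (\<lambda>p q. \<Sum>b\<in>B. coord b (S q) * f p b) l"
      by (intro D_cong refl expand[of "f _"]) (auto intro!: lins)
    then show ?thesis by (simp add: D_sum sum_divide_distrib D_times_right[of _ "1 / c", symmetric, simplified] mult_ac)
  qed
  show ?thesis
  proof (rule semisimple_if_separable[of B x "\<lambda>b. b"])
    show "(\<Sum>b\<in>B. x b \<cdot> b) = \<one>"
    proof (rule lin_ext)
      fix f assume f: "lin f"
      note [lins] = lin_comp[OF f]
      have "f (\<Sum>b\<in>B. x b \<cdot> b) = (\<Sum>b\<in>B. f (x b \<cdot> b))"
        using f by (rule lin_sum) auto
      also have "\<dots> = (\<Sum>b\<in>B. D (\<lambda>p q. f (p \<cdot> b) * (coord b (S q) / c)) l)"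
        by (intro sum.cong refl x_apply) (auto intro!: lins)
      also have "\<dots> = D (\<lambda>p q. f (p \<cdot> S q)) l / c"
        by (rule expand_antipode) (auto intro!: lins bilI)
      also have "\<dots> = f \<one>"
        using f c by (simp add: target_antipode[OF f, symmetric] lin_scale)
      finally show "f (\<Sum>b\<in>B. x b \<cdot> b) = f \<one>" .
    qed auto
    fix a assume [simp]: "a \<in> E"
    have "a \<cdot> x b = (\<Sum>d\<in>B. scl H (coord b (d \<cdot> a)) (x d))" if "b \<in> B" for b
    proof (rule lin_ext)
      fix f assume f: "lin f"
      note [lins] = lin_comp[OF f]
      have "f (a \<cdot> x b) = D (\<lambda>p q. f (a \<cdot> p) * coord b (S q)) l / c"
        by (subst x_apply) (auto intro!: lins simp: D_times_right[of _ "1 / c", symmetric, simplified])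
      also have "\<dots> = D (\<lambda>p q. f p * coord b (S q \<cdot> a)) l / c"
        by (subst integral_casimir[where f="\<lambda>p q. f p * coord b q"]) (auto intro!: lins bilI l)
      also have "\<dots> = (\<Sum>d\<in>B. D (\<lambda>p q. f p * coord b (d \<cdot> a) * (coord d (S q) / c)) l)"
        by (rule expand_antipode[symmetric]) (auto intro!: lins bilI)
      also have "\<dots> = (\<Sum>d\<in>B. coord b (d \<cdot> a) * f (x d))"
        by (simp add: x_apply f D_times[symmetric] mult_ac)
      also have "\<dots> = f (\<Sum>d\<in>B. scl H (coord b (d \<cdot> a)) (x d))"
        using f by (simp add: lin_sum lin_scale)
      finally show "f (a \<cdot> x b) = f (\<Sum>d\<in>B. scl H (coord b (d \<cdot> a)) (x d))" .
    qed (use that in auto)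
    moreover have "d \<cdot> a = (\<Sum>b\<in>B. scl H (coord b (d \<cdot> a)) b)" if "d \<in> B" for d
      using that by (simp add: expand_vector)
    ultimately show "\<exists>\<alpha>. (\<forall>j\<in>B. a \<cdot> x j = (\<Sum>i\<in>B. scl H (\<alpha> i j) (x i))) \<and>
        (\<forall>i\<in>B. i \<cdot> a = (\<Sum>j\<in>B. scl H (\<alpha> i j) j))"
      by (intro exI[of _ "\<lambda>d b. coord b (d \<cdot> a)"]) auto
  qed (use finite_B in auto)
qed

lemma counit_target: assumes [simp]: "x \<in> E" shows "\<epsilon> (\<tau> x) = \<epsilon> x"
  using target_apply[OF counit_linear, of x] counit_unit2[of \<one> x]
  by (simp add: unit_left mult.commute cong: D_cong)

lemma counit_trace_integral: "\<epsilon> trace_integral = (\<Sum>i\<in>B. coord i (S (S i)))"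
  using D_counit_left[OF lin_co'[OF linH_S[OF antipode_linear]]]
  by (simp add: trace_integral_apply[OF counit_linear])

lemma semisimple_algebra:
  assumes "connected_wha H" and S2: "\<And>z. z \<in> E \<Longrightarrow> S (S (\<tau> z)) = \<tau> z"
    and tr: "(\<Sum>i\<in>B. coord i (S (S i))) \<noteq> 0"
  shows "semisimple H"
proof -
  let ?l = trace_integral
  have "S (\<tau> ?l) \<cdot> h = h \<cdot> S (\<tau> ?l)" if "h \<in> E" for h
    using that
    by (intro antipode_central[symmetric] target_integral_central S2 trace_integral_left) auto
  then have "S (\<tau> ?l) \<in> center H"
    by (simp add: center_def)
  moreover have "S (\<tau> ?l) \<in> source_base H"
    unfolding source_base_def by (subst source_target[symmetric]) auto
  ultimately obtain c where "S (\<tau> ?l) = scl H c \<one>"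
    using assms(1) by (auto simp: connected_wha_def)
  then have "S (S (\<tau> ?l)) = scl H c (S \<one>)"
    using linH_scale[OF antipode_linear] by simp
  then have c: "\<tau> ?l = scl H c \<one>"
    by (simp add: S2)
  have "c * \<epsilon> \<one> = \<epsilon> ?l"
    using counit_target[of ?l] lin_scale[OF counit_linear] by (simp add: c)
  then have "c \<noteq> 0" using tr by (auto simp: counit_trace_integral)
  then show ?thesis
    by (intro semisimple_if_integral[OF _ trace_integral_left c]) auto
qed

section \<open>An integral on the dual\<close>

text \<open>
  The functional \<open>x \<mapsto> Tr(y \<mapsto> x S\<^sup>2(y))\<close>.
\<close>

definition trace_functional :: "'v \<Rightarrow> 'k" where
  "trace_functional x = (\<Sum>i\<in>B. coord i (x \<cdot> S (S i)))"

lemma lin_trace_functional: "lin trace_functional"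
  unfolding trace_functional_def by (auto intro!: lins)

lemmas lin_trace_functional' [lins] = lin_comp[OF lin_trace_functional]

lemma comul_antipode2:
  assumes f: "bil f" and [simp]: "h \<in> E"
  shows "D f (S (S h)) = D (\<lambda>a b. f (S (S a)) (S (S b))) h"
proof -
  note [lins] = bil_left[OF f] bil_right[OF f]
  have "bil (\<lambda>a b. f (S b) (S a))" by (auto intro!: lins bilI)
  then show ?thesis
    using f by (simp add: comul_antipode)
qed

lemma unit_antipode2:
  assumes f: "bil f"
  shows "D (\<lambda>u v. f (S (S u)) (S (S v))) \<one> = D f \<one>"
proof -
  note [lins] = bil_left[OF f] bil_right[OF f]
  have "bil (\<lambda>u v. f (S v) (S u))" by (auto intro!: lins bilI)
  from unit_swap[OF this] show ?thesis by (simp add: unit_swap[OF f])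
qed

text \<open>
  Since \<open>S\<^sup>2\<close> preserves \<open>\<Delta>(1)\<close>, one has \<open>x\<^sub>1 \<otimes> x\<^sub>2 S\<^sup>2(y) = x\<^sub>1 S(\<tau>(y\<^sub>1)) \<otimes> x\<^sub>2 S\<^sup>2(y\<^sub>2)\<close>, and
  \<open>S(y\<^sub>1 S(y\<^sub>2)) = S\<^sup>2(y\<^sub>2) S(y\<^sub>1)\<close> completes the right factor to the coproduct of \<open>x S\<^sup>2(y\<^sub>2)\<close>.
\<close>

lemma trace_functional_insert:
  assumes \<phi>: "lin \<phi>" and \<psi>: "lin \<psi>" and [simp]: "x \<in> E" "y \<in> E"
  shows "D (\<lambda>p q. \<phi> p * \<psi> (q \<cdot> S (S y))) x
    = D (\<lambda>m r. D (\<lambda>p q. \<phi> (p \<cdot> S m) * \<psi> q) (x \<cdot> S (S r))) y"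
proof -
  note [lins] = lin_comp[OF \<phi>] lin_comp[OF \<psi>]
  have "D (\<lambda>p q. \<phi> p * \<psi> (q \<cdot> S (S y))) x
     = D (\<lambda>p q. D (\<lambda>u v. \<phi> (p \<cdot> u) * \<psi> (q \<cdot> v \<cdot> S (S y))) \<one>) x"
    by (rule D_one_right) (auto intro!: lins bilI)
  also have "\<dots> = D (\<lambda>p q. D (\<lambda>u v. \<phi> (p \<cdot> S (S u)) * \<psi> (q \<cdot> S (S v) \<cdot> S (S y))) \<one>) x"
    by (intro D_cong refl unit_antipode2[where f="\<lambda>u v. \<phi> (_ \<cdot> u) * \<psi> (_ \<cdot> v \<cdot> S (S y))", symmetric])
      (auto intro!: lins bilI)
  also have "\<dots> = D (\<lambda>p q. D (\<lambda>u v. \<phi> (p \<cdot> S (S u)) * \<psi> (q \<cdot> S (S (v \<cdot> y)))) \<one>) x"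
    by (intro D_cong refl) (simp add: antipode_mul mul_assoc)
  also have "\<dots> = D (\<lambda>p q. D (\<lambda>a c. \<phi> (p \<cdot> S (\<tau> a)) * \<psi> (q \<cdot> S (S c))) y) x"
    by (intro D_cong refl target_left_leg[where f="\<lambda>a c. \<phi> (_ \<cdot> S a) * \<psi> (_ \<cdot> S (S c))", symmetric])
      (auto intro!: lins bilI)
  also have "\<dots> = D (\<lambda>p q. D (\<lambda>a c. D (\<lambda>m n. \<phi> (p \<cdot> S (m \<cdot> S n)) * \<psi> (q \<cdot> S (S c))) a) y) x"
    by (intro D_cong refl target_antipode[where f="\<lambda>z. \<phi> (_ \<cdot> S z) * \<psi> (_ \<cdot> S (S _))"])
      (auto intro!: lins)
  also have "\<dots> = D (\<lambda>p q. D (\<lambda>m r. D (\<lambda>n c. \<phi> (p \<cdot> S (S n) \<cdot> S m) * \<psi> (q \<cdot> S (S c))) r) y) x"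
    by (rule D_cong[OF refl], subst D_coassoc) (auto intro!: D_cong simp: antipode_mul mul_assoc)
  also have "\<dots> = D (\<lambda>m r. D (\<lambda>p q. D (\<lambda>n c. \<phi> (p \<cdot> S (S n) \<cdot> S m) * \<psi> (q \<cdot> S (S c))) r) x) y"
    by (rule D_swap)
  also have "\<dots> = D (\<lambda>m r. D (\<lambda>p q. \<phi> (p \<cdot> S m) * \<psi> q) (x \<cdot> S (S r))) y"
  proof (rule D_cong[OF refl])
    fix m r assume [simp]: "m \<in> E" "r \<in> E"
    have "D (\<lambda>p q. D (\<lambda>n c. \<phi> (p \<cdot> S (S n) \<cdot> S m) * \<psi> (q \<cdot> S (S c))) r) x
       = D (\<lambda>p q. D (\<lambda>n c. \<phi> (p \<cdot> n \<cdot> S m) * \<psi> (q \<cdot> c)) (S (S r))) x"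
      by (intro D_cong refl comul_antipode2[where f="\<lambda>n c. \<phi> (_ \<cdot> n \<cdot> S m) * \<psi> (_ \<cdot> c)", symmetric])
        (auto intro!: lins bilI)
    also have "\<dots> = D (\<lambda>p q. \<phi> (p \<cdot> S m) * \<psi> q) (x \<cdot> S (S r))"
      by (rule D_mul[symmetric]) (auto intro!: lins bilI)
    finally show "D (\<lambda>p q. D (\<lambda>n c. \<phi> (p \<cdot> S (S n) \<cdot> S m) * \<psi> (q \<cdot> S (S c))) r) x
       = D (\<lambda>p q. \<phi> (p \<cdot> S m) * \<psi> q) (x \<cdot> S (S r))" .
  qed
  finally show ?thesis .
qed

text \<open>
  The integral property of the dual; \<open>S(u) \<chi>(x v)\<close> on the right takes the place of the scalar \<open>\<chi>(x) 1\<close> of the Hopf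
  algebra case. The proof is the dual of \<open>trace_integral_left\<close>: after the expansion, the map
  \<open>r \<mapsto> \<phi>(r\<^sub>1 S(a)) r\<^sub>2\<close> is moved around the trace and meets the coproduct of the argument,
  where \<open>\<tau>\<close> appears.
\<close>

lemma trace_functional_left:
  assumes \<phi>: "lin \<phi>" and [simp]: "x \<in> E"
    and S2: "\<And>z. z \<in> E \<Longrightarrow> S (S (\<tau> z)) = \<tau> z"
  shows "D (\<lambda>a b. \<phi> a * trace_functional b) x = D (\<lambda>u v. \<phi> (S u) * trace_functional (x \<cdot> v)) \<one>"
proof -
  note [lins] = lin_comp[OF \<phi>]
  define K where "K b a r = D (\<lambda>p q. \<phi> (p \<cdot> S a) * coord b q) r" for b a r
  have [lins]: "lin (\<lambda>r. K b a (g r))" if "linH g" for b a g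
    using that unfolding K_def by (auto intro!: lins)
  have "D (\<lambda>a b. \<phi> a * trace_functional b) x = (\<Sum>b\<in>B. D (\<lambda>p q. \<phi> p * coord b (q \<cdot> S (S b))) x)"
    by (simp add: trace_functional_def sum_distrib_left D_sum)
  also have "\<dots> = (\<Sum>b\<in>B. D (\<lambda>a c. K b a (x \<cdot> S (S c))) b)"
    unfolding K_def by (intro sum.cong refl trace_functional_insert \<phi> lin_co) auto
  also have "\<dots> = (\<Sum>b\<in>B. D (\<lambda>a c. \<Sum>d\<in>B. coord d (x \<cdot> S (S c)) * K b a d) b)"
    by (intro sum.cong D_cong refl expand) (auto intro!: lins)
  also have "\<dots> = (\<Sum>d\<in>B. \<Sum>b\<in>B. D (\<lambda>a c. D (\<lambda>p q. coord b q * (\<phi> (p \<cdot> S a) * coord d (x \<cdot> S (S c)))) d) b)"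
    unfolding D_sum K_def by (subst sum.swap) (simp add: D_times[symmetric] mult_ac)
  also have "\<dots> = (\<Sum>d\<in>B. D (\<lambda>p q. \<Sum>b\<in>B. coord b q * D (\<lambda>a c. \<phi> (p \<cdot> S a) * coord d (x \<cdot> S (S c))) b) d)"
    unfolding D_sum D_times[symmetric] by (intro sum.cong refl D_swap)
  \<comment> \<open>cyclicity of the trace: the sum over \<open>b\<close> is the coordinate expansion of \<open>q\<close>\<close>
  also have "\<dots> = (\<Sum>d\<in>B. D (\<lambda>p q. D (\<lambda>a c. \<phi> (p \<cdot> S a) * coord d (x \<cdot> S (S c))) q) d)"
    by (intro sum.cong D_cong refl expand[symmetric]) (auto intro!: lins)
  also have "\<dots> = (\<Sum>d\<in>B. D (\<lambda>p c. D (\<lambda>q a. \<phi> (q \<cdot> S a) * coord d (x \<cdot> S (S c))) p) d)"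
    by (intro sum.cong refl D_coassoc[symmetric]) simp
  also have "\<dots> = (\<Sum>d\<in>B. D (\<lambda>p c. \<phi> (\<tau> p) * coord d (x \<cdot> S (S c))) d)"
    by (intro sum.cong D_cong refl arg_cong2[where f="(*)"])
      (simp add: D_times_right target_antipode[OF \<phi>])
  also have "\<dots> = (\<Sum>d\<in>B. D (\<lambda>u v. \<phi> (S u) * coord d (x \<cdot> S (S (v \<cdot> d)))) \<one>)"
    by (intro sum.cong refl target_left_leg[where f="\<lambda>p c. \<phi> p * coord _ (x \<cdot> S (S c))"]) (auto intro!: lins bilI)
  also have "\<dots> = D (\<lambda>u v. \<phi> (S u) * (\<Sum>d\<in>B. coord d (x \<cdot> S (S (v \<cdot> d))))) \<one>"
    by (simp add: sum_distrib_left D_sum)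
  \<comment> \<open>the second leg of \<open>\<Delta>(1)\<close> lies in the target base, where the square of the antipode is the identity\<close>
  also have "\<dots> = D (\<lambda>u v. \<phi> (S u) * (\<Sum>d\<in>B. coord d (x \<cdot> S (S (\<tau> v \<cdot> d))))) \<one>"
    by (rule unit_target[where f="\<lambda>u v. \<phi> (S u) * (\<Sum>d\<in>B. coord d (x \<cdot> S (S (v \<cdot> d))))", symmetric])
      (auto intro!: lins bilI)
  also have "\<dots> = D (\<lambda>u v. \<phi> (S u) * trace_functional (x \<cdot> \<tau> v)) \<one>"
    unfolding trace_functional_def
    by (intro D_cong refl arg_cong2[where f="(*)"] sum.cong) (simp add: antipode_mul S2 mul_assoc)
  also have "\<dots> = D (\<lambda>u v. \<phi> (S u) * trace_functional (x \<cdot> v)) \<one>"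
    by (rule unit_target[where f="\<lambda>u v. \<phi> (S u) * trace_functional (x \<cdot> v)"]) (auto intro!: lins bilI)
  finally show ?thesis .
qed

text \<open>
  The bilinear form \<open>\<chi>(x S(y))\<close> is a Casimir element of \<open>H\<^sup>* \<otimes> H\<^sup>*\<close>. Both sides arise from
  \<open>r\<^sub>1 y\<^sub>2 \<chi>(r\<^sub>2)\<close> with \<open>r = x S(y\<^sub>1)\<close>: on the one hand \<open>S(y\<^sub>2) y\<^sub>3\<close> contracts, on the other hand the
  integral property applies to \<open>r\<close>. The base element that it introduces, \<open>S(u) = S\<^sup>2(v')\<close> after swapping
  the legs, is \<open>v'\<close>, and then disappears in \<open>\<Delta>(1) \<Delta>(y) = \<Delta>(y)\<close>.
\<close>

lemma functional_casimir:
  assumes \<phi>: "lin \<phi>" and \<chi>: "lin \<chi>" and [simp]: "x \<in> E" "y \<in> E"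
    and S2: "\<And>z. z \<in> E \<Longrightarrow> S (S (\<tau> z)) = \<tau> z"
    and left: "\<And>\<phi> x. lin \<phi> \<Longrightarrow> x \<in> E \<Longrightarrow> D (\<lambda>a b. \<phi> a * \<chi> b) x = D (\<lambda>u v. \<phi> (S u) * \<chi> (x \<cdot> v)) \<one>"
  shows "D (\<lambda>a b. \<phi> a * \<chi> (b \<cdot> S y)) x = D (\<lambda>c d. \<chi> (x \<cdot> S c) * \<phi> d) y"
proof -
  note [lins] = lin_comp[OF \<phi>] lin_comp[OF \<chi>]
  have "D (\<lambda>a b. \<phi> a * \<chi> (b \<cdot> S y)) x = D (\<lambda>a b. D (\<lambda>u v. \<phi> (a \<cdot> u) * \<chi> (b \<cdot> v \<cdot> S y)) \<one>) x"
    by (rule D_one_right) (auto intro!: lins bilI)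
  also have "\<dots> = D (\<lambda>a b. D (\<lambda>u v. \<phi> (a \<cdot> S v) * \<chi> (b \<cdot> S u \<cdot> S y)) \<one>) x"
    by (intro D_cong refl unit_swap[where f="\<lambda>u v. \<phi> (_ \<cdot> u) * \<chi> (_ \<cdot> v \<cdot> S y)", symmetric]) (auto intro!: lins bilI)
  also have "\<dots> = D (\<lambda>a b. D (\<lambda>u v. \<phi> (a \<cdot> S v) * \<chi> (b \<cdot> S (y \<cdot> u))) \<one>) x"
    by (intro D_cong refl) (simp add: antipode_mul mul_assoc)
  also have "\<dots> = D (\<lambda>a b. D (\<lambda>c d. \<phi> (a \<cdot> \<sigma> d) * \<chi> (b \<cdot> S c)) y) x"
    by (intro D_cong refl source_right_leg[where f="\<lambda>c d. \<phi> (_ \<cdot> d) * \<chi> (_ \<cdot> S c)", symmetric]) (auto intro!: lins bilI)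
  also have "\<dots> = D (\<lambda>a b. D (\<lambda>c d. D (\<lambda>m n. \<phi> (a \<cdot> (S m \<cdot> n)) * \<chi> (b \<cdot> S c)) d) y) x"
    by (intro D_cong refl source_antipode[where f="\<lambda>d. \<phi> (_ \<cdot> d) * \<chi> (_ \<cdot> S _)"]) (auto intro!: lins)
  also have "\<dots> = D (\<lambda>a b. D (\<lambda>d n. D (\<lambda>c m. \<phi> (a \<cdot> S m \<cdot> n) * \<chi> (b \<cdot> S c)) d) y) x"
    by (rule D_cong[OF refl], subst D_coassoc) (auto intro!: D_cong simp: mul_assoc)
  also have "\<dots> = D (\<lambda>d n. D (\<lambda>a b. D (\<lambda>c m. \<phi> (a \<cdot> S m \<cdot> n) * \<chi> (b \<cdot> S c)) d) x) y"
    by (rule D_swap)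
  also have "\<dots> = D (\<lambda>d n. D (\<lambda>a b. \<phi> (a \<cdot> n) * \<chi> b) (x \<cdot> S d)) y"
  proof (rule D_cong[OF refl])
    fix d n assume [simp]: "d \<in> E" "n \<in> E"
    have "D (\<lambda>a b. D (\<lambda>c m. \<phi> (a \<cdot> S m \<cdot> n) * \<chi> (b \<cdot> S c)) d) x
       = D (\<lambda>a b. D (\<lambda>p q. \<phi> (a \<cdot> p \<cdot> n) * \<chi> (b \<cdot> q)) (S d)) x"
      by (intro D_cong refl comul_antipode[where f="\<lambda>p q. \<phi> (_ \<cdot> p \<cdot> n) * \<chi> (_ \<cdot> q)", symmetric]) (auto intro!: lins bilI)
    also have "\<dots> = D (\<lambda>a b. \<phi> (a \<cdot> n) * \<chi> b) (x \<cdot> S d)"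
      by (rule D_mul[symmetric]) (auto intro!: lins bilI)
    finally show "D (\<lambda>a b. D (\<lambda>c m. \<phi> (a \<cdot> S m \<cdot> n) * \<chi> (b \<cdot> S c)) d) x
       = D (\<lambda>a b. \<phi> (a \<cdot> n) * \<chi> b) (x \<cdot> S d)" .
  qed
  also have "\<dots> = D (\<lambda>d n. D (\<lambda>u v. \<phi> (S u \<cdot> n) * \<chi> (x \<cdot> S d \<cdot> v)) \<one>) y"
    by (intro D_cong refl left[where \<phi>="\<lambda>z. \<phi> (z \<cdot> _)"]) (auto intro!: lins)
  also have "\<dots> = D (\<lambda>d n. D (\<lambda>u v. \<phi> (v \<cdot> n) * \<chi> (x \<cdot> S (u \<cdot> d))) \<one>) y"
  proof (rule D_cong[OF refl])
    fix d n assume [simp]: "d \<in> E" "n \<in> E"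
    have "D (\<lambda>u v. \<phi> (S u \<cdot> n) * \<chi> (x \<cdot> S d \<cdot> v)) \<one> = D (\<lambda>u v. \<phi> (S (S v) \<cdot> n) * \<chi> (x \<cdot> S d \<cdot> S u)) \<one>"
      by (rule unit_swap[where f="\<lambda>u v. \<phi> (S u \<cdot> n) * \<chi> (x \<cdot> S d \<cdot> v)", symmetric]) (auto intro!: lins bilI)
    also have "\<dots> = D (\<lambda>u v. \<phi> (S (S (\<tau> v)) \<cdot> n) * \<chi> (x \<cdot> S d \<cdot> S u)) \<one>"
      by (rule unit_target[where f="\<lambda>u v. \<phi> (S (S v) \<cdot> n) * \<chi> (x \<cdot> S d \<cdot> S u)", symmetric]) (auto intro!: lins bilI)
    also have "\<dots> = D (\<lambda>u v. \<phi> (\<tau> v \<cdot> n) * \<chi> (x \<cdot> S (u \<cdot> d))) \<one>"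
      by (intro D_cong refl) (simp add: S2 antipode_mul mul_assoc)
    also have "\<dots> = D (\<lambda>u v. \<phi> (v \<cdot> n) * \<chi> (x \<cdot> S (u \<cdot> d))) \<one>"
      by (rule unit_target[where f="\<lambda>u v. \<phi> (v \<cdot> n) * \<chi> (x \<cdot> S (u \<cdot> d))"]) (auto intro!: lins bilI)
    finally show "D (\<lambda>u v. \<phi> (S u \<cdot> n) * \<chi> (x \<cdot> S d \<cdot> v)) \<one> = D (\<lambda>u v. \<phi> (v \<cdot> n) * \<chi> (x \<cdot> S (u \<cdot> d))) \<one>" .
  qed
  also have "\<dots> = D (\<lambda>c d. \<chi> (x \<cdot> S c) * \<phi> d) y"
    by (subst D_swap, subst (3) D_one_left) (auto intro!: lins bilI simp: mult.commute)
  finally show ?thesis .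
qed

section \<open>The dual algebra\<close>

abbreviation Hd where "Hd \<equiv> dual H"
abbreviation Vd where "Vd \<equiv> dual_space H"

lemma dual_elems: "elems Hd = {\<phi>. lin \<phi> \<and> (\<forall>x. x \<notin> E \<longrightarrow> \<phi> x = 0)}"
  and dual_space_elems: "elems Vd = {\<phi>. lin \<phi> \<and> (\<forall>x. x \<notin> E \<longrightarrow> \<phi> x = 0)}"
  and dual_scl: "scl Hd = (\<lambda>c \<phi> x. c * \<phi> x)" "scl Vd = (\<lambda>c \<phi> x. c * \<phi> x)"
  and dual_unit: "unit_elt Hd = (\<lambda>h. if h \<in> E then \<epsilon> h else 0)"
  by (simp_all add: dual_def dual_space_def)

lemma lin_bil_mul: "lin f \<Longrightarrow> lin g \<Longrightarrow> bil (\<lambda>a b. f a * g b)"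
  by (auto intro!: bilI lin_times_left lin_times_right)

lemma dual_mul:
  "lin \<phi> \<Longrightarrow> lin \<psi> \<Longrightarrow> mul Hd \<phi> \<psi> h = (if h \<in> E then D (\<lambda>a b. \<phi> a * \<psi> b) h else 0)"
  by (simp add: dual_def legs_D lin_bil_mul)

lemma lin_restrict: "lin \<phi> \<Longrightarrow> lin (\<lambda>h. if h \<in> E then \<phi> h else 0)"
  by (auto simp: linear_map_def)

lemma dual_mul_closed: "lin \<phi> \<Longrightarrow> lin \<psi> \<Longrightarrow> mul Hd \<phi> \<psi> \<in> elems Hd"
proof -
  assume lin: "lin \<phi>" "lin \<psi>"
  have "mul Hd \<phi> \<psi> = (\<lambda>h. if h \<in> E then D (\<lambda>a b. \<phi> a * \<psi> b) h else 0)"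
    by (rule ext) (rule dual_mul[OF lin])
  then show ?thesis
    using lin_restrict[OF lin_D[OF linH_id, of "\<lambda>a b. \<phi> a * \<psi> b"]] by (simp add: dual_elems)
qed

lemma dual_vspace: "vspace Hd" "vspace Vd"
proof -
  interpret F: vector_space "\<lambda>c (\<phi> :: 'v \<Rightarrow> 'k) x. c * \<phi> x"
    by unfold_locales (auto simp: fun_eq_iff algebra_simps)
  have "F.subspace {\<phi>. lin \<phi> \<and> (\<forall>x. x \<notin> E \<longrightarrow> \<phi> x = 0)}"
    by (intro F.subspaceI) (auto simp: zero_fun_def lin_zero_fun lin_plus lin_times_left plus_fun_def)
  then show "vspace Hd" "vspace Vd"
    using F.vector_space_axioms by (simp_all add: vspace_def dual_elems dual_space_elems dual_scl)
qed

lemma dual_k_algebra: "k_algebra Hd"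
proof -
  interpret vspace Hd by (rule dual_vspace)
  show ?thesis
  proof
    show "bilinear_map Hd Hd Hd (mul Hd)"
      unfolding bilinear_map_def linear_map_def
      using dual_mul_closed
      by (auto simp: dual_elems dual_scl fun_eq_iff dual_mul lin_plus lin_times_left plus_fun_def
          D_plus D_times[symmetric] algebra_simps)
    show "unit_elt Hd \<in> elems Hd"
      by (simp add: dual_elems dual_unit lin_restrict counit_linear)
  next
    fix \<phi> \<psi> \<chi> assume "\<phi> \<in> elems Hd" "\<psi> \<in> elems Hd" "\<chi> \<in> elems Hd"
    then have [simp]: "lin \<phi>" "lin \<psi>" "lin \<chi>" by (auto simp: dual_elems)
    have [simp]: "lin (mul Hd \<phi> \<psi>)" "lin (mul Hd \<psi> \<chi>)"
      using dual_mul_closed by (auto simp: dual_elems)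
    show "mul Hd (mul Hd \<phi> \<psi>) \<chi> = mul Hd \<phi> (mul Hd \<psi> \<chi>)"
    proof (rule ext)
      fix h
      show "mul Hd (mul Hd \<phi> \<psi>) \<chi> h = mul Hd \<phi> (mul Hd \<psi> \<chi>) h"
      proof (cases "h \<in> E")
        case h: True
        have "mul Hd (mul Hd \<phi> \<psi>) \<chi> h = D (\<lambda>a b. D (\<lambda>c d. \<phi> c * \<psi> d * \<chi> b) a) h"
          using h by (simp add: dual_mul D_times_right cong: D_cong)
        also have "\<dots> = D (\<lambda>a b. D (\<lambda>c d. \<phi> a * \<psi> c * \<chi> d) b) h"
          by (rule D_coassoc) fact
        also have "\<dots> = mul Hd \<phi> (mul Hd \<psi> \<chi>) h"
          using h by (simp add: dual_mul D_times mult.assoc cong: D_cong)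
        finally show ?thesis .
      qed (simp add: dual_mul)
    qed
  next
    fix \<phi> assume "\<phi> \<in> elems Hd"
    then have [simp]: "lin \<phi>" "\<And>x. x \<notin> E \<Longrightarrow> \<phi> x = 0" by (auto simp: dual_elems)
    have [simp]: "lin (unit_elt Hd)" by (simp add: dual_unit lin_restrict counit_linear)
    show "mul Hd (unit_elt Hd) \<phi> = \<phi>" "mul Hd \<phi> (unit_elt Hd) = \<phi>"
      by (simp_all add: fun_eq_iff dual_mul) (simp_all add: dual_unit D_counit_left D_counit_right cong: D_cong)
  qed
qed

lemma sum_apply: "(\<Sum>i\<in>J. F i) x = (\<Sum>i\<in>J. F i x)" for F :: "'c \<Rightarrow> 'd \<Rightarrow> 'k"
  by (induction J rule: infinite_finite_induct) auto

lemma co_outside: "x \<notin> E \<Longrightarrow> coord b x = 0"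
  by (simp add: coord_def amb.representation_def span_B)

text \<open>
  The form \<open>\<chi>(x S(y)) / c\<close> is written as \<open>\<Sum> \<chi>(_ S(b)) / c \<otimes> coord b\<close>, that is, in the dual basis for its
  second variable.
\<close>

lemma semisimple_dual_if_integral:
  assumes \<chi>: "lin \<chi>" and S2: "\<And>z. z \<in> E \<Longrightarrow> S (S (\<tau> z)) = \<tau> z"
    and left: "\<And>\<phi> x. lin \<phi> \<Longrightarrow> x \<in> E \<Longrightarrow> D (\<lambda>a b. \<phi> a * \<chi> b) x = D (\<lambda>u v. \<phi> (S u) * \<chi> (x \<cdot> v)) \<one>"
    and c: "\<And>x. x \<in> E \<Longrightarrow> \<chi> (\<tau> x) = c * \<epsilon> x" "c \<noteq> 0"
  shows "semisimple Hd"
proof -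
  note [lins] = lin_comp[OF \<chi>]
  define x where "x b = (\<lambda>h. if h \<in> E then \<chi> (h \<cdot> S b) / c else 0)" for b
  have lin_x: "lin (x b)" if "b \<in> B" for b
    using that lin_times_right[OF lin_comp[OF \<chi> linH_mul_left[OF linH_id]], of "S b" "1 / c"]
    by (simp add: x_def lin_restrict)
  interpret A: k_algebra Hd by (rule dual_k_algebra)
  show ?thesis
  proof (rule A.semisimple_if_separable[of B x coord])
    show "finite B" by (rule finite_B)
    show "x b \<in> elems Hd" if "b \<in> B" for b
      using lin_x[OF that] by (simp add: dual_elems x_def)
    show "coord b \<in> elems Hd" for b
      by (simp add: dual_elems lin_co co_outside)
    show "(\<Sum>b\<in>B. mul Hd (x b) (coord b)) = unit_elt Hd"
    proof (rule ext)
      fix h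
      show "(\<Sum>b\<in>B. mul Hd (x b) (coord b)) h = unit_elt Hd h"
      proof (cases "h \<in> E")
        case h: True
        have "(\<Sum>b\<in>B. mul Hd (x b) (coord b)) h = (\<Sum>b\<in>B. D (\<lambda>p q. coord b q * (\<chi> (p \<cdot> S b) / c)) h)"
          unfolding sum_apply
          by (intro sum.cong refl, simp add: dual_mul lin_x lin_co h)
            (auto intro!: D_cong simp: x_def)
        also have "\<dots> = D (\<lambda>p q. \<chi> (p \<cdot> S q) * (1 / c)) h"
          unfolding D_sum[symmetric]
          by (intro D_cong refl, subst expand[of "\<lambda>q. \<chi> (_ \<cdot> S q) * (1 / c)"]) (auto intro!: lins)
        also have "\<dots> = unit_elt Hd h"
          unfolding D_times_right target_antipode[OF \<chi> h, symmetric] using h c by (simp add: dual_unit)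
        finally show ?thesis .
      qed (simp add: sum_apply dual_mul lin_x lin_co dual_unit)
    qed
    fix \<phi> assume "\<phi> \<in> elems Hd"
    then have \<phi> [simp]: "lin \<phi>" by (simp add: dual_elems)
    define \<alpha> where "\<alpha> i j = D (\<lambda>p q. coord i p * \<phi> q) j" for i j
    have "mul Hd \<phi> (x j) = (\<Sum>i\<in>B. scl Hd (\<alpha> i j) (x i))" if [simp]: "j \<in> B" for j
    proof (rule ext)
      fix h
      show "mul Hd \<phi> (x j) h = (\<Sum>i\<in>B. scl Hd (\<alpha> i j) (x i)) h"
      proof (cases "h \<in> E")
        case h: True
        have "mul Hd \<phi> (x j) h = D (\<lambda>a b. \<phi> a * \<chi> (b \<cdot> S j) * (1 / c)) h"
          using h by (simp add: dual_mul lin_x) (auto intro!: D_cong simp: x_def)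
        also have "\<dots> = D (\<lambda>p q. \<chi> (h \<cdot> S p) * \<phi> q) j * (1 / c)"
          unfolding D_times_right using functional_casimir[OF \<phi> \<chi> h _ S2 left, of j] by simp
        also have "\<dots> = D (\<lambda>p q. (\<Sum>i\<in>B. coord i p * \<chi> (h \<cdot> S i)) * \<phi> q) j * (1 / c)"
          by (intro arg_cong2[where f="(*)"] D_cong refl expand[of "\<lambda>p. \<chi> (h \<cdot> S p)"]) (auto intro!: lins h)
        also have "\<dots> = D (\<lambda>p q. \<Sum>i\<in>B. coord i p * \<phi> q * (\<chi> (h \<cdot> S i) * (1 / c))) j"
          unfolding D_times_right[symmetric]
          by (intro D_cong refl) (simp add: sum_distrib_right sum_distrib_left sum_divide_distrib mult_ac)
        also have "\<dots> = (\<Sum>i\<in>B. \<alpha> i j * (\<chi> (h \<cdot> S i) * (1 / c)))"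
          unfolding D_sum D_times_right \<alpha>_def ..
        also have "\<dots> = (\<Sum>i\<in>B. scl Hd (\<alpha> i j) (x i)) h"
          using h by (simp add: sum_apply dual_scl x_def)
        finally show ?thesis .
      qed (simp add: dual_mul lin_x sum_apply dual_scl, simp add: x_def)
    qed
    moreover have "mul Hd (coord i) \<phi> = (\<Sum>j\<in>B. scl Hd (\<alpha> i j) (coord j))" for i
    proof (rule ext)
      fix h
      show "mul Hd (coord i) \<phi> h = (\<Sum>j\<in>B. scl Hd (\<alpha> i j) (coord j)) h"
      proof (cases "h \<in> E")
        case h: True
        have "mul Hd (coord i) \<phi> h = D (\<lambda>p q. coord i p * \<phi> q) h"
          using h by (simp add: dual_mul lin_co)
        also have "\<dots> = (\<Sum>j\<in>B. coord j h * D (\<lambda>p q. coord i p * \<phi> q) j)"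
          using h by (intro expand) (auto intro!: lins)
        finally show ?thesis by (simp add: sum_apply dual_scl \<alpha>_def mult.commute)
      qed (simp add: dual_mul lin_co sum_apply dual_scl co_outside)
    qed
    ultimately show "\<exists>\<alpha>. (\<forall>j\<in>B. mul Hd \<phi> (x j) = (\<Sum>i\<in>B. scl Hd (\<alpha> i j) (x i))) \<and>
        (\<forall>i\<in>B. mul Hd (coord i) \<phi> = (\<Sum>j\<in>B. scl Hd (\<alpha> i j) (coord j)))"
      by blast
  qed
qed

section \<open>Connectedness of the dual\<close>

lemma dual_simple_tensor: "simple_tensor Hd Hd = simple_tensor Vd Vd"
  by (intro ext) (simp add: simple_tensor_def bilinear_map_def linear_map_def dual_elems
      dual_space_elems dual_scl)

lemma dual_sweedler: "sweedler Hd Hd = sweedler Vd Vd"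
  by (intro ext) (simp add: sweedler_def dual_simple_tensor dual_elems dual_space_elems)

lemma dual_expand: "\<alpha> \<in> elems Vd \<Longrightarrow> \<alpha> = (\<Sum>i\<in>B. scl Vd (\<alpha> i) (coord i))"
proof (rule ext)
  fix x assume "\<alpha> \<in> elems Vd"
  then show "\<alpha> x = (\<Sum>i\<in>B. scl Vd (\<alpha> i) (coord i)) x"
    using expand[of \<alpha> x]
    by (cases "x \<in> E") (auto simp: dual_space_elems sum_apply dual_scl co_outside mult.commute)
qed

lemma dual_bilinear_expand:
  assumes \<beta>: "bilinear_map Vd Vd ground \<beta>" and \<alpha>: "\<alpha> \<in> elems Vd" "\<gamma> \<in> elems Vd"
  shows "\<beta> \<alpha> \<gamma> = (\<Sum>i\<in>B. \<Sum>j\<in>B. \<alpha> i * \<gamma> j * \<beta> (coord i) (coord j))"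
proof -
  interpret V: vspace Vd by (rule dual_vspace)
  interpret F: vector_space "scl Vd" by (rule V.ambient)
  have coord [simp]: "coord i \<in> elems Vd" for i by (simp add: dual_space_elems lin_co co_outside)
  have sc [simp]: "scl Vd c \<phi> \<in> elems Vd" if "\<phi> \<in> elems Vd" for c \<phi>
    using F.subspace_scale[OF V.subspace_elems that] .
  have sum: "f (\<Sum>i\<in>J. scl Vd (c i) (coord i)) = (\<Sum>i\<in>J. c i * f (coord i))"
    if f: "linear_map Vd ground f" for f c and J :: "'v set"
  proof -
    have add: "f (a + b) = f a + f b" if "a \<in> elems Vd" "b \<in> elems Vd" for a b
      using f that by (simp add: linear_map_def)
    have scale: "f (scl Vd d a) = d * f a" if "a \<in> elems Vd" for a d
      using f that by (simp add: linear_map_def ground_def)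
    have "f 0 = 0" using scale[of "coord undefined" 0] by simp
    moreover have "(\<Sum>i\<in>J. scl Vd (c i) (coord i)) \<in> elems Vd" for J :: "'v set"
      by (intro F.subspace_sum[OF V.subspace_elems]) simp
    ultimately show ?thesis
      by (induction J rule: infinite_finite_induct) (auto simp: add scale)
  qed
  have "\<beta> \<alpha> \<gamma> = (\<Sum>i\<in>B. \<alpha> i * \<beta> (coord i) \<gamma>)"
    using \<beta> \<alpha> sum[of "\<lambda>a. \<beta> a \<gamma>" \<alpha> B] by (simp add: bilinear_map_def dual_expand[symmetric])
  also have "\<dots> = (\<Sum>i\<in>B. \<alpha> i * (\<Sum>j\<in>B. \<gamma> j * \<beta> (coord i) (coord j)))"
    using \<beta> \<alpha> sum[of "\<beta> (coord _)" \<gamma> B] by (simp add: bilinear_map_def dual_expand[symmetric])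
  finally show ?thesis by (simp add: sum_distrib_left mult.assoc)
qed

text \<open>
  The condition by which the coproduct of the unit of the dual is specified.
\<close>

definition represents :: "('k, 'v \<Rightarrow> 'k, 'v \<Rightarrow> 'k) tens \<Rightarrow> bool" where
  "represents t \<longleftrightarrow> t \<in> elems (tensor Vd Vd) \<and> (\<forall>h\<in>E. \<forall>g\<in>E.
     (\<Sum>(\<alpha>, \<beta>)\<leftarrow>sweedler Vd Vd t. \<alpha> h * \<beta> g) = unit_elt Hd (h \<cdot> g))"

lemma dual_sweedler_props:
  assumes "t \<in> elems (tensor Vd Vd)"
  shows "set (sweedler Vd Vd t) \<subseteq> elems Vd \<times> elems Vd"
    "(\<Sum>(\<alpha>, \<beta>)\<leftarrow>sweedler Vd Vd t. simple_tensor Vd Vd \<alpha> \<beta>) = t"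
  using someI_ex[OF tensor_representation[OF assms dual_vspace(2)]]
  unfolding sweedler_def by auto

lemma sum_list_cong_pairs:
  "set xs \<subseteq> A \<times> A' \<Longrightarrow> (\<And>a b. a \<in> A \<Longrightarrow> b \<in> A' \<Longrightarrow> F a b = G a b) \<Longrightarrow>
   (\<Sum>(a, b)\<leftarrow>xs. F a b) = (\<Sum>(a, b)\<leftarrow>xs. G a b)" for F :: "'c \<Rightarrow> 'd \<Rightarrow> 'k"
  by (intro arg_cong[where f=sum_list] map_cong) auto

text \<open>
  A tensor is determined by its values at bilinear forms, and such a form is determined by its values on
  pairs of coordinate functionals; these are multiplied by the pairings with basis elements.
\<close>

lemma represents_unique:
  assumes "represents t" "represents t'" shows "t = t'"
proof (rule ext)
  fix \<beta>
  have val: "s \<beta> = (if bilinear_map Vd Vd ground \<beta> then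
      (\<Sum>i\<in>B. \<Sum>j\<in>B. unit_elt Hd (i \<cdot> j) * \<beta> (coord i) (coord j)) else 0)" if s: "represents s" for s
  proof (cases "bilinear_map Vd Vd ground \<beta>")
    case \<beta>: True
    let ?ps = "sweedler Vd Vd s"
    have t: "s \<in> elems (tensor Vd Vd)" using s by (simp add: represents_def)
    have "s \<beta> = (\<Sum>(\<alpha>, \<gamma>)\<leftarrow>?ps. \<beta> \<alpha> \<gamma>)"
      by (subst dual_sweedler_props(2)[OF t, symmetric]) (simp add: sum_list_apply2 simple_tensor_def \<beta>)
    also have "\<dots> = (\<Sum>(\<alpha>, \<gamma>)\<leftarrow>?ps. \<Sum>i\<in>B. \<Sum>j\<in>B. \<alpha> i * \<gamma> j * \<beta> (coord i) (coord j))"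
      by (rule sum_list_cong_pairs[OF dual_sweedler_props(1)[OF t] dual_bilinear_expand[OF \<beta>]])
    also have "\<dots> = (\<Sum>i\<in>B. \<Sum>j\<in>B. (\<Sum>(\<alpha>, \<gamma>)\<leftarrow>?ps. \<alpha> i * \<gamma> j) * \<beta> (coord i) (coord j))"
      by (simp add: sum_list_sum sum_list_mult)
    also have "\<dots> = (\<Sum>i\<in>B. \<Sum>j\<in>B. unit_elt Hd (i \<cdot> j) * \<beta> (coord i) (coord j))"
      using s by (simp add: represents_def)
    finally show ?thesis using \<beta> by simp
  next
    case \<beta>: False
    have t: "s \<in> elems (tensor Vd Vd)" using s by (simp add: represents_def)
    have "(\<Sum>(\<alpha>, \<gamma>)\<leftarrow>ps. 0) = (0::'k)" for ps :: "(('v \<Rightarrow> 'k) \<times> ('v \<Rightarrow> 'k)) list"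
      by (induction ps) auto
    then have "s \<beta> = 0"
      by (subst dual_sweedler_props(2)[OF t, symmetric]) (simp add: sum_list_apply2 simple_tensor_def \<beta>)
    then show ?thesis using \<beta> by simp
  qed
  show "t \<beta> = t' \<beta>" using val[OF assms(1)] val[OF assms(2)] by simp
qed

lemma represents_exists: "\<exists>t. represents t"
proof -
  let ?s = "\<lambda>c (t :: ('k, 'v \<Rightarrow> 'k, 'v \<Rightarrow> 'k) tens) \<beta>. c * t \<beta>"
  interpret T: module ?s
    by unfold_locales (auto simp: fun_eq_iff algebra_simps)
  define t where "t = (\<Sum>i\<in>B. \<Sum>j\<in>B. ?s (\<epsilon> (i \<cdot> j)) (simple_tensor Vd Vd (coord i) (coord j)))"
  have coord: "coord i \<in> elems Vd" for i by (simp add: dual_space_elems lin_co co_outside)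
  have t: "t \<in> elems (tensor Vd Vd)"
    unfolding t_def tensor_def using coord
    by (auto intro!: T.span_sum T.span_scale intro: T.span_base)
  have "(\<Sum>(\<alpha>, \<beta>)\<leftarrow>sweedler Vd Vd t. \<alpha> h * \<beta> g) = unit_elt Hd (h \<cdot> g)" if [simp]: "h \<in> E" "g \<in> E" for h g
  proof -
    have ev: "bilinear_map Vd Vd ground (\<lambda>\<alpha> \<beta>. \<alpha> h * \<beta> g)"
      by (simp add: bilinear_map_def linear_map_def ground_def dual_scl algebra_simps)
    have "(\<Sum>(\<alpha>, \<beta>)\<leftarrow>sweedler Vd Vd t. \<alpha> h * \<beta> g) = t (\<lambda>\<alpha> \<beta>. \<alpha> h * \<beta> g)"
      by (subst (2) dual_sweedler_props(2)[OF t, symmetric]) (simp add: sum_list_apply2 simple_tensor_def ev)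
    also have "\<dots> = (\<Sum>i\<in>B. \<Sum>j\<in>B. coord i h * coord j g * \<epsilon> (i \<cdot> j))"
      by (simp add: t_def sum_apply simple_tensor_def ev mult.commute)
    also have "\<dots> = \<epsilon> (h \<cdot> g)"
      by (rule bil_expand[symmetric]) (auto intro!: bilI lins)
    finally show ?thesis by (simp add: dual_unit)
  qed
  with t show ?thesis by (auto simp: represents_def)
qed

lemma D_sum_list:
  "(\<Sum>(c, d)\<leftarrow>xs. D (\<lambda>a b. f a b c d) h) = D (\<lambda>a b. \<Sum>(c, d)\<leftarrow>xs. f a b c d) h"
  by (induction xs) (auto simp: D_plus D_def[of "\<lambda>_ _. 0"])

text \<open>
  The source map of the dual is the transpose of the source map. So the source base of the dual consists of the
  functionals \<open>\<psi> \<circ> \<sigma>\<close>, extended by zero outside of the carrier.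
\<close>

lemma dual_source_map:
  assumes \<psi>: "\<psi> \<in> elems Hd"
  shows "source_map Hd \<psi> x = (if x \<in> E then \<psi> (\<sigma> x) else 0)"
proof -
  have lin: "lin \<psi>" using \<psi> by (simp add: dual_elems)
  let ?ps = "legs Hd (unit_elt Hd)"
  have "comul Hd (unit_elt Hd) = (THE t. represents t)"
    by (simp add: dual_def represents_def)
  then have "represents (comul Hd (unit_elt Hd))"
    using represents_exists represents_unique by (metis the_equality)
  then have ps: "set ?ps \<subseteq> elems Vd \<times> elems Vd"
    and ev: "\<And>h g. h \<in> E \<Longrightarrow> g \<in> E \<Longrightarrow> (\<Sum>(\<alpha>, \<beta>)\<leftarrow>?ps. \<alpha> h * \<beta> g) = \<epsilon> (h \<cdot> g)"
    using dual_sweedler_props(1) by (auto simp: represents_def legs_def dual_sweedler dual_unit)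
  have *: "source_map Hd \<psi> x = (\<Sum>(\<alpha>, \<beta>)\<leftarrow>?ps. mul Hd \<psi> \<beta> \<one> * \<alpha> x)"
    unfolding source_map_def by (simp add: sum_list_apply2 dual_scl) (simp add: dual_def)
  show ?thesis
  proof (cases "x \<in> E")
    case False
    have "(\<Sum>(\<alpha>, \<beta>)\<leftarrow>?ps. mul Hd \<psi> \<beta> \<one> * \<alpha> x) = (\<Sum>(\<alpha>, \<beta>)\<leftarrow>?ps. 0)"
      by (rule sum_list_cong_pairs[OF ps]) (simp add: dual_space_elems False)
    then show ?thesis
      using False * by (simp add: case_prod_unfold)
  next
    case x: True
    have "source_map Hd \<psi> x = (\<Sum>(\<alpha>, \<beta>)\<leftarrow>?ps. mul Hd \<psi> \<beta> \<one> * \<alpha> x)"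
      by (rule *)
    also have "\<dots> = (\<Sum>(\<alpha>, \<beta>)\<leftarrow>?ps. D (\<lambda>p q. \<psi> p * (\<alpha> x * \<beta> q)) \<one>)"
      by (rule sum_list_cong_pairs[OF ps])
        (simp add: dual_space_elems dual_mul lin D_times[symmetric] mult_ac)
    also have "\<dots> = D (\<lambda>p q. \<Sum>(\<alpha>, \<beta>)\<leftarrow>?ps. \<psi> p * (\<alpha> x * \<beta> q)) \<one>"
      by (rule D_sum_list)
    also have "\<dots> = D (\<lambda>p q. \<psi> p * \<epsilon> (x \<cdot> q)) \<one>"
    proof (intro D_cong refl)
      fix p q assume q: "q \<in> E"
      have "(\<Sum>(\<alpha>, \<beta>)\<leftarrow>ps. \<psi> p * (\<alpha> x * \<beta> q)) = \<psi> p * (\<Sum>(\<alpha>, \<beta>)\<leftarrow>ps. \<alpha> x * \<beta> q)" for ps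
        by (induction ps) (auto simp: algebra_simps)
      then show "(\<Sum>(\<alpha>, \<beta>)\<leftarrow>?ps. \<psi> p * (\<alpha> x * \<beta> q)) = \<psi> p * \<epsilon> (x \<cdot> q)"
        using ev[OF x q] by simp
    qed
    also have "\<dots> = \<psi> (\<sigma> x)"
      by (subst source_apply[OF lin x]) (simp add: mult.commute)
    finally show ?thesis using x by simp
  qed
qed

text \<open>
  The functional \<open>\<psi> = \<epsilon>(_ w)\<close> is in the source base of the dual because \<open>\<epsilon>(\<sigma>(x) w) = \<epsilon>(x w)\<close>. It
  is central because \<open>w\<close>, being in both bases, acts on either leg of a coproduct: for every functional
  \<open>\<phi>\<close>, both products with \<open>\<psi>\<close> send \<open>x\<close> to \<open>\<phi>(x w)\<close>.
\<close>

lemma connected_dual_trivial: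
  assumes con: "connected_wha Hd" and [simp]: "w \<in> E" and w: "\<sigma> w = w" "\<tau> w = w"
  shows "\<exists>c. w = scl H c \<one>"
proof -
  define \<psi> where "\<psi> x = (if x \<in> E then \<epsilon> (x \<cdot> w) else 0)" for x
  have lin: "lin \<psi>"
    unfolding \<psi>_def[abs_def] by (rule lin_restrict) (auto intro!: lins)
  then have \<psi>: "\<psi> \<in> elems Hd" by (auto simp: dual_elems \<psi>_def)
  have "source_map Hd \<psi> = \<psi>"
  proof (rule ext)
    fix x show "source_map Hd \<psi> x = \<psi> x"
    proof (cases "x \<in> E")
      case x [simp]: True
      have "source_map Hd \<psi> x = \<epsilon> (\<sigma> x \<cdot> w)"
        by (simp add: dual_source_map \<psi>) (simp add: \<psi>_def)
      also have "\<dots> = D (\<lambda>u v. \<epsilon> (x \<cdot> v) * \<epsilon> (u \<cdot> w)) \<one>"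
        by (rule source_apply) (auto intro!: lins)
      also have "\<dots> = \<psi> x" by (simp add: counit_unit2 \<psi>_def)
      finally show ?thesis .
    qed (simp add: dual_source_map \<psi>, simp add: \<psi>_def)
  qed
  then have "\<psi> \<in> source_base Hd"
    using \<psi> by (force simp: source_base_def)
  moreover have "mul Hd \<psi> \<phi> = mul Hd \<phi> \<psi>" if "\<phi> \<in> elems Hd" for \<phi>
  proof (rule ext)
    fix x
    have \<phi>: "lin \<phi>" using that by (simp add: dual_elems)
    note [lins] = lin_comp[OF \<phi>]
    show "mul Hd \<psi> \<phi> x = mul Hd \<phi> \<psi> x"
    proof (cases "x \<in> E")
      case x [simp]: True
      have "D (\<lambda>a b. \<psi> a * \<phi> b) x = D (\<lambda>a b. \<epsilon> (a \<cdot> \<tau> w) * \<phi> b) x"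
        by (intro D_cong refl) (simp add: \<psi>_def w)
      also have "\<dots> = D (\<lambda>a b. \<epsilon> a * \<phi> b) (x \<cdot> \<tau> w)"
        by (rule comul_mul_target[where f="\<lambda>a b. \<epsilon> a * \<phi> b", symmetric]) (auto intro!: lins bilI)
      also have "\<dots> = D (\<lambda>a b. \<phi> a * \<epsilon> b) (x \<cdot> \<sigma> w)"
        using \<phi> by (simp add: w D_counit_left D_counit_right)
      also have "\<dots> = D (\<lambda>a b. \<phi> a * \<epsilon> (b \<cdot> \<sigma> w)) x"
        by (rule comul_mul_source[where f="\<lambda>a b. \<phi> a * \<epsilon> b"]) (auto intro!: lins bilI)
      also have "\<dots> = D (\<lambda>a b. \<phi> a * \<psi> b) x"
        by (intro D_cong refl) (simp add: \<psi>_def w)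
      finally show ?thesis by (simp add: dual_mul lin \<phi>)
    qed (simp add: dual_mul lin \<phi>)
  qed
  then have "\<psi> \<in> center Hd" using \<psi> by (auto simp: center_def)
  ultimately obtain c where c: "\<psi> = scl Hd c (unit_elt Hd)"
    using con by (auto simp: connected_wha_def)
  have "w = scl H c \<one>"
  proof (rule lin_ext)
    fix f assume f: "lin f"
    note [lins] = lin_comp[OF f]
    \<comment> \<open>a functional of the form \<open>\<epsilon>(_ w)\<close> determines \<open>w\<close> by \<open>w = \<epsilon>(1\<^sub>1 w) 1\<^sub>2\<close>\<close>
    have "f w = D (\<lambda>a b. \<epsilon> a * f b) (\<one> \<cdot> \<tau> w)"
      using f by (simp add: w unit_left D_counit_left)
    also have "\<dots> = D (\<lambda>a b. \<epsilon> (a \<cdot> \<tau> w) * f b) \<one>"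
      by (rule comul_mul_target[where f="\<lambda>a b. \<epsilon> a * f b"]) (auto intro!: lins bilI)
    also have "\<dots> = D (\<lambda>a b. c * (\<epsilon> a * f b)) \<one>"
    proof (intro D_cong refl)
      fix a b assume "a \<in> E"
      then have "\<epsilon> (a \<cdot> w) = c * \<epsilon> a"
        using fun_cong[OF c, of a] by (simp add: \<psi>_def dual_scl dual_unit)
      then show "\<epsilon> (a \<cdot> \<tau> w) * f b = c * (\<epsilon> a * f b)" by (simp add: w)
    qed
    also have "\<dots> = f (scl H c \<one>)"
      using f by (simp add: D_times D_counit_left lin_scale)
    finally show "f w = f (scl H c \<one>)" .
  qed auto
  then show ?thesis ..
qed

text \<open>
  The vector \<open>w = u \<chi>(v)\<close> is fixed by \<open>\<sigma>\<close> because the first leg of \<open>\<Delta>(1)\<close> lies in the source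
  base. By the integral property at \<open>x = 1\<close> it equals \<open>S(u) \<chi>(v)\<close>, so it is fixed by \<open>\<tau>\<close> as well.
\<close>

lemma semisimple_dual:
  assumes con: "connected_wha Hd" and S2: "\<And>z. z \<in> E \<Longrightarrow> S (S (\<tau> z)) = \<tau> z"
    and tr: "(\<Sum>i\<in>B. coord i (S (S i))) \<noteq> 0"
  shows "semisimple Hd"
proof -
  let ?\<chi> = trace_functional
  note left = trace_functional_left[OF _ _ S2]
  define w where "w = (\<Sum>j\<in>B. scl H (\<Sum>i\<in>{\<one>}. D (\<lambda>p q. coord j p * ?\<chi> q) i) j)"
  have [simp]: "w \<in> E" by (simp add: w_def)
  have w: "f w = D (\<lambda>p q. f p * ?\<chi> q) \<one>" if "lin f" for f
    unfolding w_def by (subst apply_coordinates[OF that]) simp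
  have "\<sigma> w = w"
  proof (rule lin_ext)
    fix f assume f: "lin f"
    note [lins] = lin_comp[OF f]
    have "f (\<sigma> w) = D (\<lambda>u v. f (\<sigma> u) * ?\<chi> v) \<one>"
      by (rule w) (auto intro!: lins)
    also have "\<dots> = D (\<lambda>u v. f u * ?\<chi> v) \<one>"
      by (rule unit_source) (auto intro!: lins bilI)
    finally show "f (\<sigma> w) = f w" using w[OF f] by simp
  qed auto
  moreover have "\<tau> w = w"
  proof (rule lin_ext)
    fix f assume f: "lin f"
    note [lins] = lin_comp[OF f]
    have "f (\<tau> w) = D (\<lambda>u v. f (\<tau> u) * ?\<chi> v) \<one>"
      by (rule w) (auto intro!: lins)
    also have "\<dots> = D (\<lambda>u v. f (S u) * ?\<chi> v) \<one>"
      by (rule target_eq_antipode_unit[where f="\<lambda>u v. f u * ?\<chi> v"]) (auto intro!: lins bilI)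
    also have "\<dots> = D (\<lambda>u v. f (S u) * ?\<chi> (\<one> \<cdot> v)) \<one>"
      by (intro D_cong refl) (simp add: unit_left)
    also have "\<dots> = D (\<lambda>u v. f u * ?\<chi> v) \<one>"
      by (rule left[symmetric]) (auto intro: f)
    finally show "f (\<tau> w) = f w" using w[OF f] by simp
  qed auto
  ultimately obtain c where c: "w = scl H c \<one>"
    using connected_dual_trivial[OF con \<open>w \<in> E\<close>] by blast
  have "c * \<epsilon> \<one> = \<epsilon> w"
    using lin_scale[OF counit_linear] by (simp add: c)
  also have "\<dots> = ?\<chi> \<one>"
    by (simp add: w counit_linear D_counit_left lin_trace_functional)
  also have "\<dots> = (\<Sum>i\<in>B. coord i (S (S i)))"
    by (simp add: trace_functional_def unit_left)
  finally have "c \<noteq> 0" using tr by auto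
  moreover have "?\<chi> (\<tau> x) = c * \<epsilon> x" if [simp]: "x \<in> E" for x
  proof -
    have "?\<chi> (\<tau> x) = \<epsilon> (w \<cdot> x)"
      by (subst target_apply[OF lin_trace_functional], simp, subst w[where f="\<lambda>u. \<epsilon> (u \<cdot> x)"]) (auto intro!: lins)
    then show ?thesis
      using lin_scale[OF counit_linear] by (simp add: c mul_scale_left unit_left)
  qed
  ultimately show ?thesis
    using semisimple_dual_if_integral[OF lin_trace_functional S2 left] by blast
qed

end

section \<open>The trace criterion\<close>

text \<open>
  The basis is the one chosen in the definition of the trace, which makes the formula for the
  trace hold by definition.
\<close>

lemma finite_dim_basis:
  assumes "vspace V" "finite_dim V"
  obtains B where "finite B" "\<not> module.dependent (scl V) B" "module.span (scl V) B = elems V"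
    "trace_on V f = (\<Sum>b\<in>B. module.representation (scl V) B (f b) b)"
proof -
  interpret V: vector_space "scl V" using assms(1) by (rule vspace.ambient)
  obtain F where F: "finite F" "V.span F = elems V"
    using assms(2) by (auto simp: finite_dim_def)
  define B where "B = (SOME B. \<not> V.dependent B \<and> V.span B = elems V)"
  have "\<exists>B. \<not> V.dependent B \<and> V.span B = elems V"
    using V.maximal_independent_subset[of "elems V"] V.span_subspace vspace.subspace_elems[OF assms(1)]
    by metis
  then have B: "\<not> V.dependent B \<and> V.span B = elems V"
    unfolding B_def by (rule someI_ex)
  then have "B \<subseteq> V.span F"
    using F V.span_superset by auto
  then have "finite B"
    using V.independent_span_bound F B by blast
  then show ?thesis
    using that[of B] B by (simp add: trace_on_def B_def[symmetric])
qed

theorem corollary6p7: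
  fixes H :: "('k::{alg_closed_field, field_char_0}, 'v::ab_group_add) weak_hopf"
  assumes "weak_hopf_algebra H"
    and "finite_dim H"
    and "biconnected H"
    and "frobenius_algebra H"
    and "\<forall>x\<in>minimal_part H. antipode H (antipode H x) = x"
    and "trace_on H (\<lambda>x. antipode H (antipode H x)) \<noteq> 0"
  shows "semisimple H \<and> semisimple (dual H)"
proof -
  interpret W: weak_hopf_algebra H by fact
  obtain B where B: "finite B" "\<not> module.dependent (scl H) B" "module.span (scl H) B = elems H"
    "trace_on H (\<lambda>x. antipode H (antipode H x))
      = (\<Sum>b\<in>B. module.representation (scl H) B (antipode H (antipode H b)) b)"
    by (rule finite_dim_basis[OF W.vspace_axioms assms(2),
          where f="\<lambda>x. antipode H (antipode H x)"])
  interpret based_weak_hopf_algebra H B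
    by unfold_locales (rule B(1) B(2) B(3))+
  have S2: "S (S (\<tau> z)) = \<tau> z" if [simp]: "z \<in> E" for z
  proof -
    have "\<tau> z \<cdot>\<^bsub>H\<^esub> \<sigma> \<one> \<in> minimal_part H"
      unfolding minimal_part_def target_base_def source_base_def
      by (rule amb.span_base) (use that W.unit_closed in blast)
    then show ?thesis using assms(5) by (simp add: W.unit_right)
  qed
  have tr: "(\<Sum>i\<in>B. coord i (S (S i))) \<noteq> 0"
    using assms(6) B(4) by (simp add: coord_def)
  show ?thesis
    using semisimple_algebra[OF _ S2 tr] semisimple_dual[OF _ S2 tr] assms(3)
    by (simp add: biconnected_def)
qed

end
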